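(* Let $A$ be a finite alphabet and let $\vartheta:A\to A^+$ be a primitive substitution of constant length. Then: (i) $\mathrm{ac}(\sigma|_{X_\vartheta})=0$ if and only if $(X_\vartheta,\sigma)$ is finite. (ii) $1\le\underline{\mathrm{ac}}(\sigma|_{X_\vartheta})\le\overline{\mathrm{ac}}(\sigma|_{X_\vartheta})<\infty$ if and only if $(X_\vartheta,\sigma)$ has discrete spectrum and is infinite. (iii) $\mathrm{ac}(\sigma|_{X_\vartheta})=\infty$ if and only if $(X_\vartheta,\sigma)$ has partly continuous spectrum.
   Context: Let $A$ be a finite alphabet, $A^+$ the set of non-empty finite words over $A$, and $\Sigma=A^{\mathbb Z}$ with the product topology and the left shift $\sigma((x_n)_n)=(x_{n+1})_n$. A subshift is a pair $(X,\sigma)$ with $\emptyset\ne X\subseteq\Sigma$ closed and $\sigma(X)=X$; it is finite (infinite) if $X$ is a finite (infinite) set. It is minimal if $X$ has no non-empty proper closed subset $E$ with $\sigma(E)=E$. A substitution is a map $\vartheta:A\to A^+$, extended by concatenation to $A^+\to A^+$ and to $A^{\mathbb Z}\to A^{\mathbb Z}$ (with $\vartheta(x)=\dots\vartheta(x_{-1}).\vartheta(x_0)\vartheta(x_1)\dots$, the word $\vartheta(x_0)$ starting at coordinate $0$). It is primitive if for some $\ell>0$ and every $a\in A$ the word $\vartheta^\ell(a)$ contains every letter of $A$. It is of constant length $|\vartheta|=\ell$ if $\vartheta(a)\in A^\ell$ for all $a\in A$. For $\vartheta$ primitive, $X_\vartheta$ is the orbit closure $\overline{\{\sigma^k(x_0):k\in\mathbb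 Z\}}$ of a point $x_0\in A^{\mathbb Z}$ with $\vartheta^p(x_0)=x_0$ for some $p\in\mathbb N$, chosen so that this orbit closure is minimal; such points exist and $X_\vartheta$ does not depend on the choice. The subshift $(X_\vartheta,\sigma)$ has a unique $\sigma$-invariant Borel probability measure $\mu$. It has (purely) discrete spectrum if $L_2(X_\vartheta,\mu)$ has an orthonormal basis of eigenfunctions, i.e. functions $\varphi$ with $\varphi\circ\sigma=\lambda\varphi$ for some $\lambda\in\mathbb C$. It has partly continuous spectrum if it does not have (purely) discrete spectrum. Amorphic complexity: let $(X,\sigma)$ be a subshift and $d$ any metric inducing the product topology on $A^{\mathbb Z}$. For $\delta>0$ put $D_\delta(x,y)=\limsup_{n\to\infty}\frac1n\#\{0\le k\le n-1: d(\sigma^k(x),\sigma^k(y))\ge\delta\}$. For $\delta>0$, $\nu\in(0,1]$ let $\mathrm{Sep}(\sigma|_X,\delta,\nu)=\sup\{\#Y: Y\subseteq X,\ D_\delta(x,y)\ge\nu \text{ for all } x\ne y\text{ in }Y\}$. The lower and upper amorphic complexity are $\underline{\mathrm{ac}}(\sigma|_X)=\sup_{\delta>0}\liminf_{\nu\to0}\frac{\log\mathrm{Sep}(\sigma|_X,\delta,\nu)}{-\log\nu}$ and $\overline{\mathrm{ac}}(\sigma|_X)=\sup_{\delta>0}\limsup_{\nu\to0}\frac{\log\mathrm{Sep}(\sigma|_X,\delta,\nu)}{-\log\nu}$, with values in $[0,\infty]$; if they coincide, the common value is $\mathrm{ac}(\sigma|_X)$. (The assertion $\mathrm{ac}=c$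 includes that they coincide.) *)

theory Defs
  imports "HOL-Probability.Probability"
begin

section \<open>Subshifts\<close>

text \<open>The alphabet is an arbitrary (nonempty) finite type \<open>'a\<close>; a point of the full shift is a
  function \<open>int \<Rightarrow> 'a\<close>.\<close>

definition shift_topology :: "(int \<Rightarrow> 'a) topology" where
  "shift_topology = product_topology (\<lambda>_. discrete_topology UNIV) UNIV"

definition shift :: "(int \<Rightarrow> 'a) \<Rightarrow> int \<Rightarrow> 'a" where
  "shift x = (\<lambda>n. x (n + 1))"

definition subshift :: "(int \<Rightarrow> 'a) set \<Rightarrow> bool" where
  "subshift X \<longleftrightarrow> X \<noteq> {} \<and> closedin shift_topology X \<and> shift ` X = X"

definition minimal_subshift :: "(int \<Rightarrow> 'a) set \<Rightarrow> bool" where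
  "minimal_subshift X \<longleftrightarrow> subshift X \<and>
     (\<nexists>E. E \<noteq> {} \<and> E \<subset> X \<and> closedin shift_topology E \<and> shift ` E = E)"

text \<open>The \<open>k\<close>-th power of the shift, for \<open>k\<close> an integer, maps \<open>x\<close> to \<open>\<lambda>n. x (n + k)\<close>.\<close>

definition orbit_closure :: "(int \<Rightarrow> 'a) \<Rightarrow> (int \<Rightarrow> 'a) set" where
  "orbit_closure x = shift_topology closure_of range (\<lambda>k. \<lambda>n. x (n + k))"

section \<open>Substitutions\<close>

definition substitution :: "('a \<Rightarrow> 'a list) \<Rightarrow> bool" where
  "substitution \<theta> \<longleftrightarrow> (\<forall>a. \<theta> a \<noteq> [])"

definition constant_length :: "('a \<Rightarrow> 'a list) \<Rightarrow> bool" where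
  "constant_length \<theta> \<longleftrightarrow> (\<exists>l. \<forall>a. length (\<theta> a) = l)"

definition subst_word :: "('a \<Rightarrow> 'a list) \<Rightarrow> 'a list \<Rightarrow> 'a list" where
  "subst_word \<theta> w = concat (map \<theta> w)"

definition primitive :: "('a \<Rightarrow> 'a list) \<Rightarrow> bool" where
  "primitive \<theta> \<longleftrightarrow> (\<exists>l>0. \<forall>a. set ((subst_word \<theta> ^^ l) [a]) = UNIV)"

text \<open>\<open>subst_pos \<theta> x k\<close> is the coordinate at which the block \<open>\<theta> (x k)\<close> starts in \<open>\<theta> (x)\<close>. One of the
  two sums is always empty.\<close>

definition subst_pos :: "('a \<Rightarrow> 'a list) \<Rightarrow> (int \<Rightarrow> 'a) \<Rightarrow> int \<Rightarrow> int" where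
  "subst_pos \<theta> x k = (\<Sum>i\<in>{0..<k}. int (length (\<theta> (x i)))) - (\<Sum>i\<in>{k..<0}. int (length (\<theta> (x i))))"

text \<open>The bi-infinite concatenation \<open>\<dots>\<theta>(x\<^sub>-\<^sub>1).\<theta>(x\<^sub>0)\<theta>(x\<^sub>1)\<dots>\<close>; see \<open>subst_seq_nth\<close> below for the
  fact that the description is proper when all blocks are nonempty.\<close>

definition subst_seq :: "('a \<Rightarrow> 'a list) \<Rightarrow> (int \<Rightarrow> 'a) \<Rightarrow> int \<Rightarrow> 'a" where
  "subst_seq \<theta> x = (THE y. \<forall>k. \<forall>j<length (\<theta> (x k)). y (subst_pos \<theta> x k + int j) = \<theta> (x k) ! j)"

lemma subst_pos_0 [simp]: "subst_pos \<theta> x 0 = 0"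
  by (simp add: subst_pos_def)

lemma subst_pos_step: "subst_pos \<theta> x (k + 1) = subst_pos \<theta> x k + int (length (\<theta> (x k)))"
proof (cases "k \<ge> 0")
  case True
  then have "{0..<k + 1} = insert k {0..<k}" by auto
  with True show ?thesis by (simp add: subst_pos_def)
next
  case False
  then have "{k..<0} = insert k {k + 1..<0}" by auto
  with False show ?thesis by (simp add: subst_pos_def)
qed

lemma subst_pos_cover:
  assumes "substitution \<theta>"
  shows "\<exists>k j. j < length (\<theta> (x k)) \<and> n = subst_pos \<theta> x k + int j"
proof (induction n rule: int_induct[where k = 0])
  case base
  show ?case using assms
    by (intro exI[of _ "0::int"] exI[of _ "0::nat"]) (auto simp: substitution_def)
next
  case (step1 n)
  then obtain k j where kj: "j < length (\<theta> (x k))" "n = subst_pos \<theta> x k + int j" by blast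
  show ?case
  proof (cases "Suc j < length (\<theta> (x k))")
    case True
    then show ?thesis using kj by (intro exI[of _ k] exI[of _ "Suc j"]) auto
  next
    case False
    then show ?thesis using kj assms subst_pos_step[of \<theta> x k]
      by (intro exI[of _ "k + 1"] exI[of _ "0::nat"]) (auto simp: substitution_def)
  qed
next
  case (step2 n)
  then obtain k j where kj: "j < length (\<theta> (x k))" "n = subst_pos \<theta> x k + int j" by blast
  show ?case
  proof (cases j)
    case (Suc i)
    then show ?thesis using kj by (intro exI[of _ k] exI[of _ i]) auto
  next
    case 0
    have "length (\<theta> (x (k - 1))) > 0" using assms by (auto simp: substitution_def)
    then show ?thesis using kj 0 subst_pos_step[of \<theta> x "k - 1"]
      by (intro exI[of _ "k - 1"] exI[of _ "length (\<theta> (x (k - 1))) - 1"])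
        (auto simp: of_nat_diff Suc_le_eq)
  qed
qed

lemma subst_pos_mono: "k \<le> l \<Longrightarrow> subst_pos \<theta> x k \<le> subst_pos \<theta> x l"
proof (induction l rule: int_ge_induct)
  case (step i)
  then show ?case by (simp add: subst_pos_step)
qed simp

lemma subst_pos_unique:
  assumes "j < length (\<theta> (x k))" "j' < length (\<theta> (x k'))"
    and "subst_pos \<theta> x k + int j = subst_pos \<theta> x k' + int j'"
  shows "k = k'" "j = j'"
proof -
  have "\<not> k < k'" using subst_pos_mono[of "k + 1" k' \<theta> x] subst_pos_step[of \<theta> x k] assms by auto
  moreover have "\<not> k' < k"
    using subst_pos_mono[of "k' + 1" k \<theta> x] subst_pos_step[of \<theta> x k'] assms by auto
  ultimately show "k = k'" by simp
  with assms show "j = j'" by simp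
qed

lemma subst_seq_nth:
  assumes "substitution \<theta>" "j < length (\<theta> (x k))"
  shows "subst_seq \<theta> x (subst_pos \<theta> x k + int j) = \<theta> (x k) ! j"
proof -
  let ?P = "\<lambda>y. \<forall>k. \<forall>j<length (\<theta> (x k)). y (subst_pos \<theta> x k + int j) = \<theta> (x k) ! j"
  have "\<exists>!y. ?P y"
  proof (rule ex_ex1I)
    have "\<forall>n. \<exists>a. \<forall>k j. j < length (\<theta> (x k)) \<longrightarrow> n = subst_pos \<theta> x k + int j \<longrightarrow> a = \<theta> (x k) ! j"
    proof
      fix n
      obtain k j where "j < length (\<theta> (x k))" "n = subst_pos \<theta> x k + int j"
        using subst_pos_cover[OF assms(1)] by blast
      then show "\<exists>a. \<forall>k j. j < length (\<theta> (x k)) \<longrightarrow> n = subst_pos \<theta> x k + int j \<longrightarrow> a = \<theta> (x k) ! j"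
        by (intro exI[of _ "\<theta> (x k) ! j"]) (metis subst_pos_unique)
    qed
    then show "\<exists>y. ?P y" by metis
  next
    fix y z assume yz: "?P y" "?P z"
    show "y = z"
    proof
      fix n
      obtain k j where "j < length (\<theta> (x k))" "n = subst_pos \<theta> x k + int j"
        using subst_pos_cover[OF assms(1)] by blast
      with yz show "y n = z n" by simp
    qed
  qed
  from theI'[OF this] show ?thesis using assms(2) by (auto simp: subst_seq_def)
qed

text \<open>For primitive \<open>\<theta>\<close> a point as required exists and its orbit closure does not depend on the
  choice.\<close>

definition substitution_subshift :: "('a \<Rightarrow> 'a list) \<Rightarrow> (int \<Rightarrow> 'a) set" where
  "substitution_subshift \<theta> = orbit_closure
     (SOME x. (\<exists>p>0. (subst_seq \<theta> ^^ p) x = x) \<and> minimal_subshift (orbit_closure x))"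

section \<open>Discrete spectrum\<close>

text \<open>\<open>\<mu>\<close> is a shift-invariant Borel probability measure on the subshift \<open>X\<close>; in particular
  \<open>space \<mu> = X\<close>.\<close>

definition invariant_prob :: "(int \<Rightarrow> 'a) set \<Rightarrow> (int \<Rightarrow> 'a) measure \<Rightarrow> bool" where
  "invariant_prob X \<mu> \<longleftrightarrow> prob_space \<mu> \<and>
     sets \<mu> = sets (sigma X {U. openin (subtopology shift_topology X) U}) \<and>
     (\<forall>B\<in>sets \<mu>. emeasure \<mu> (shift -` B \<inter> X) = emeasure \<mu> B)"

text \<open>Elements of \<open>L\<^sub>2(\<mu>)\<close> are represented by functions, so equalities in \<open>L\<^sub>2(\<mu>)\<close> become equalities
  almost everywhere. An orthonormal set contains at most one representative of each class, because
  the inner product of two representatives of the same element is 1.\<close>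

definition L2 :: "'b measure \<Rightarrow> ('b \<Rightarrow> complex) set" where
  "L2 \<mu> = {f \<in> borel_measurable \<mu>. integrable \<mu> (\<lambda>x. (cmod (f x))\<^sup>2)}"

definition L2_inner :: "'b measure \<Rightarrow> ('b \<Rightarrow> complex) \<Rightarrow> ('b \<Rightarrow> complex) \<Rightarrow> complex" where
  "L2_inner \<mu> f g = (LINT x|\<mu>. f x * cnj (g x))"

definition L2_orthonormal_basis :: "'b measure \<Rightarrow> ('b \<Rightarrow> complex) set \<Rightarrow> bool" where
  "L2_orthonormal_basis \<mu> \<Phi> \<longleftrightarrow> \<Phi> \<subseteq> L2 \<mu> \<and>
     (\<forall>f\<in>\<Phi>. \<forall>g\<in>\<Phi>. L2_inner \<mu> f g = (if f = g then 1 else 0)) \<and>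
     (\<forall>h\<in>L2 \<mu>. \<forall>\<epsilon>>0. \<exists>F c. finite F \<and> F \<subseteq> \<Phi> \<and>
        (LINT x|\<mu>. (cmod (h x - (\<Sum>f\<in>F. c f * f x)))\<^sup>2) < \<epsilon>)"

definition eigenfunction :: "(int \<Rightarrow> 'a) measure \<Rightarrow> ((int \<Rightarrow> 'a) \<Rightarrow> complex) \<Rightarrow> bool" where
  "eigenfunction \<mu> f \<longleftrightarrow> f \<in> L2 \<mu> \<and> (\<exists>c. AE x in \<mu>. f (shift x) = c * f x)"

definition discrete_spectrum :: "(int \<Rightarrow> 'a) measure \<Rightarrow> bool" where
  "discrete_spectrum \<mu> \<longleftrightarrow> (\<exists>\<Phi>. L2_orthonormal_basis \<mu> \<Phi> \<and> (\<forall>f\<in>\<Phi>. eigenfunction \<mu> f))"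

definition partly_continuous_spectrum :: "(int \<Rightarrow> 'a) measure \<Rightarrow> bool" where
  "partly_continuous_spectrum \<mu> \<longleftrightarrow> \<not> discrete_spectrum \<mu>"

section \<open>Amorphic complexity\<close>

definition induces_shift_topology :: "((int \<Rightarrow> 'a) \<Rightarrow> (int \<Rightarrow> 'a) \<Rightarrow> real) \<Rightarrow> bool" where
  "induces_shift_topology d \<longleftrightarrow>
     Metric_space UNIV d \<and> Metric_space.mtopology UNIV d = shift_topology"

definition sep_density ::
    "((int \<Rightarrow> 'a) \<Rightarrow> (int \<Rightarrow> 'a) \<Rightarrow> real) \<Rightarrow> real \<Rightarrow> (int \<Rightarrow> 'a) \<Rightarrow> (int \<Rightarrow> 'a) \<Rightarrow> ereal" where
  "sep_density d \<delta> x y =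
     limsup (\<lambda>n. ereal (real (card {k\<in>{..<n}. d ((shift ^^ k) x) ((shift ^^ k) y) \<ge> \<delta>}) / real n))"

definition Sep ::
    "((int \<Rightarrow> 'a) \<Rightarrow> (int \<Rightarrow> 'a) \<Rightarrow> real) \<Rightarrow> (int \<Rightarrow> 'a) set \<Rightarrow> real \<Rightarrow> real \<Rightarrow> enat" where
  "Sep d X \<delta> \<nu> =
     (SUP Y \<in> {Y. Y \<subseteq> X \<and> (\<forall>x\<in>Y. \<forall>y\<in>Y. x \<noteq> y \<longrightarrow> sep_density d \<delta> x y \<ge> ereal \<nu>)}.
        if finite Y then enat (card Y) else \<infinity>)"

definition ln_enat :: "enat \<Rightarrow> ereal" where
  "ln_enat m = (case m of enat k \<Rightarrow> ereal (ln (real k)) | \<infinity> \<Rightarrow> \<infinity>)"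

definition lower_ac :: "((int \<Rightarrow> 'a) \<Rightarrow> (int \<Rightarrow> 'a) \<Rightarrow> real) \<Rightarrow> (int \<Rightarrow> 'a) set \<Rightarrow> ereal" where
  "lower_ac d X = (SUP \<delta>\<in>{0<..}. Liminf (at_right 0) (\<lambda>\<nu>. ln_enat (Sep d X \<delta> \<nu>) / ereal (- ln \<nu>)))"

definition upper_ac :: "((int \<Rightarrow> 'a) \<Rightarrow> (int \<Rightarrow> 'a) \<Rightarrow> real) \<Rightarrow> (int \<Rightarrow> 'a) set \<Rightarrow> ereal" where
  "upper_ac d X = (SUP \<delta>\<in>{0<..}. Limsup (at_right 0) (\<lambda>\<nu>. ln_enat (Sep d X \<delta> \<nu>) / ereal (- ln \<nu>)))"

definition has_ac ::
    "((int \<Rightarrow> 'a) \<Rightarrow> (int \<Rightarrow> 'a) \<Rightarrow> real) \<Rightarrow> (int \<Rightarrow> 'a) set \<Rightarrow> ereal \<Rightarrow> bool" where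
  "has_ac d X c \<longleftrightarrow> lower_ac d X = c \<and> upper_ac d X = c"

end

theory Submission
  imports Defs
begin

text \<open>
  A power of \<open>\<theta>\<close> fixes a point \<open>x\<close> whose orbit closure is the subshift \<open>X\<close>. The proof uses only two
  properties of \<open>x\<close>, collected in the locale \<open>self_similar\<close>: for some \<open>l \<ge> 2\<close> the block of length \<open>l ^ n\<close>
  at position \<open>l ^ n * i\<close> depends only on the letter at \<open>i\<close>, and each word recurs in \<open>x\<close> with bounded gaps.
  Consequently, level-\<open>n\<close> blocks over a given word occur with a frequency that does not depend on \<open>n\<close>.

  If \<open>X\<close> is finite, then the separation numbers are bounded and the complexity is 0. If \<open>X\<close> is infinite,
  then \<open>x\<close> is not periodic, and \<open>x\<close> differs from its shift by \<open>k \<le> l ^ n\<close> once in every window of length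
  \<open>L l ^ n\<close> (\<open>aperiodic_often_differ\<close>). So \<open>l ^ n\<close> points are separated at scale \<open>1 / (L l ^ n)\<close>, and the lower
  complexity is at least 1.

  For the spectrum fix \<open>k > 0\<close> such that two equal letters lie at distance \<open>k\<close>, and ask whether all pairs of
  letters at distances \<open>k l ^ n\<close> have a coincidence, that is, whether they have the same letter at some place of
  their images under an iterate.

  \<^item> With coincidences, the proportion of mismatches between \<open>x\<close> and its shifts by multiples of \<open>k l ^ n\<close> decays
    geometrically along some arithmetic progression of levels \<open>n\<close> (\<open>coincident_decay\<close>). Up to this error, a
    point of \<open>X\<close> is determined by its time modulo \<open>m = k l ^ n\<close>. Hence at most \<open>m\<close> points
    are separated at this scale, and the upper complexity is finite. For the same reason every cylinder is
    approximated by a set that is invariant under the \<open>m\<close>-th power of the shift, and finite Fourier analysis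
    turns this into a basis of eigenfunctions whose eigenvalues are roots of unity.
  \<^item> Without coincidences, each point \<open>y\<close> and its shift by \<open>k l ^ n\<close> differ with a frequency bounded below for all
    large \<open>n\<close> (\<open>not_coincident_often_differ\<close>). On the other hand \<open>y\<close> and this shift run through the same
    level-\<open>n\<close> block with positive frequency, by the choice of \<open>k\<close>. As measurable functions are almost
    functions of finitely many coordinates, each of them nearly returns on a set of \<open>y\<close> of measure bounded below
    (\<open>often_L2_return\<close>). Applied to an eigenfunction with eigenvalue \<open>\<omega>\<close>, this shows
    that \<open>\<omega> ^ (k l ^ n)\<close> tends to 1, which is incompatible with discrete spectrum. Applied to the index of a ball
    in a finite cover of \<open>X\<close> by small balls for the density of differences, it shows that there is no
    such cover; so infinitely many points are separated at one scale and the complexity is infinite.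
\<close>

section \<open>The shift topology\<close>

definition translate :: "int \<Rightarrow> (int \<Rightarrow> 'a) \<Rightarrow> int \<Rightarrow> 'a" where
  "translate t y = (\<lambda>n. y (n + t))"

lemma translate_nth: "translate t y n = y (n + t)"
  by (simp add: translate_def)

lemma translate_translate [simp]: "translate s (translate t y) = translate (s + t) y"
  by (simp add: translate_def fun_eq_iff ac_simps)

lemma translate_0 [simp]: "translate 0 y = y"
  by (simp add: translate_def)

lemma shift_eq_translate: "shift = translate 1"
  by (simp add: shift_def translate_def fun_eq_iff)

lemma shift_funpow: "(shift ^^ k) y = translate (int k) y"
  by (induction k) (simp_all add: shift_eq_translate)

text \<open>Points that agree on a window around 0. The windows give a neighbourhood base, so that topological
  statements become statements about finite windows.\<close>

definition agree :: "nat \<Rightarrow> (int \<Rightarrow> 'a) \<Rightarrow> (int \<Rightarrow> 'a) \<Rightarrow> bool" where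
  "agree R y z \<longleftrightarrow> (\<forall>i. \<bar>i\<bar> \<le> int R \<longrightarrow> y i = z i)"

lemma agree_refl [simp]: "agree R y y"
  by (simp add: agree_def)

lemma agree_sym: "agree R y z \<Longrightarrow> agree R z y"
  by (simp add: agree_def)

lemma agree_trans: "agree R y z \<Longrightarrow> agree R z w \<Longrightarrow> agree R y w"
  by (simp add: agree_def)

lemma agree_mono: "agree R y z \<Longrightarrow> R' \<le> R \<Longrightarrow> agree R' y z"
  by (auto simp: agree_def)

lemma agree_translate:
  "agree R y z \<Longrightarrow> R' + nat \<bar>t\<bar> \<le> R \<Longrightarrow> agree R' (translate t y) (translate t z)"
  unfolding agree_def translate_nth
proof (intro allI impI)
  fix i
  assume *: "\<forall>i. \<bar>i\<bar> \<le> int R \<longrightarrow> y i = z i" "R' + nat \<bar>t\<bar> \<le> R" "\<bar>i\<bar> \<le> int R'"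
  then have "\<bar>i + t\<bar> \<le> int R" by linarith
  then show "y (i + t) = z (i + t)" using * by blast
qed

lemma topspace_shift_topology [simp]: "topspace shift_topology = UNIV"
  by (simp add: shift_topology_def)

lemma openin_shift_topology:
  "openin shift_topology U \<longleftrightarrow> (\<forall>y\<in>U. \<exists>R. \<forall>z. agree R y z \<longrightarrow> z \<in> U)"
proof
  assume U: "openin shift_topology U"
  show "\<forall>y\<in>U. \<exists>R. \<forall>z. agree R y z \<longrightarrow> z \<in> U"
  proof
    fix y assume "y \<in> U"
    then obtain V where V: "finite {i. V i \<noteq> UNIV}" "y \<in> Pi\<^sub>E UNIV V" "Pi\<^sub>E UNIV V \<subseteq> U"
      using U unfolding shift_topology_def openin_product_topology_alt by auto
    define R where "R = Max (insert 0 ((\<lambda>i. nat \<bar>i\<bar>) ` {i. V i \<noteq> UNIV}))"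
    have R: "\<bar>i\<bar> \<le> int R" if "V i \<noteq> UNIV" for i
    proof -
      have "nat \<bar>i\<bar> \<le> R" unfolding R_def using V(1) that by (intro Max_ge) auto
      then show ?thesis by linarith
    qed
    have "z \<in> U" if "agree R y z" for z
    proof -
      have "z i \<in> V i" for i
      proof (cases "V i = UNIV")
        case False
        then have "z i = y i" using R that unfolding agree_def by metis
        then show ?thesis using V(2) by auto
      qed simp
      then show ?thesis using V(3) by auto
    qed
    then show "\<exists>R. \<forall>z. agree R y z \<longrightarrow> z \<in> U" by blast
  qed
next
  assume *: "\<forall>y\<in>U. \<exists>R. \<forall>z. agree R y z \<longrightarrow> z \<in> U"
  show "openin shift_topology U"
    unfolding shift_topology_def openin_product_topology_alt
  proof (intro conjI ballI)
    fix y assume "y \<in> U"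
    then obtain R where R: "\<And>z. agree R y z \<Longrightarrow> z \<in> U" using * by blast
    define V where "V i = (if \<bar>i\<bar> \<le> int R then {y i} else UNIV)" for i
    have "{i. V i \<noteq> UNIV} \<subseteq> {- int R..int R}" by (auto simp: V_def)
    then have "finite {i. V i \<noteq> UNIV}" by (rule finite_subset) simp
    moreover have "Pi\<^sub>E UNIV V \<subseteq> U"
    proof
      fix z assume "z \<in> Pi\<^sub>E UNIV V"
      then have "\<And>i. z i \<in> V i" by auto
      then have "z i = y i" if "\<bar>i\<bar> \<le> int R" for i
        using that V_def[of i] \<open>\<And>i. z i \<in> V i\<close>[of i] by simp
      then have "agree R y z" unfolding agree_def by simp
      then show "z \<in> U" by (rule R)
    qed
    ultimately show "\<exists>W. finite {i \<in> UNIV. W i \<noteq> topspace (discrete_topology UNIV)} \<and>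
        (\<forall>i\<in>UNIV. openin (discrete_topology UNIV) (W i)) \<and> y \<in> Pi\<^sub>E UNIV W \<and> Pi\<^sub>E UNIV W \<subseteq> U"
      by (intro exI[of _ V]) (auto simp: V_def)
  qed
qed

lemma closedin_shift_topology:
  "closedin shift_topology E \<longleftrightarrow> (\<forall>w. (\<forall>R. \<exists>z\<in>E. agree R w z) \<longrightarrow> w \<in> E)"
  unfolding closedin_def openin_shift_topology topspace_shift_topology by blast

lemma closedin_UNIV_shift_topology: "closedin shift_topology UNIV"
  using closedin_topspace[of shift_topology] by simp

lemma in_closure_of_shift_topology:
  "y \<in> shift_topology closure_of S \<longleftrightarrow> (\<forall>R. \<exists>z\<in>S. agree R y z)"
proof
  assume y: "y \<in> shift_topology closure_of S"
  show "\<forall>R. \<exists>z\<in>S. agree R y z"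
  proof
    fix R
    have "openin shift_topology {z. agree R y z}"
      unfolding openin_shift_topology using agree_trans by blast
    moreover have "y \<in> {z. agree R y z}" by simp
    ultimately show "\<exists>z\<in>S. agree R y z"
      using y unfolding in_closure_of by blast
  qed
next
  assume *: "\<forall>R. \<exists>z\<in>S. agree R y z"
  show "y \<in> shift_topology closure_of S"
    unfolding in_closure_of openin_shift_topology using * by (metis UNIV_I topspace_shift_topology)
qed

lemma compact_space_shift_topology:
  "compact_space (shift_topology :: (int \<Rightarrow> 'a::finite) topology)"
  unfolding shift_topology_def compact_space_product_topology
  by (auto simp: compact_space_discrete_topology)

text \<open>Compactness, in the form in which it is used: a choice of a window around each point
  covers a closed set by finitely many cylinders.\<close>

lemma finite_cylinder_cover:
  fixes E :: "(int \<Rightarrow> 'a::finite) set"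
  assumes "closedin shift_topology E"
  obtains F where "finite F" "F \<subseteq> E" "\<And>y. y \<in> E \<Longrightarrow> \<exists>z\<in>F. agree (r z) z y"
proof -
  have comp: "compactin shift_topology E"
    using assms compact_space_shift_topology by (rule closedin_compact_space[rotated])
  have "\<And>U. U \<in> (\<lambda>z. {y. agree (r z) z y}) ` E \<Longrightarrow> openin shift_topology U"
    unfolding openin_shift_topology using agree_trans by blast
  moreover have "E \<subseteq> \<Union>((\<lambda>z. {y. agree (r z) z y}) ` E)" by auto
  ultimately have "\<exists>\<F>. finite \<F> \<and> \<F> \<subseteq> (\<lambda>z. {y. agree (r z) z y}) ` E \<and> E \<subseteq> \<Union>\<F>"
    by (rule compactinD[OF comp])
  then obtain \<F> where F: "finite \<F>" "\<F> \<subseteq> (\<lambda>z. {y. agree (r z) z y}) ` E" "E \<subseteq> \<Union>\<F>"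
    by blast
  then obtain F where "finite F" "F \<subseteq> E" "\<F> = (\<lambda>z. {y. agree (r z) z y}) ` F"
    by (meson finite_subset_image)
  then show ?thesis using F by (intro that[of F]) auto
qed

lemma in_orbit_closure: "y \<in> orbit_closure x \<longleftrightarrow> (\<forall>R. \<exists>t. agree R y (translate t x))"
  unfolding orbit_closure_def in_closure_of_shift_topology by (auto simp: translate_def)

lemma closedin_orbit_closure: "closedin shift_topology (orbit_closure x)"
  by (simp add: orbit_closure_def)

lemma translate_in_orbit_closure:
  assumes "y \<in> orbit_closure x" shows "translate s y \<in> orbit_closure x"
  unfolding in_orbit_closure
proof
  fix R
  obtain t where "agree (R + nat \<bar>s\<bar>) y (translate t x)" using assms in_orbit_closure by blast
  then have "agree R (translate s y) (translate s (translate t x))" by (rule agree_translate) simp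
  then show "\<exists>t. agree R (translate s y) (translate t x)" by auto
qed

lemma self_in_orbit_closure: "x \<in> orbit_closure x"
  unfolding in_orbit_closure by (metis agree_refl translate_0)

lemma orbit_in_orbit_closure: "translate s x \<in> orbit_closure x"
  by (rule translate_in_orbit_closure[OF self_in_orbit_closure])

lemma subshift_orbit_closure: "subshift (orbit_closure x)"
proof -
  have "shift ` orbit_closure x = orbit_closure x"
  proof
    show "shift ` orbit_closure x \<subseteq> orbit_closure x"
      unfolding shift_eq_translate using translate_in_orbit_closure by blast
    show "orbit_closure x \<subseteq> shift ` orbit_closure x"
    proof
      fix y assume "y \<in> orbit_closure x"
      then have "translate (-1) y \<in> orbit_closure x" by (rule translate_in_orbit_closure)
      then show "y \<in> shift ` orbit_closure x"
        unfolding shift_eq_translate by (intro image_eqI[of _ _ "translate (-1) y"]) auto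
    qed
  qed
  then show ?thesis
    unfolding subshift_def using closedin_orbit_closure self_in_orbit_closure by blast
qed

lemma translate_in_invariant:
  assumes "shift ` E = E" "y \<in> E" shows "translate t y \<in> E"
proof (induction t rule: int_induct[where k = 0])
  case base
  then show ?case using assms by simp
next
  case (step1 t)
  have "shift (translate t y) \<in> E" using step1 assms by blast
  then show ?case by (simp only: shift_eq_translate translate_translate add.commute)
next
  case (step2 t)
  then obtain z where z: "z \<in> E" "translate t y = shift z" using assms by blast
  then have "z = translate (-1) (translate t y)" by (simp only: shift_eq_translate translate_translate) simp
  then show ?case using z(1) by simp
qed

section \<open>Uniform recurrence and minimality\<close>

definition uniformly_recurrent :: "(int \<Rightarrow> 'a) \<Rightarrow> bool" where
  "uniformly_recurrent x \<longleftrightarrow> (\<forall>u r. \<exists>L. \<forall>a. \<exists>t. a \<le> t \<and> t < a + L \<and>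
     (\<forall>i. 0 \<le> i \<and> i \<le> r \<longrightarrow> x (t + i) = x (u + i)))"

text \<open>Every point of the orbit closure contains each word of \<open>x\<close>, so the orbit of each of these points
  comes arbitrarily near to all the others.\<close>

lemma uniformly_recurrent_imp_minimal:
  assumes "uniformly_recurrent x" shows "minimal_subshift (orbit_closure x)"
  unfolding minimal_subshift_def
proof (intro conjI subshift_orbit_closure notI)
  assume "\<exists>E. E \<noteq> {} \<and> E \<subset> orbit_closure x \<and> closedin shift_topology E \<and> shift ` E = E"
  then obtain E where E: "E \<noteq> {}" "E \<subset> orbit_closure x" "closedin shift_topology E" "shift ` E = E"
    by blast
  from E obtain y where y: "y \<in> E" "y \<in> orbit_closure x" by blast
  have "w \<in> E" if w: "w \<in> orbit_closure x" for w
  proof -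
    have "\<exists>z\<in>E. agree R w z" for R
    proof -
      obtain t where t: "agree R w (translate t x)" using w in_orbit_closure by blast
      obtain L where L: "\<And>a. \<exists>s. a \<le> s \<and> s < a + L \<and>
          (\<forall>i. 0 \<le> i \<and> i \<le> 2 * int R \<longrightarrow> x (s + i) = x (t - int R + i))"
        using assms unfolding uniformly_recurrent_def by metis
      obtain t' where t': "agree (nat \<bar>L\<bar> + 2 * R) y (translate t' x)"
        using y in_orbit_closure by blast
      obtain s where s: "t' \<le> s" "s < t' + L"
        "\<And>i. 0 \<le> i \<Longrightarrow> i \<le> 2 * int R \<Longrightarrow> x (s + i) = x (t - int R + i)"
        using L[of t'] by blast
      have "agree R w (translate (s - t' + int R) y)"
        unfolding agree_def translate_nth
      proof (intro allI impI)
        fix i :: int assume i: "\<bar>i\<bar> \<le> int R"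
        have "w i = x (i + t)" using t i by (simp add: agree_def translate_nth)
        also have "\<dots> = x (s + (i + int R))" using s(3)[of "i + int R"] i by (simp add: algebra_simps)
        also have "\<dots> = y (i + (s - t' + int R))"
        proof -
          have "\<bar>i + (s - t' + int R)\<bar> \<le> int (nat \<bar>L\<bar> + 2 * R)" using i s by auto
          then have "y (i + (s - t' + int R)) = translate t' x (i + (s - t' + int R))"
            using t' unfolding agree_def by blast
          then show ?thesis by (simp add: translate_nth algebra_simps)
        qed
        finally show "w i = y (i + (s - t' + int R))" .
      qed
      then show ?thesis using translate_in_invariant[OF E(4) y(1)] by blast
    qed
    then show ?thesis using E(3) unfolding closedin_shift_topology by blast
  qed
  then show False using E(2) by blast
qed

text \<open>By minimality every orbit meets the cylinder of a given word; by compactness it does so within a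
  bounded time.\<close>

lemma minimal_imp_uniformly_recurrent:
  fixes x :: "int \<Rightarrow> 'a::finite"
  assumes "minimal_subshift (orbit_closure x)" shows "uniformly_recurrent x"
  unfolding uniformly_recurrent_def
proof (intro allI)
  fix u r :: int
  let ?X = "orbit_closure x"
  define occ where "occ y t \<longleftrightarrow> (\<forall>i. 0 \<le> i \<and> i \<le> r \<longrightarrow> y (t + i) = x (u + i))" for y t
  \<comment> \<open>The points in which the word never occurs form a closed invariant set without \<open>x\<close>.\<close>
  define E where "E = {y \<in> ?X. \<forall>t. \<not> occ y t}"
  have occ_agree: "occ z t" if "occ y t" "agree (nat (\<bar>t\<bar> + \<bar>r\<bar>)) y z" for y z t
    unfolding occ_def
  proof (intro allI impI)
    fix i assume i: "0 \<le> i \<and> i \<le> r"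
    then have "\<bar>t + i\<bar> \<le> int (nat (\<bar>t\<bar> + \<bar>r\<bar>))" by auto
    then have "y (t + i) = z (t + i)" using that(2) unfolding agree_def by blast
    then show "z (t + i) = x (u + i)" using that(1) i unfolding occ_def by metis
  qed
  have occ_translate: "occ (translate s y) t \<longleftrightarrow> occ y (s + t)" for s y t
    unfolding occ_def translate_nth by (simp add: algebra_simps)
  have "closedin shift_topology E"
    unfolding closedin_shift_topology
  proof (intro allI impI)
    fix w assume w: "\<forall>R. \<exists>z\<in>E. agree R w z"
    then have "w \<in> ?X" using closedin_orbit_closure[of x] unfolding closedin_shift_topology E_def by blast
    moreover have "\<not> occ w t" for t
      using w occ_agree[of w t] unfolding E_def by blast
    ultimately show "w \<in> E" by (simp add: E_def)
  qed
  moreover have "shift ` E = E"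
  proof
    show "shift ` E \<subseteq> E"
      unfolding E_def shift_eq_translate using translate_in_orbit_closure by (auto simp: occ_translate)
    show "E \<subseteq> shift ` E"
    proof
      fix y assume "y \<in> E"
      then have "translate (-1) y \<in> E"
        unfolding E_def using translate_in_orbit_closure by (auto simp: occ_translate)
      then show "y \<in> shift ` E"
        unfolding shift_eq_translate by (intro image_eqI[of _ _ "translate (-1) y"]) auto
    qed
  qed
  moreover have "x \<in> ?X" "x \<notin> E"
    using self_in_orbit_closure by (auto simp: E_def occ_def)
  ultimately have "E = {}"
    using assms unfolding minimal_subshift_def E_def by blast
  then have "\<forall>y\<in>?X. \<exists>t. occ y t" by (auto simp: E_def)
  then obtain \<tau> where \<tau>: "\<And>y. y \<in> ?X \<Longrightarrow> occ y (\<tau> y)" by metis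
  obtain F where F: "finite F" "F \<subseteq> ?X" "\<And>y. y \<in> ?X \<Longrightarrow> \<exists>z\<in>F. agree (nat (\<bar>\<tau> z\<bar> + \<bar>r\<bar>)) z y"
    using finite_cylinder_cover[OF closedin_orbit_closure, of x "\<lambda>z. nat (\<bar>\<tau> z\<bar> + \<bar>r\<bar>)"] by blast
  define B where "B = Max (insert 0 ((\<lambda>z. \<bar>\<tau> z\<bar>) ` F))"
  have B: "\<bar>\<tau> z\<bar> \<le> B" if "z \<in> F" for z
    unfolding B_def using F(1) that by (intro Max_ge) auto
  show "\<exists>L. \<forall>a. \<exists>t. a \<le> t \<and> t < a + L \<and> (\<forall>i. 0 \<le> i \<and> i \<le> r \<longrightarrow> x (t + i) = x (u + i))"
  proof (rule exI[of _ "2 * B + 1"], rule allI)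
    fix a
    obtain z where z: "z \<in> F" "agree (nat (\<bar>\<tau> z\<bar> + \<bar>r\<bar>)) z (translate (a + B) x)"
      using F(3)[OF orbit_in_orbit_closure] by blast
    then have "occ (translate (a + B) x) (\<tau> z)" using \<tau> F(2) occ_agree by blast
    then have "occ x (a + B + \<tau> z)" by (simp add: occ_translate)
    then show "\<exists>t. a \<le> t \<and> t < a + (2 * B + 1) \<and> (\<forall>i. 0 \<le> i \<and> i \<le> r \<longrightarrow> x (t + i) = x (u + i))"
      using B[OF z(1)] unfolding occ_def by (intro exI[of _ "a + B + \<tau> z"]) auto
  qed
qed

section \<open>Metrics of the shift topology\<close>

lemma induces_openin:
  assumes "induces_shift_topology d"
  shows "openin shift_topology U \<longleftrightarrow> (\<forall>y\<in>U. \<exists>r>0. \<forall>z. d y z < r \<longrightarrow> z \<in> U)"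
proof -
  interpret Metric_space UNIV d using assms by (simp add: induces_shift_topology_def)
  have *: "shift_topology = mtopology" using assms by (simp add: induces_shift_topology_def)
  show ?thesis unfolding * openin_mtopology subset_eq Ball_def in_mball by simp
qed

lemma ball_contains_cylinder:
  assumes "induces_shift_topology d" "r > 0"
  shows "\<exists>R. \<forall>z. agree R y z \<longrightarrow> d y z < r"
proof -
  interpret Metric_space UNIV d using assms by (simp add: induces_shift_topology_def)
  have "openin mtopology (mball y r)" by simp
  then have "openin shift_topology (mball y r)"
    using assms by (metis induces_shift_topology_def)
  moreover have "y \<in> mball y r" using assms(2) by simp
  ultimately have "\<exists>R. \<forall>z. agree R y z \<longrightarrow> z \<in> mball y r"
    unfolding openin_shift_topology by blast
  then show ?thesis by simp
qed

text \<open>This lemma and the next reduce the separation of orbits in an arbitrary compatible metric to the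
  density of the places where two sequences differ. Both are uniformity statements that hold by
  compactness.\<close>

lemma metric_separates_coordinate_0:
  fixes d :: "(int \<Rightarrow> 'a::finite) \<Rightarrow> (int \<Rightarrow> 'a) \<Rightarrow> real"
  assumes "induces_shift_topology d"
  obtains \<delta> where "\<delta> > 0" "\<And>y z. y 0 \<noteq> z 0 \<Longrightarrow> \<delta> \<le> d y z"
proof -
  interpret Metric_space UNIV d using assms by (simp add: induces_shift_topology_def)
  have "\<exists>r>0. \<forall>z. d y z < r \<longrightarrow> z 0 = y 0" for y
  proof -
    have "openin shift_topology {z. z 0 = y 0}"
      unfolding openin_shift_topology by (auto simp: agree_def intro!: exI[of _ 0])
    then show ?thesis using induces_openin[OF assms] by auto
  qed
  then obtain r where r: "\<And>y. r y > 0" "\<And>y z. d y z < r y \<Longrightarrow> z 0 = y 0" by metis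
  have "\<exists>R. \<forall>z. agree R y z \<longrightarrow> d y z < r y / 2" for y
    using ball_contains_cylinder[OF assms, of "r y / 2" y] r(1)[of y] by simp
  then obtain \<rho> where \<rho>: "\<And>y z. agree (\<rho> y) y z \<Longrightarrow> d y z < r y / 2" by metis
  obtain F where F: "finite F" "\<And>y. \<exists>z\<in>F. agree (\<rho> z) z y"
    by (rule finite_cylinder_cover[OF closedin_UNIV_shift_topology, of \<rho>]) simp
  have "F \<noteq> {}" using F(2) by blast
  define \<delta> where "\<delta> = Min ((\<lambda>z. r z / 2) ` F)"
  show ?thesis
  proof (rule that[of \<delta>])
    show "\<delta> > 0" unfolding \<delta>_def using F(1) \<open>F \<noteq> {}\<close> r(1) by simp
    fix y z :: "int \<Rightarrow> 'a" assume yz: "y 0 \<noteq> z 0"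
    obtain w where w: "w \<in> F" "agree (\<rho> w) w y" using F(2) by blast
    have "\<delta> \<le> r w / 2" unfolding \<delta>_def using F(1) w(1) by (intro Min_le) auto
    moreover have "d w y < r w / 2" using \<rho> w(2) by blast
    moreover have "\<not> d w z < r w" using r(2)[of w z] r(2)[of w y] \<open>d w y < r w / 2\<close> r(1)[of w] yz by force
    moreover have "d w z \<le> d w y + d y z" by (rule triangle) auto
    ultimately show "\<delta> \<le> d y z" by linarith
  qed
qed

lemma metric_uniform_window:
  fixes d :: "(int \<Rightarrow> 'a::finite) \<Rightarrow> (int \<Rightarrow> 'a) \<Rightarrow> real"
  assumes "induces_shift_topology d" "\<delta> > 0"
  obtains R where "\<And>y z. agree R y z \<Longrightarrow> d y z < \<delta>"
proof -
  interpret Metric_space UNIV d using assms by (simp add: induces_shift_topology_def)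
  have "\<exists>R. \<forall>z. agree R y z \<longrightarrow> d y z < \<delta> / 2" for y
    using ball_contains_cylinder[OF assms(1), of "\<delta> / 2" y] assms(2) by simp
  then obtain \<rho> where \<rho>: "\<And>y z. agree (\<rho> y) y z \<Longrightarrow> d y z < \<delta> / 2" by metis
  obtain F where F: "finite F" "\<And>y. \<exists>z\<in>F. agree (\<rho> z) z y"
    by (rule finite_cylinder_cover[OF closedin_UNIV_shift_topology, of \<rho>]) simp
  define R where "R = Max (insert 0 (\<rho> ` F))"
  show ?thesis
  proof (rule that[of R])
    fix y z :: "int \<Rightarrow> 'a" assume yz: "agree R y z"
    obtain w where w: "w \<in> F" "agree (\<rho> w) w y" using F(2) by blast
    have "\<rho> w \<le> R" unfolding R_def using F(1) w(1) by (intro Max_ge) auto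
    then have "agree (\<rho> w) w z" using agree_trans[OF w(2) agree_mono[OF yz]] by blast
    then have "d w y < \<delta> / 2" "d w z < \<delta> / 2" using \<rho> w(2) by auto
    moreover have "d y z \<le> d y w + d w z" by (rule triangle) auto
    moreover have "d y w = d w y" by (rule commute)
    ultimately show "d y z < \<delta>" by linarith
  qed
qed

section \<open>Self-similar points\<close>

text \<open>All that is used of a substitution of constant length \<open>l\<close> and its subshift: a point \<open>x\<close> in which the block
  of length \<open>l\<close> at position \<open>l * i\<close> depends only on the letter at \<open>i\<close>, and which is uniformly recurrent.\<close>

locale self_similar =
  fixes x :: "int \<Rightarrow> 'a::finite" and l :: int
  assumes l_ge_2: "2 \<le> l"
    and step: "x i = x i' \<Longrightarrow> 0 \<le> j \<Longrightarrow> j < l \<Longrightarrow> x (l * i + j) = x (l * i' + j)"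
    and recurrent: "uniformly_recurrent x"

lemma next_multiple:
  fixes A P :: int
  assumes "P > 0"
  obtains k where "A \<le> P * k" "P * k \<le> A + P"
proof -
  have "P * (A div P) + A mod P = A" "0 \<le> A mod P" "A mod P < P"
    using assms by auto
  then have "A \<le> P * (A div P + 1)" "P * (A div P + 1) \<le> A + P"
    unfolding distrib_left by linarith+
  then show ?thesis by (rule that)
qed

section \<open>From substitutions to self-similar points\<close>

definition letter :: "('a \<Rightarrow> 'a list) \<Rightarrow> nat \<Rightarrow> 'a \<Rightarrow> nat \<Rightarrow> 'a" where
  "letter \<theta> n a j = (subst_word \<theta> ^^ n) [a] ! j"

locale const_subst =
  fixes \<theta> :: "'a \<Rightarrow> 'a list" and q :: nat
  assumes len: "\<And>a. length (\<theta> a) = q" and q_pos: "0 < q"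
begin

lemma length_subst_word: "length (subst_word \<theta> w) = q * length w"
  by (induction w) (simp_all add: subst_word_def len)

lemma length_subst_word_pow: "length ((subst_word \<theta> ^^ n) w) = q ^ n * length w"
  by (induction n) (simp_all add: length_subst_word)

lemma subst_word_nth:
  assumes "k < length w" "j < q"
  shows "subst_word \<theta> w ! (q * k + j) = \<theta> (w ! k) ! j"
  using assms
proof (induction w arbitrary: k)
  case (Cons a w)
  show ?case
  proof (cases k)
    case 0
    then show ?thesis using Cons.prems by (simp add: subst_word_def nth_append len)
  next
    case (Suc k')
    then have "subst_word \<theta> (a # w) ! (q * k + j) = subst_word \<theta> w ! (q * k' + j)"
      by (simp add: subst_word_def nth_append len)
    then show ?thesis using Cons Suc by simp
  qed
qed simp

lemma block_index_less:
  fixes k j N Q :: nat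
  assumes "k < N" "j < Q" shows "Q * k + j < Q * N"
proof -
  have "Q * k + j < Q * (k + 1)" using assms(2) by simp
  also have "\<dots> \<le> Q * N" using assms(1) by (intro mult_left_mono) auto
  finally show ?thesis .
qed

lemma letter_0 [simp]: "letter \<theta> 0 a 0 = a"
  by (simp add: letter_def)

lemma letter_1: "letter \<theta> (Suc 0) a j = \<theta> a ! j"
  by (simp add: letter_def subst_word_def)

lemma subst_word_pow_nth:
  assumes "k < length w" "j < q ^ n"
  shows "(subst_word \<theta> ^^ n) w ! (q ^ n * k + j) = letter \<theta> n (w ! k) j"
  using assms(2)
proof (induction n arbitrary: j)
  case (Suc n)
  have j: "j = q * (j div q) + j mod q" "j mod q < q" "j div q < q ^ n"
    using q_pos Suc.prems by (auto simp: less_mult_imp_div_less mult.commute)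
  have "(subst_word \<theta> ^^ Suc n) w ! (q ^ Suc n * k + j) =
      subst_word \<theta> ((subst_word \<theta> ^^ n) w) ! (q * (q ^ n * k + j div q) + j mod q)"
    using j(1) by (simp add: algebra_simps)
  also have "\<dots> = \<theta> ((subst_word \<theta> ^^ n) w ! (q ^ n * k + j div q)) ! (j mod q)"
    using j assms(1) block_index_less by (intro subst_word_nth) (auto simp: length_subst_word_pow)
  also have "\<dots> = \<theta> (letter \<theta> n (w ! k) (j div q)) ! (j mod q)"
    using Suc.IH j by simp
  also have "\<dots> = subst_word \<theta> ((subst_word \<theta> ^^ n) [w ! k]) ! (q * (j div q) + j mod q)"
    unfolding letter_def
    using j by (intro subst_word_nth[symmetric]) (auto simp: length_subst_word_pow)
  also have "\<dots> = letter \<theta> (Suc n) (w ! k) j" using j(1) by (simp add: letter_def)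
  finally show ?case .
qed (simp add: letter_def)

lemma letter_add:
  assumes "j < q ^ n" "i < q ^ m"
  shows "letter \<theta> (m + n) a (q ^ m * j + i) = letter \<theta> m (letter \<theta> n a j) i"
  unfolding letter_def[of \<theta> "m + n"] funpow_add comp_def
  using assms by (subst subst_word_pow_nth) (auto simp: length_subst_word_pow letter_def)

lemma letter_first_add: "letter \<theta> (m + n) a 0 = letter \<theta> m (letter \<theta> n a 0) 0"
  using letter_add[of 0 n 0 m] q_pos by simp

lemma letter_last_add:
  "letter \<theta> (m + n) a (q ^ (m + n) - 1) = letter \<theta> m (letter \<theta> n a (q ^ n - 1)) (q ^ m - 1)"
proof -
  have "q ^ m > 0" "q ^ n > 0" using q_pos by auto
  then have "q ^ (m + n) - 1 = q ^ m * (q ^ n - 1) + (q ^ m - 1)"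
    by (cases "q ^ n") (auto simp: power_add)
  then show ?thesis using letter_add[of "q ^ n - 1" n "q ^ m - 1" m a] q_pos by simp
qed

lemma subst_pos_const: "subst_pos \<theta> y k = int q * k"
  by (simp add: subst_pos_def len)

lemma subst_seq_pow_nth:
  assumes "j < q ^ n"
  shows "(subst_seq \<theta> ^^ n) y (int (q ^ n) * k + int j) = letter \<theta> n (y k) j"
  using assms
proof (induction n arbitrary: j)
  case (Suc n)
  have j: "j = q * (j div q) + j mod q" "j mod q < q" "j div q < q ^ n"
    using q_pos Suc.prems by (auto simp: less_mult_imp_div_less mult.commute)
  have sub: "substitution \<theta>" using len q_pos by (auto simp: substitution_def simp flip: length_greater_0_conv)
  have "int (q ^ Suc n) * k + int j = int q * (int (q ^ n) * k + int (j div q)) + int (j mod q)"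
    by (subst j(1)) (simp only: of_nat_add of_nat_mult power_Suc algebra_simps)
  then have "(subst_seq \<theta> ^^ Suc n) y (int (q ^ Suc n) * k + int j) =
      subst_seq \<theta> ((subst_seq \<theta> ^^ n) y) (int q * (int (q ^ n) * k + int (j div q)) + int (j mod q))"
    by simp
  also have "\<dots> = \<theta> ((subst_seq \<theta> ^^ n) y (int (q ^ n) * k + int (j div q))) ! (j mod q)"
    using subst_seq_nth[OF sub, of "j mod q"] len j(2) by (simp add: subst_pos_const)
  also have "\<dots> = \<theta> (letter \<theta> n (y k) (j div q)) ! (j mod q)"
    using Suc.IH j by simp
  also have "\<dots> = letter \<theta> (1 + n) (y k) (q ^ 1 * (j div q) + j mod q)"
    using j by (subst letter_add) (auto simp: letter_1)
  also have "\<dots> = letter \<theta> (Suc n) (y k) j" using j(1) by simp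
  finally show ?case .
qed simp

lemma in_set_subst_word_pow:
  "c \<in> set ((subst_word \<theta> ^^ n) [a]) \<Longrightarrow> \<exists>j<q ^ n. letter \<theta> n a j = c"
  by (auto simp: in_set_conv_nth letter_def length_subst_word_pow)

end

text \<open>The fixed point with seed \<open>b.a\<close> of a substitution \<open>\<tau>\<close> of constant length \<open>L\<close>: the letter at
  \<open>i\<close> is read off from the letter at \<open>i div L\<close>, which is nearer to the seed.\<close>

function seeded_point :: "int \<Rightarrow> ('a \<Rightarrow> nat \<Rightarrow> 'a) \<Rightarrow> 'a \<Rightarrow> 'a \<Rightarrow> int \<Rightarrow> 'a" where
  "seeded_point L \<tau> b a i = (if L < 2 \<or> i = 0 then a else if i = -1 then b
     else \<tau> (seeded_point L \<tau> b a (i div L)) (nat (i mod L)))"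
  by auto
termination
proof (relation "Wellfounded.measure (\<lambda>(L, \<tau>, b, a, i). nat \<bar>i\<bar>)")
  fix L i :: int
  assume *: "\<not> (L < 2 \<or> i = 0)" "i \<noteq> -1"
  have "\<bar>i div L\<bar> < \<bar>i\<bar>"
  proof (cases "i > 0")
    case True
    then have "i div L < i" "i div L \<ge> 0" using * by (auto simp: int_div_less_self pos_imp_zdiv_nonneg_iff)
    then show ?thesis by simp
  next
    case False
    then have i: "i \<le> -2" using * by auto
    have "i div L < 0" using i * by (simp add: neg_imp_zdiv_neg_iff div_neg_pos_less0)
    moreover have "i < i div L"
    proof -
      have "L * (i div L) = i - i mod L" using mult_div_mod_eq[of L i] by linarith
      moreover have "i mod L < L" using * by simp
      moreover have "i mod L \<ge> 0" using * by simp
      ultimately have "i div L * L > i - L" by (simp add: mult.commute)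
      show ?thesis
      proof (rule ccontr)
        assume "\<not> i < i div L"
        then have "i div L \<le> i" by simp
        then have "L * (i div L) \<le> L * i" using * by simp
        then have "i - L < L * i" using \<open>i div L * L > i - L\<close> by (simp add: mult.commute)
        then have "(L - 1) * i > - L" by (simp add: algebra_simps)
        moreover have "(L - 1) * i \<le> (L - 1) * (-2)" using i * by (intro mult_left_mono) auto
        ultimately show False using * by simp
      qed
    qed
    ultimately show ?thesis using i by simp
  qed
  then show "((L, \<tau>, b, a, i div L), L, \<tau>, b, a, i) \<in> Wellfounded.measure (\<lambda>(L, \<tau>, b, a, i). nat \<bar>i\<bar>)"
    for \<tau> b a by simp
qed simp

declare seeded_point.simps [simp del]

text \<open>Call a pair of letters legal if it occurs side by side in the image of a letter under some iterate. The
  last letter of \<open>\<theta> b\<close> and the first of \<open>\<theta> a\<close> form a legal pair if \<open>b\<close>, \<open>a\<close> do. There are finitely many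
  legal pairs, so one of them is mapped to itself by an iterate.\<close>

lemma (in const_subst) exists_periodic_seed:
  assumes "finite (UNIV :: 'a set)" "q \<ge> 2"
  obtains p a b s c J where "p > 0" "letter \<theta> p a 0 = a" "letter \<theta> p b (q ^ p - 1) = b"
    "letter \<theta> s c J = b" "letter \<theta> s c (Suc J) = a" "Suc J < q ^ s"
proof -
  define legal where "legal = {(b, a). \<exists>s c J. Suc J < q ^ s \<and> letter \<theta> s c J = b \<and> letter \<theta> s c (Suc J) = a}"
  define f where "f = (\<lambda>n (b, a). (letter \<theta> n b (q ^ n - 1), letter \<theta> n a 0))"
  have f_legal: "f n z \<in> legal" if z_legal: "z \<in> legal" for n z
  proof -
    obtain s c J where z: "Suc J < q ^ s" "z = (letter \<theta> s c J, letter \<theta> s c (Suc J))"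
      using z_legal unfolding legal_def by blast
    have "q ^ n > 0" using q_pos by simp
    then have "letter \<theta> (n + s) c (q ^ n * J + (q ^ n - 1)) = fst (f n z)"
        "letter \<theta> (n + s) c (q ^ n * Suc J) = snd (f n z)"
      using z letter_add[of J s "q ^ n - 1" n c] letter_add[of "Suc J" s 0 n c]
      by (auto simp: f_def)
    moreover have "q ^ n * Suc J = Suc (q ^ n * J + (q ^ n - 1))"
      using \<open>q ^ n > 0\<close> by simp
    moreover have "q ^ n * Suc J < q ^ (n + s)"
      using z(1) \<open>q ^ n > 0\<close> by (simp add: power_add del: mult_Suc_right)
    ultimately have "Suc (q ^ n * J + (q ^ n - 1)) < q ^ (n + s) \<and>
        letter \<theta> (n + s) c (q ^ n * J + (q ^ n - 1)) = fst (f n z) \<and>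
        letter \<theta> (n + s) c (Suc (q ^ n * J + (q ^ n - 1))) = snd (f n z)"
      by metis
    then have "(fst (f n z), snd (f n z)) \<in> legal" unfolding legal_def by blast
    then show ?thesis by simp
  qed
  have f_add: "f (m + n) z = f m (f n z)" for m n z
    unfolding f_def split_beta fst_conv snd_conv letter_first_add letter_last_add ..
  have "(letter \<theta> 1 undefined 0, letter \<theta> 1 undefined (Suc 0)) \<in> legal"
  proof -
    have "Suc 0 < q ^ 1" using assms(2) by simp
    then show ?thesis unfolding legal_def by blast
  qed
  then obtain z where z: "z \<in> legal" by blast
  have "finite (UNIV :: ('a \<times> 'a) set)" using assms(1) by (simp add: finite_Prod_UNIV)
  then have "\<not> inj (\<lambda>n. f n z)"
    using finite_imageD infinite_UNIV_nat rev_finite_subset subset_UNIV by metis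
  then obtain i j where ij: "i < j" "f i z = f j z"
    unfolding inj_def by (metis linorder_neqE_nat)
  obtain b a where ba: "f i z = (b, a)" by (cases "f i z")
  have "f (j - i) (b, a) = (b, a)"
    using f_add[of "j - i" i z] ij ba by simp
  moreover have "(b, a) \<in> legal" using f_legal[OF z, of i] ba by simp
  ultimately obtain s c J where "letter \<theta> (j - i) b (q ^ (j - i) - 1) = b" "letter \<theta> (j - i) a 0 = a"
    "Suc J < q ^ s" "letter \<theta> s c J = b" "letter \<theta> s c (Suc J) = a"
    unfolding f_def legal_def by auto
  then show ?thesis using ij(1) by (intro that[of "j - i" a b s c J]) auto
qed

text \<open>The seed occurs in the image of some letter, hence by primitivity in a bounded power of the
  substitution applied to any letter; so every word of the fixed point recurs with bounded gaps.\<close>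

lemma (in const_subst) exists_recurrent_periodic_point:
  assumes "finite (UNIV :: 'a set)" "q \<ge> 2" "primitive \<theta>"
  shows "\<exists>x p. p > 0 \<and> (subst_seq \<theta> ^^ p) x = x \<and> uniformly_recurrent x"
proof -
  obtain p a b s c J where p: "p > 0" "letter \<theta> p a 0 = a" "letter \<theta> p b (q ^ p - 1) = b"
    and J: "letter \<theta> s c J = b" "letter \<theta> s c (Suc J) = a" "Suc J < q ^ s"
    by (rule exists_periodic_seed[OF assms(1,2)])
  define L where "L = int (q ^ p)"
  have "q ^ 1 \<le> q ^ p" using p(1) q_pos by (intro power_increasing) auto
  then have "2 \<le> q ^ p" using assms(2) by simp
  then have L: "L \<ge> 2" unfolding L_def by linarith
  define x where "x = seeded_point L (letter \<theta> p) b a"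
  have x_rec: "x i = letter \<theta> p (x (i div L)) (nat (i mod L))" for i
  proof -
    consider "i = 0" | "i = -1" | "i \<noteq> 0" "i \<noteq> -1" by blast
    then show ?thesis
    proof cases
      case 1
      then show ?thesis using p L by (simp add: x_def seeded_point.simps)
    next
      case 2
      have "(-1) div L = -1" "(-1) mod L = L - 1"
        using L by (auto simp: div_eq_minus1 zmod_minus1)
      moreover have "nat (L - 1) = q ^ p - 1" unfolding L_def by linarith
      moreover have "x (-1) = b" using L by (simp add: x_def seeded_point.simps)
      ultimately show ?thesis using 2 p by simp
    next
      case 3
      then show ?thesis unfolding x_def using L by (subst seeded_point.simps) auto
    qed
  qed
  have fix_x: "(subst_seq \<theta> ^^ p) x = x"
  proof
    fix i
    have "0 \<le> i mod L" "i mod L < L" using L by auto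
    then have "nat (i mod L) < q ^ p" unfolding L_def by linarith
    moreover have "i = L * (i div L) + int (nat (i mod L))"
      using mult_div_mod_eq[of L i] \<open>0 \<le> i mod L\<close> by linarith
    ultimately have "(subst_seq \<theta> ^^ p) x i = letter \<theta> p (x (i div L)) (nat (i mod L))"
      using subst_seq_pow_nth[of "nat (i mod L)" p x "i div L"] unfolding L_def[symmetric] by argo
    then show "(subst_seq \<theta> ^^ p) x i = x i" using x_rec[of i] by argo
  qed
  have fix_pow: "(subst_seq \<theta> ^^ (p * n)) x = x" for n
  proof (induction n)
    case (Suc n)
    have "(subst_seq \<theta> ^^ (p * Suc n)) x = (subst_seq \<theta> ^^ p) ((subst_seq \<theta> ^^ (p * n)) x)"
      by (simp add: funpow_add)
    then show ?case using Suc fix_x by simp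
  qed simp
  have block: "x (int (q ^ (p * n)) * k + int j) = letter \<theta> (p * n) (x k) j" if "j < q ^ (p * n)" for n k j
    using subst_seq_pow_nth[OF that, of x k] by (simp add: fix_pow)
  have x0: "x 0 = a" "x (-1) = b" using L by (auto simp: x_def seeded_point.simps)
  obtain m where m: "m > 0" "\<And>e. set ((subst_word \<theta> ^^ m) [e]) = UNIV"
    using assms(3) unfolding primitive_def by blast
  have "uniformly_recurrent x"
    unfolding uniformly_recurrent_def
  proof (intro allI)
    fix u r :: int
    define K where "K = nat (\<bar>u\<bar> + \<bar>r\<bar> + 1)"
    define Q where "Q = q ^ (p * K)"
    have "K < q ^ (p * K)"
    proof -
      have "K < 2 ^ K" by simp
      also have "\<dots> \<le> q ^ K" using assms(2) by (intro power_mono) auto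
      also have "\<dots> \<le> q ^ (p * K)" using p(1) q_pos by (intro power_increasing) auto
      finally show ?thesis .
    qed
    then have Q: "\<bar>u\<bar> + \<bar>r\<bar> < int Q" unfolding Q_def K_def by linarith
    define N where "N = p * K + s + m"
    define P where "P = q ^ (p * N)"
    have "N \<le> p * N" using p(1) by simp
    have occ: "\<exists>o'. (\<forall>i. 0 \<le> i \<and> i \<le> r \<longrightarrow> 0 \<le> o' + i \<and> o' + i < int P \<and>
        letter \<theta> (p * N) e (nat (o' + i)) = x (u + i))" for e
    proof -
      define e' where "e' = letter \<theta> (p * N - N) e 0"
      obtain j where j: "j < q ^ m" "letter \<theta> m e' j = c"
        using in_set_subst_word_pow[of c m e'] m(2) by auto
      define o' where "o' = int (Q * (q ^ s * j + J + 1)) + u"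
      have seed: "letter \<theta> (s + m) e' (q ^ s * j + J) = b" "letter \<theta> (s + m) e' (q ^ s * j + Suc J) = a"
        using letter_add[of j m J s e'] letter_add[of j m "Suc J" s e'] j J by auto
      have bound: "q ^ s * j + Suc J < q ^ (s + m)"
        using block_index_less[OF j(1) J(3)] by (simp add: power_add)
      have "0 \<le> o' + i \<and> o' + i < int P \<and> letter \<theta> (p * N) e (nat (o' + i)) = x (u + i)"
        if i: "0 \<le> i" "i \<le> r" for i
      proof -
        define g where "g = u + i"
        have g: "\<bar>g\<bar> < int Q" using Q i unfolding g_def by linarith
        have "\<exists>J' h. J' \<le> q ^ s * j + Suc J \<and> h < Q \<and> int (Q * (q ^ s * j + J + 1)) + g = int (Q * J' + h)
            \<and> letter \<theta> (p * K) (letter \<theta> (s + m) e' J') h = x g"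
        proof (cases "g \<ge> 0")
          case True
          then have "nat g < q ^ (p * K)" using g Q_def by linarith
          then show ?thesis
            using True g seed x0 block[of "nat g" K 0] unfolding Q_def
            by (intro exI[of _ "q ^ s * j + Suc J"] exI[of _ "nat g"]) auto
        next
          case False
          then have h: "nat (int Q + g) < q ^ (p * K)" using g Q_def by linarith
          have "int Q * (-1) + int (nat (int Q + g)) = g" using g by simp
          then show ?thesis
            using False g seed x0 block[OF h, of "-1"] h unfolding Q_def
            by (intro exI[of _ "q ^ s * j + J"] exI[of _ "nat (int Q + g)"]) (auto simp: Q_def algebra_simps)
        qed
        then obtain J' h where J'h: "J' \<le> q ^ s * j + Suc J" "h < Q"
          "o' + i = int (Q * J' + h)" "letter \<theta> (p * K) (letter \<theta> (s + m) e' J') h = x g"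
          unfolding o'_def g_def by (auto simp: algebra_simps)
        have "J' < q ^ (s + m)" using J'h(1) bound by linarith
        then have "letter \<theta> N e' (Q * J' + h) = x g"
          using letter_add[of J' "s + m" h "p * K" e'] J'h unfolding N_def Q_def by (simp add: add.assoc)
        moreover have lt: "Q * J' + h < q ^ N"
          using block_index_less[OF \<open>J' < q ^ (s + m)\<close> J'h(2)] unfolding N_def Q_def
          by (simp add: power_add mult.assoc)
        moreover have "letter \<theta> (p * N) e (Q * J' + h) = letter \<theta> N e' (Q * J' + h)"
          using letter_add[of 0 "p * N - N" "Q * J' + h" N e] lt q_pos \<open>N \<le> p * N\<close>
          by (simp add: e'_def)
        moreover have "q ^ N \<le> P" unfolding P_def
          using \<open>N \<le> p * N\<close> q_pos by (intro power_increasing) auto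
        ultimately have "letter \<theta> (p * N) e (Q * J' + h) = x g" and "Q * J' + h < P" by simp_all
        moreover have "nat (o' + i) = Q * J' + h" unfolding J'h(3) by (rule nat_int)
        moreover have "0 \<le> o' + i" using J'h(3) of_nat_0_le_iff[of "Q * J' + h"] by metis
        moreover have "o' + i < int P" using J'h(3) \<open>Q * J' + h < P\<close> of_nat_less_iff by metis
        ultimately show ?thesis unfolding g_def by metis
      qed
      then show ?thesis by blast
    qed
    then obtain \<omega> where \<omega>: "\<And>e i. 0 \<le> i \<Longrightarrow> i \<le> r \<Longrightarrow> 0 \<le> \<omega> e + i \<and> \<omega> e + i < int P \<and>
        letter \<theta> (p * N) e (nat (\<omega> e + i)) = x (u + i)" by metis
    have "P > 0" using q_pos by (simp add: P_def)
    have "\<exists>t. A \<le> t \<and> t < A + 2 * int P \<and> (\<forall>i. 0 \<le> i \<and> i \<le> r \<longrightarrow> x (t + i) = x (u + i))" for A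
    proof (cases "r \<ge> 0")
      case True
      obtain k where k: "A \<le> int P * k" "int P * k \<le> A + int P"
        using next_multiple[of "int P" A] \<open>P > 0\<close> by auto
      have "x (int P * k + \<omega> (x k) + i) = x (u + i)" if "0 \<le> i" "i \<le> r" for i
        using \<omega>[OF that, of "x k"] block[of "nat (\<omega> (x k) + i)" N k]
        unfolding P_def[symmetric] by (simp add: nat_less_iff add.assoc)
      then show ?thesis using \<omega>[of 0 "x k"] True k
        by (intro exI[of _ "int P * k + \<omega> (x k)"]) auto
    next
      case False
      then show ?thesis using \<open>P > 0\<close> by (intro exI[of _ A]) auto
    qed
    then show "\<exists>L. \<forall>A. \<exists>t. A \<le> t \<and> t < A + L \<and> (\<forall>i. 0 \<le> i \<and> i \<le> r \<longrightarrow> x (t + i) = x (u + i))"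
      by blast
  qed
  then show ?thesis using p(1) fix_x by blast
qed

text \<open>A point fixed by the \<open>p\<close>-th iterate is self-similar with factor \<open>q ^ p\<close>, and minimality of its orbit
  closure is uniform recurrence. This applies to the point by which the subshift is defined, since the
  construction above shows that there is such a point.\<close>

lemma substitution_subshift_self_similar:
  fixes \<theta> :: "'a::finite \<Rightarrow> 'a list"
  assumes "substitution \<theta>" "primitive \<theta>" "constant_length \<theta>"
  obtains x l where "substitution_subshift \<theta> = orbit_closure x" "self_similar x l"
proof -
  obtain q where q: "\<And>a. length (\<theta> a) = q"
    using assms(3) unfolding constant_length_def by blast
  have "q > 0" using assms(1) q[of undefined] by (metis length_greater_0_conv substitution_def)
  then interpret const_subst \<theta> q using q by unfold_locales auto
  define good where "good = (\<lambda>x. (\<exists>p>0. (subst_seq \<theta> ^^ p) x = x) \<and> minimal_subshift (orbit_closure x))"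
  define x where "x = (SOME x. good x)"
  have X: "substitution_subshift \<theta> = orbit_closure x"
    by (simp add: substitution_subshift_def x_def good_def)
  show ?thesis
  proof (cases "q \<ge> 2")
    case True
    have "\<exists>x. good x"
      using exists_recurrent_periodic_point[OF _ True assms(2)] uniformly_recurrent_imp_minimal
      unfolding good_def by (metis finite_class.finite_UNIV)
    then have "good x" unfolding x_def by (rule someI_ex)
    then obtain p where p: "p > 0" "(subst_seq \<theta> ^^ p) x = x" and "minimal_subshift (orbit_closure x)"
      unfolding good_def by blast
    then have rec: "uniformly_recurrent x" by (intro minimal_imp_uniformly_recurrent)
    have "q ^ 1 \<le> q ^ p" using p(1) q_pos by (intro power_increasing) auto
    then have "2 \<le> q ^ p" using True by simp
    then have "2 \<le> int (q ^ p)" by linarith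
    moreover have "x (int (q ^ p) * i + j) = letter \<theta> p (x i) (nat j)" if "0 \<le> j" "j < int (q ^ p)" for i j
      using subst_seq_pow_nth[of "nat j" p x i] that p(2) by (simp add: nat_less_iff)
    ultimately have "self_similar x (int (q ^ p))"
      using rec by unfold_locales auto
    then show ?thesis using X that by blast
  next
    case False
    \<comment> \<open>For length 1, primitivity leaves only one letter.\<close>
    then have "q = 1" using q_pos by simp
    obtain m where m: "\<And>e. set ((subst_word \<theta> ^^ m) [e]) = UNIV"
      using assms(2) unfolding primitive_def by blast
    have "length ((subst_word \<theta> ^^ m) [undefined]) = 1"
      by (simp add: length_subst_word_pow \<open>q = 1\<close>)
    then have "card (UNIV :: 'a set) \<le> 1" using m card_length by metis
    then have one: "e = e'" for e e' :: 'a
      by (metis card_le_Suc0_iff_eq finite_class.finite_UNIV One_nat_def UNIV_I)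
    have "uniformly_recurrent x"
      unfolding uniformly_recurrent_def
    proof (intro allI)
      fix u r
      have "a \<le> a \<and> a < a + 1 \<and> (\<forall>i. 0 \<le> i \<and> i \<le> r \<longrightarrow> x (a + i) = x (u + i))" for a
        using one by simp
      then show "\<exists>L. \<forall>a. \<exists>t. a \<le> t \<and> t < a + L \<and> (\<forall>i. 0 \<le> i \<and> i \<le> r \<longrightarrow> x (t + i) = x (u + i))"
        by blast
    qed
    then have "self_similar x 2"
      using one by unfold_locales auto
    then show ?thesis using X that by blast
  qed
qed

section \<open>Events that occur with positive frequency in every window\<close>

text \<open>Every window of one fixed length, in every point, contains the visits to \<open>B\<close> with proportion at least
  \<open>c\<close>. This bounds the density of the visits along each orbit and the measure of \<open>B\<close> for each invariant
  measure at the same time.\<close>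

definition often :: "(int \<Rightarrow> 'a) set \<Rightarrow> real \<Rightarrow> (int \<Rightarrow> 'a) set \<Rightarrow> bool" where
  "often X c B \<longleftrightarrow> (\<exists>M>0. \<forall>y\<in>X. c * real M \<le> real (card {s. s < M \<and> translate (int s) y \<in> B}))"

definition local_set :: "(int \<Rightarrow> 'a) set \<Rightarrow> (int \<Rightarrow> 'a) set \<Rightarrow> bool" where
  "local_set X B \<longleftrightarrow> (\<exists>R. \<forall>y\<in>X. \<forall>z\<in>X. agree R y z \<longrightarrow> (y \<in> B \<longleftrightarrow> z \<in> B))"

text \<open>Each window of a point of the orbit closure is a window of \<open>x\<close>, so it is enough to count in \<open>x\<close>.\<close>

lemma often_orbit_closureI:
  assumes "local_set (orbit_closure x) B" "M > 0"
    and "\<And>a. c * real M \<le> real (card {s. s < M \<and> translate (a + int s) x \<in> B})"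
  shows "often (orbit_closure x) c B"
  unfolding often_def
proof (intro exI[of _ M] conjI ballI assms(2))
  fix y assume y: "y \<in> orbit_closure x"
  obtain R where R: "\<And>y z. y \<in> orbit_closure x \<Longrightarrow> z \<in> orbit_closure x \<Longrightarrow> agree R y z \<Longrightarrow> y \<in> B \<longleftrightarrow> z \<in> B"
    using assms(1) unfolding local_set_def by blast
  obtain a where a: "agree (R + M) y (translate a x)" using y in_orbit_closure by blast
  have "translate (int s) y \<in> B \<longleftrightarrow> translate (a + int s) x \<in> B" if "s < M" for s
  proof -
    have "agree R (translate (int s) y) (translate (int s) (translate a x))"
      using that by (intro agree_translate[OF a]) simp
    then have "agree R (translate (int s) y) (translate (a + int s) x)" by (simp add: add.commute)
    then show ?thesis
      by (intro R translate_in_orbit_closure[OF y] orbit_in_orbit_closure)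
  qed
  then have "{s. s < M \<and> translate (int s) y \<in> B} = {s. s < M \<and> translate (a + int s) x \<in> B}"
    by blast
  then show "c * real M \<le> real (card {s. s < M \<and> translate (int s) y \<in> B})"
    using assms(3)[of a] by simp
qed

lemma window_count_ge:
  assumes "a \<le> p" "q \<le> a + int M" "\<And>s. p \<le> s \<Longrightarrow> s < q \<Longrightarrow> translate s x \<in> B"
  shows "q - p \<le> int (card {s. s < M \<and> translate (a + int s) x \<in> B})"
proof -
  have "(\<lambda>s. nat (s - a)) ` {p..<q} \<subseteq> {s. s < M \<and> translate (a + int s) x \<in> B}"
    using assms by auto
  then have "card ((\<lambda>s. nat (s - a)) ` {p..<q}) \<le> card {s. s < M \<and> translate (a + int s) x \<in> B}"
    by (intro card_mono) auto
  moreover have "inj_on (\<lambda>s. nat (s - a)) {p..<q}"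
    using assms(1) by (auto simp: inj_on_def)
  ultimately have "card {p..<q} \<le> card {s. s < M \<and> translate (a + int s) x \<in> B}"
    by (simp add: card_image)
  then show ?thesis by simp
qed

lemma local_set_differ: "local_set X {y. y 0 \<noteq> y m}"
  unfolding local_set_def
proof (rule exI[of _ "nat \<bar>m\<bar>"], intro ballI impI)
  fix y z :: "int \<Rightarrow> 'a" assume "agree (nat \<bar>m\<bar>) y z"
  then have "y 0 = z 0" "y m = z m" by (auto simp: agree_def)
  then show "y \<in> {y. y 0 \<noteq> y m} \<longleftrightarrow> z \<in> {y. y 0 \<noteq> y m}" by simp
qed

lemma local_set_return: "local_set X {y. agree R y (translate m y)}"
  unfolding local_set_def
proof (rule exI[of _ "R + nat \<bar>m\<bar>"], intro ballI impI)
  fix y z :: "int \<Rightarrow> 'a" assume yz: "agree (R + nat \<bar>m\<bar>) y z"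
  then have "agree R y z" by (rule agree_mono) simp
  moreover have "agree R (translate m y) (translate m z)"
    using yz by (rule agree_translate) simp
  ultimately show "y \<in> {y. agree R y (translate m y)} \<longleftrightarrow> z \<in> {y. agree R y (translate m y)}"
    using agree_trans agree_sym by blast
qed

section \<open>Blocks of a self-similar point\<close>

context self_similar
begin

abbreviation "X \<equiv> orbit_closure x"

lemma l_pos: "l > 0" and l_pow_pos: "l ^ n > 0"
  using l_ge_2 by auto

lemma step_pow:
  assumes "x i = x i'" "0 \<le> j" "j < l ^ n"
  shows "x (l ^ n * i + j) = x (l ^ n * i' + j)"
  using assms(2,3)
proof (induction n arbitrary: j)
  case (Suc n)
  define u v where "u = j div l" and "v = j mod l"
  have j: "j = l * u + v" by (simp add: u_def v_def)
  have v: "0 \<le> v" "v < l" using l_pos by (auto simp: v_def)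
  have u: "0 \<le> u" using Suc.prems l_pos by (simp add: u_def pos_imp_zdiv_nonneg_iff)
  have "l * u < l * l ^ n" using j v(1) Suc.prems(2) unfolding power_Suc by linarith
  then have "u < l ^ n" using mult_less_cancel_left_pos[OF l_pos] by blast
  then have "x (l * (l ^ n * i + u) + v) = x (l * (l ^ n * i' + u) + v)"
    using Suc.IH u v by (intro step) auto
  then show ?case by (simp add: j algebra_simps)
next
  case 0
  then have "j = 0" by simp
  then show ?case using assms(1) by simp
qed

text \<open>The gaps between occurrences are bounded uniformly over all words of one length, because there are only
  finitely many of them.\<close>

lemma word_recurs:
  obtains L where "L > 0" "\<And>u a. \<exists>t. a \<le> t \<and> t < a + L \<and> (\<forall>i. 0 \<le> i \<and> i \<le> r \<longrightarrow> x (t + i) = x (u + i))"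
proof -
  have "\<forall>u. \<exists>L. \<forall>a. \<exists>t. a \<le> t \<and> t < a + L \<and> (\<forall>i. 0 \<le> i \<and> i \<le> r \<longrightarrow> x (t + i) = x (u + i))"
    using recurrent unfolding uniformly_recurrent_def by blast
  from choice[OF this] obtain \<Lambda> where
    \<Lambda>: "\<And>u a. \<exists>t. a \<le> t \<and> t < a + \<Lambda> u \<and> (\<forall>i. 0 \<le> i \<and> i \<le> r \<longrightarrow> x (t + i) = x (u + i))"
    by blast
  define word where "word u = map (\<lambda>i. x (u + i)) [0..r]" for u
  have word_eq: "x (u + i) = x (u' + i)" if "word u = word u'" "0 \<le> i" "i \<le> r" for u u' i
    using that unfolding word_def map_eq_conv by simp
  have "range word \<subseteq> {w. set w \<subseteq> UNIV \<and> length w = nat (r + 1)}" by (auto simp: word_def)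
  then have fin: "finite (range word)"
    by (rule finite_subset) (intro finite_lists_length_eq finite)
  define rep where "rep w = (SOME u. word u = w)" for w
  have rep: "word (rep (word u)) = word u" for u
    unfolding rep_def by (rule someI[of _ u]) simp
  define L where "L = Max (insert 1 ((\<lambda>w. \<Lambda> (rep w)) ` range word))"
  have L: "\<Lambda> (rep (word u)) \<le> L" for u
    unfolding L_def using fin by (intro Max_ge) auto
  show ?thesis
  proof (rule that)
    show "L > 0" using fin unfolding L_def by (auto intro!: less_le_trans[OF _ Max_ge, of _ 1])
    show "\<exists>t. a \<le> t \<and> t < a + L \<and> (\<forall>i. 0 \<le> i \<and> i \<le> r \<longrightarrow> x (t + i) = x (u + i))" for u a
    proof -
      obtain t where "a \<le> t" "t < a + \<Lambda> (rep (word u))"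
        "\<And>i. 0 \<le> i \<and> i \<le> r \<Longrightarrow> x (t + i) = x (rep (word u) + i)"
        using \<Lambda>[of a "rep (word u)"] by blast
      moreover have "t < a + L" using L[of u] \<open>t < a + \<Lambda> (rep (word u))\<close> by simp
      ultimately show ?thesis using word_eq[OF rep] by metis
    qed
  qed
qed

lemma block_recurs:
  obtains L where "L > 0" "\<And>u n a. \<exists>t. a \<le> l ^ n * t \<and> l ^ n * (t + 1) \<le> a + L * l ^ n \<and>
    (\<forall>i. 0 \<le> i \<and> i \<le> r \<longrightarrow> x (t + i) = x (u + i))"
proof -
  obtain L where L: "L > 0" "\<And>u a. \<exists>t. a \<le> t \<and> t < a + L \<and> (\<forall>i. 0 \<le> i \<and> i \<le> r \<longrightarrow> x (t + i) = x (u + i))"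
    by (rule word_recurs[of r]) blast
  show ?thesis
  proof (rule that[of "L + 1"])
    show "L + 1 > 0" using L by simp
    fix u n a
    obtain k where k: "a \<le> l ^ n * k" "l ^ n * k \<le> a + l ^ n"
      using next_multiple[OF l_pow_pos] by metis
    obtain t where t: "k \<le> t" "t < k + L" "\<forall>i. 0 \<le> i \<and> i \<le> r \<longrightarrow> x (t + i) = x (u + i)"
      using L(2) by blast
    have "l ^ n * k \<le> l ^ n * t" using t l_pow_pos[of n] by simp
    moreover have "l ^ n * (t + 1) \<le> l ^ n * (k + L)" using t l_pow_pos[of n] by simp
    ultimately show "\<exists>t. a \<le> l ^ n * t \<and> l ^ n * (t + 1) \<le> a + (L + 1) * l ^ n \<and>
        (\<forall>i. 0 \<le> i \<and> i \<le> r \<longrightarrow> x (t + i) = x (u + i))"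
      using k t(3) by (intro exI[of _ t]) (auto simp: algebra_simps)
  qed
qed

text \<open>Level-\<open>n\<close> blocks over one word follow each other with gaps proportional to their length. Hence
  the frequency with which a set holding on large parts of such blocks is visited does not depend
  on \<open>n\<close>.\<close>

lemma often_blockI:
  assumes L: "L > 0" "\<And>a. \<exists>t. a \<le> l ^ n * t \<and> l ^ n * (t + 1) \<le> a + L * l ^ n \<and> Q t"
    and Q: "\<And>t s. Q t \<Longrightarrow> l ^ n * t + e \<le> s \<Longrightarrow> s < l ^ n * (t + 1) - e' \<Longrightarrow> translate s x \<in> B"
    and e: "0 \<le> e" "0 \<le> e'" "c * real_of_int (L * l ^ n) \<le> real_of_int (l ^ n - e - e')"
    and "local_set X B"
  shows "often X c B"
proof (rule often_orbit_closureI[OF assms(7), of "nat (L * l ^ n)"])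
  have "L * l ^ n > 0" using L(1) l_pow_pos by simp
  then show "nat (L * l ^ n) > 0" by simp
  fix a
  obtain t where t: "a \<le> l ^ n * t" "l ^ n * (t + 1) \<le> a + L * l ^ n" "Q t" using L(2) by blast
  have "(l ^ n * (t + 1) - e') - (l ^ n * t + e) \<le>
      int (card {s. s < nat (L * l ^ n) \<and> translate (a + int s) x \<in> B})"
    using t e \<open>L * l ^ n > 0\<close> Q by (intro window_count_ge) auto
  then have "l ^ n - e - e' \<le> int (card {s. s < nat (L * l ^ n) \<and> translate (a + int s) x \<in> B})"
    by (simp add: algebra_simps)
  then have "real_of_int (l ^ n - e - e') \<le> real (card {s. s < nat (L * l ^ n) \<and> translate (a + int s) x \<in> B})"
    by linarith
  moreover have "real (nat (L * l ^ n)) = real_of_int (L * l ^ n)" using \<open>L * l ^ n > 0\<close> by simp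
  ultimately show "c * real (nat (L * l ^ n)) \<le> real (card {s. s < nat (L * l ^ n) \<and> translate (a + int s) x \<in> B})"
    using order_trans[OF e(3)] by metis
qed

text \<open>Where \<open>x\<close> differs from its shift by \<open>k \<le> l ^ n\<close> within a level-\<open>n\<close> block depends only on the letters of
  this block and the next one. So a single difference recurs whenever these two letters do.\<close>

lemma aperiodic_often_differ:
  assumes "\<And>k. k > 0 \<Longrightarrow> \<exists>i. x i \<noteq> x (i + k)"
  obtains L where "L > 0" "\<And>n k. 0 < k \<Longrightarrow> k \<le> l ^ n \<Longrightarrow> often X (1 / real_of_int (L * l ^ n)) {y. y 0 \<noteq> y k}"
proof -
  obtain L where L: "L > 0" "\<And>u n a. \<exists>t. a \<le> l ^ n * t \<and> l ^ n * (t + 1) \<le> a + L * l ^ n \<and>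
    (\<forall>i. 0 \<le> i \<and> i \<le> 1 \<longrightarrow> x (t + i) = x (u + i))"
    by (rule block_recurs[of 1]) blast
  show ?thesis
  proof (rule that[OF L(1)])
    fix n k assume k: "0 < k" "k \<le> l ^ n"
    obtain i where i: "x i \<noteq> x (i + k)" using assms k by blast
    define u v where "u = i div l ^ n" and "v = i mod l ^ n"
    have iuv: "i = l ^ n * u + v" by (simp add: u_def v_def)
    have v: "0 \<le> v" "v < l ^ n" using l_pow_pos by (auto simp: v_def)
    define Q where "Q t \<longleftrightarrow> x t = x u \<and> x (t + 1) = x (u + 1)" for t
    have Q: "x (l ^ n * t + v) \<noteq> x (l ^ n * t + v + k)" if "Q t" for t
    proof -
      have "x (l ^ n * t + v) = x i"
        using step_pow[of t u v n] that v iuv by (simp add: Q_def)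
      moreover have "x (l ^ n * t + v + k) = x (i + k)"
      proof (cases "v + k < l ^ n")
        case True
        then show ?thesis using step_pow[of t u "v + k" n] that v k iuv by (simp add: Q_def add.assoc)
      next
        case False
        then have "x (l ^ n * (t + 1) + (v + k - l ^ n)) = x (l ^ n * (u + 1) + (v + k - l ^ n))"
          using that v k by (intro step_pow) (auto simp: Q_def)
        then show ?thesis using iuv by (simp add: algebra_simps)
      qed
      ultimately show ?thesis using i by simp
    qed
    show "often X (1 / real_of_int (L * l ^ n)) {y. y 0 \<noteq> y k}"
    proof (rule often_blockI[where n = n and L = L and Q = Q and e = v and e' = "l ^ n - v - 1"])
      show "\<exists>t. a \<le> l ^ n * t \<and> l ^ n * (t + 1) \<le> a + L * l ^ n \<and> Q t" for a
        using L(2)[where a = a and n = n and u = u] unfolding Q_def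
        by (metis add.right_neutral order_refl zero_le_one)
      show "translate s x \<in> {y. y 0 \<noteq> y k}"
        if "Q t" "l ^ n * t + v \<le> s" "s < l ^ n * (t + 1) - (l ^ n - v - 1)" for t s
      proof -
        have "s = l ^ n * t + v" using that by (simp add: algebra_simps)
        then show ?thesis using Q[OF that(1)] by (simp add: translate_nth add.commute)
      qed
    qed (use v L l_pow_pos[of n] in \<open>auto intro: local_set_differ\<close>)
  qed
qed

lemma exists_return: obtains k i where "k > 0" "x i = x (i + k)"
proof -
  have "\<not> inj x"
    using finite_imageD[of x UNIV] infinite_UNIV_int by auto
  then obtain i j where "i < j" "x i = x j" unfolding inj_def by (metis linorder_neqE_linordered_idom)
  then show ?thesis by (intro that[of "j - i" i]) auto
qed

text \<open>If two equal letters lie at distance \<open>k\<close>, then \<open>x\<close> and its shift by \<open>k l ^ n\<close> run through the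
  same level-\<open>n\<close> block at the same time with a frequency that does not depend on \<open>n\<close>.\<close>

lemma often_return:
  assumes "x i = x (i + k)" "k > 0"
  obtains c where "c > 0" "\<And>R. \<exists>n0. \<forall>n\<ge>n0. often X c {y. agree R y (translate (k * l ^ n) y)}"
proof -
  obtain L where L: "L > 0" "\<And>u n a. \<exists>t. a \<le> l ^ n * t \<and> l ^ n * (t + 1) \<le> a + L * l ^ n \<and>
    (\<forall>i. 0 \<le> i \<and> i \<le> k \<longrightarrow> x (t + i) = x (u + i))"
    by (rule block_recurs[of k]) blast
  have "\<exists>n0. \<forall>n\<ge>n0. often X (1 / (2 * real_of_int L)) {y. agree R y (translate (k * l ^ n) y)}" for R
  proof (intro exI[of _ "4 * R"] allI impI)
    fix n assume n: "n \<ge> 4 * R"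
    have "int n \<le> 2 ^ n" by simp
    also have "(2::int) ^ n \<le> l ^ n" using l_ge_2 by (intro power_mono) auto
    finally have R: "4 * int R \<le> l ^ n" using n by linarith
    define Q where "Q t \<longleftrightarrow> x t = x (t + k)" for t
    show "often X (1 / (2 * real_of_int L)) {y. agree R y (translate (k * l ^ n) y)}"
    proof (rule often_blockI[where n = n and L = L and Q = Q and e = "int R" and e' = "int R"])
      show "\<exists>t. a \<le> l ^ n * t \<and> l ^ n * (t + 1) \<le> a + L * l ^ n \<and> Q t" for a
      proof -
        obtain t where t: "a \<le> l ^ n * t" "l ^ n * (t + 1) \<le> a + L * l ^ n"
            "\<And>j. 0 \<le> j \<and> j \<le> k \<Longrightarrow> x (t + j) = x (i + j)"
          using L(2)[where a = a and n = n and u = i] by metis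
        have "Q t" using t(3)[of 0] t(3)[of k] assms by (simp add: Q_def)
        then show ?thesis using t by blast
      qed
      show "translate s x \<in> {y. agree R y (translate (k * l ^ n) y)}"
        if "Q t" and s: "l ^ n * t + int R \<le> s" "s < l ^ n * (t + 1) - int R" for t s
      proof -
        have "x (j + s) = x (j + k * l ^ n + s)" if "\<bar>j\<bar> \<le> int R" for j
        proof -
          define v where "v = j + s - l ^ n * t"
          have "0 \<le> v" "v < l ^ n" using s that by (auto simp: v_def algebra_simps)
          then have "x (l ^ n * t + v) = x (l ^ n * (t + k) + v)"
            using \<open>Q t\<close> by (intro step_pow) (auto simp: Q_def)
          then show ?thesis by (simp add: v_def algebra_simps)
        qed
        then show ?thesis by (simp add: agree_def translate_nth)
      qed
      show "1 / (2 * real_of_int L) * real_of_int (L * l ^ n) \<le> real_of_int (l ^ n - int R - int R)"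
      proof -
        have "1 / (2 * real_of_int L) * real_of_int (L * l ^ n) = real_of_int (l ^ n) / 2"
          using L(1) by simp
        moreover have "real_of_int (4 * int R) \<le> real_of_int (l ^ n)" using R of_int_le_iff by blast
        ultimately show ?thesis by (simp add: field_simps)
      qed
    qed (use L in \<open>auto intro: local_set_return\<close>)
  qed
  then show ?thesis using L(1) by (intro that[of "1 / (2 * real_of_int L)"]) auto
qed

section \<open>Coincidences\<close>

text \<open>Dekking's coincidence condition for the pairs of letters at distance \<open>k\<close>: every
  pair of letters at the same place of the images of such a pair can be brought to coincide.\<close>

definition coincident :: "int \<Rightarrow> bool" where
  "coincident k \<longleftrightarrow> (\<forall>n i. \<exists>m j. 0 \<le> j \<and> j < l ^ m \<and> x (l ^ m * i + j) = x (l ^ m * (i + k * l ^ n) + j))"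

text \<open>The images of a pair without coincidence differ in every place. The pair recurs with bounded gaps, so
  at every higher level a fixed proportion of the places lies in such blocks.\<close>

lemma not_coincident_often_differ:
  assumes "\<not> coincident k" "k > 0"
  obtains c n0 where "c > 0" "\<And>n. n \<ge> n0 \<Longrightarrow> often X c {y. y 0 \<noteq> y (k * l ^ n)}"
proof -
  obtain n0 i where ni: "\<And>m j. 0 \<le> j \<Longrightarrow> j < l ^ m \<Longrightarrow> x (l ^ m * i + j) \<noteq> x (l ^ m * (i + k * l ^ n0) + j)"
    using assms(1) unfolding coincident_def by blast
  define K where "K = k * l ^ n0"
  have "K > 0" using assms(2) l_pow_pos by (simp add: K_def)
  obtain L where L: "L > 0" "\<And>u n a. \<exists>t. a \<le> l ^ n * t \<and> l ^ n * (t + 1) \<le> a + L * l ^ n \<and>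
    (\<forall>i. 0 \<le> i \<and> i \<le> K \<longrightarrow> x (t + i) = x (u + i))"
    by (rule block_recurs[of K]) blast
  have "often X (1 / real_of_int L) {y. y 0 \<noteq> y (k * l ^ n)}" if "n \<ge> n0" for n
  proof -
    define m where "m = n - n0"
    have klm: "k * l ^ n = l ^ m * K"
      using that by (simp add: m_def K_def flip: power_add)
    define Q where "Q t \<longleftrightarrow> x t = x i \<and> x (t + K) = x (i + K)" for t
    show ?thesis unfolding klm
    proof (rule often_blockI[where n = m and L = L and Q = Q and e = 0 and e' = 0])
      show "\<exists>t. a \<le> l ^ m * t \<and> l ^ m * (t + 1) \<le> a + L * l ^ m \<and> Q t" for a
      proof -
        obtain t where t: "a \<le> l ^ m * t" "l ^ m * (t + 1) \<le> a + L * l ^ m"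
            "\<And>j. 0 \<le> j \<and> j \<le> K \<Longrightarrow> x (t + j) = x (i + j)"
          using L(2)[where a = a and n = m and u = i] by metis
        have "Q t" using t(3)[of 0] t(3)[of K] \<open>K > 0\<close> by (simp add: Q_def)
        then show ?thesis using t by blast
      qed
      show "translate s x \<in> {y. y 0 \<noteq> y (l ^ m * K)}"
        if "Q t" and s: "l ^ m * t + 0 \<le> s" "s < l ^ m * (t + 1) - 0" for t s
      proof -
        define v where "v = s - l ^ m * t"
        have v: "0 \<le> v" "v < l ^ m" using s by (auto simp: v_def algebra_simps)
        have "x (l ^ m * t + v) = x (l ^ m * i + v)"
          "x (l ^ m * (t + K) + v) = x (l ^ m * (i + K) + v)"
          using \<open>Q t\<close> v by (auto intro!: step_pow simp: Q_def)
        then have "x (l ^ m * t + v) \<noteq> x (l ^ m * (t + K) + v)"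
          using ni[OF v] unfolding K_def by simp
        then show ?thesis by (simp add: v_def translate_nth algebra_simps)
      qed
    qed (use L in \<open>auto intro: local_set_differ\<close>)
  qed
  then show ?thesis using L(1) by (intro that[of "1 / real_of_int L" n0]) auto
qed

definition mismatches :: "nat \<Rightarrow> int \<Rightarrow> int \<Rightarrow> int set" where
  "mismatches n i i' = {j. 0 \<le> j \<and> j < l ^ n \<and> x (l ^ n * i + j) \<noteq> x (l ^ n * i' + j)}"

lemma finite_mismatches: "finite (mismatches n i i')"
  by (rule finite_subset[of _ "{0..<l ^ n}"]) (auto simp: mismatches_def)

lemma mismatches_cong: "x i = x u \<Longrightarrow> x i' = x u' \<Longrightarrow> mismatches n i i' = mismatches n u u'"
  unfolding mismatches_def by (rule Collect_cong) (auto simp only: step_pow[of i u] step_pow[of i' u'])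

lemma mismatches_add:
  "mismatches (n + m) i i' =
     (\<Union>j\<in>{0..<l ^ n}. (\<lambda>v. l ^ m * j + v) ` mismatches m (l ^ n * i + j) (l ^ n * i' + j))"
proof (intro equalityI subsetI)
  fix s assume s: "s \<in> mismatches (n + m) i i'"
  define j v where "j = s div l ^ m" and "v = s mod l ^ m"
  have sjv: "s = l ^ m * j + v" by (simp add: j_def v_def)
  have v: "0 \<le> v" "v < l ^ m" using l_pow_pos by (auto simp: v_def)
  have j: "0 \<le> j" using s l_pow_pos by (auto simp: j_def mismatches_def pos_imp_zdiv_nonneg_iff)
  have "l ^ m * j + v < l ^ m * l ^ n" using s by (simp add: mismatches_def power_add mult.commute sjv)
  then have "l ^ m * j < l ^ m * l ^ n" using v(1) by linarith
  then have "j < l ^ n" using mult_less_cancel_left_pos[OF l_pow_pos] by blast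
  moreover have "v \<in> mismatches m (l ^ n * i + j) (l ^ n * i' + j)"
    using s v unfolding mismatches_def sjv by (simp add: power_add algebra_simps)
  ultimately show "s \<in> (\<Union>j\<in>{0..<l ^ n}. (\<lambda>v. l ^ m * j + v) ` mismatches m (l ^ n * i + j) (l ^ n * i' + j))"
    using j sjv by auto
next
  fix s assume "s \<in> (\<Union>j\<in>{0..<l ^ n}. (\<lambda>v. l ^ m * j + v) ` mismatches m (l ^ n * i + j) (l ^ n * i' + j))"
  then obtain j v where j: "0 \<le> j" "j < l ^ n" and v: "v \<in> mismatches m (l ^ n * i + j) (l ^ n * i' + j)"
    and s: "s = l ^ m * j + v" by auto
  have "l ^ m * (j + 1) \<le> l ^ m * l ^ n" using j l_pow_pos[of m] by simp
  then show "s \<in> mismatches (n + m) i i'"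
    using v j l_pow_pos[of m] unfolding mismatches_def s by (simp add: power_add algebra_simps)
qed

text \<open>If every pair in a set of pairs of positions that is closed under passing to the next level has
  a coincidence at some level, then finiteness of the alphabet gives one level \<open>N\<close> at which all
  pairs have one, and every further \<open>N\<close> levels lose at least one in \<open>l ^ N\<close> of the remaining
  sub-blocks.\<close>

lemma mismatch_decay:
  assumes closed: "\<And>i i' j. (i, i') \<in> S \<Longrightarrow> 0 \<le> j \<Longrightarrow> j < l \<Longrightarrow> (l * i + j, l * i' + j) \<in> S"
    and coin: "\<And>i i'. (i, i') \<in> S \<Longrightarrow> \<exists>m j. 0 \<le> j \<and> j < l ^ m \<and> x (l ^ m * i + j) = x (l ^ m * i' + j)"
  obtains N where "N > 0" "\<And>i i' t. (i, i') \<in> S \<Longrightarrow> int (card (mismatches (N * t) i i')) \<le> (l ^ N - 1) ^ t"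
proof -
  have closed_pow: "(l ^ n * i + j, l ^ n * i' + j) \<in> S" if "(i, i') \<in> S" "0 \<le> j" "j < l ^ n" for i i' j n
    using that(2,3)
  proof (induction n arbitrary: j)
    case (Suc n)
    define u v where "u = j div l" and "v = j mod l"
    have j: "j = l * u + v" by (simp add: u_def v_def)
    have v: "0 \<le> v" "v < l" using l_pos by (auto simp: v_def)
    have u: "0 \<le> u" using Suc.prems l_pos by (simp add: u_def pos_imp_zdiv_nonneg_iff)
    have "l * u < l * l ^ n" using j v(1) Suc.prems(2) unfolding power_Suc by linarith
    then have "u < l ^ n" using mult_less_cancel_left_pos[OF l_pos] by blast
    then have "(l * (l ^ n * i + u) + v, l * (l ^ n * i' + u) + v) \<in> S"
      using Suc.IH u v by (intro closed) auto
    moreover have "l ^ Suc n * z + j = l * (l ^ n * z + u) + v" for z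
      by (simp add: j algebra_simps)
    ultimately show ?case by simp
  next
    case 0
    then have "j = 0" by simp
    then show ?case using that(1) by simp
  qed
  have persist: "mismatches (n + m) i i' \<noteq> {0..<l ^ (n + m)}" if ne: "mismatches n i i' \<noteq> {0..<l ^ n}" for n m i i'
  proof -
    obtain j where j: "0 \<le> j" "j < l ^ n" "x (l ^ n * i + j) = x (l ^ n * i' + j)"
      using ne unfolding mismatches_def by force
    have "l ^ m * j \<notin> mismatches (n + m) i i'"
    proof -
      have "x (l ^ m * (l ^ n * i + j) + 0) = x (l ^ m * (l ^ n * i' + j) + 0)"
        by (rule step_pow[OF j(3)]) (use l_pow_pos in auto)
      then show ?thesis by (simp add: mismatches_def power_add algebra_simps)
    qed
    moreover have "l ^ m * j \<in> {0..<l ^ (n + m)}"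
      using j l_pow_pos[of m] by (simp add: power_add mult.commute)
    ultimately show ?thesis by blast
  qed
  define good where "good p m \<longleftrightarrow> (\<forall>i i'. (i, i') \<in> S \<longrightarrow> (x i, x i') = p \<longrightarrow> mismatches m i i' \<noteq> {0..<l ^ m})" for p m
  have "\<exists>m. good p m" for p
  proof (cases "\<exists>i i'. (i, i') \<in> S \<and> (x i, x i') = p")
    case True
    then obtain i i' where i: "(i, i') \<in> S" "(x i, x i') = p" by blast
    obtain m j where "0 \<le> j" "j < l ^ m" "x (l ^ m * i + j) = x (l ^ m * i' + j)" using coin[OF i(1)] by blast
    then have "mismatches m i i' \<noteq> {0..<l ^ m}" by (force simp: mismatches_def)
    have "mismatches m u u' \<noteq> {0..<l ^ m}" if "(x u, x u') = p" for u u'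
    proof -
      have "mismatches m u u' = mismatches m i i'"
        using that i(2) by (intro mismatches_cong) auto
      then show ?thesis using \<open>mismatches m i i' \<noteq> {0..<l ^ m}\<close> by simp
    qed
    then show ?thesis unfolding good_def by blast
  qed (auto simp: good_def)
  then obtain \<mu> where \<mu>: "\<And>p. good p (\<mu> p)" by metis
  define N where "N = Suc (Max (range \<mu>))"
  have hit: "mismatches N i i' \<noteq> {0..<l ^ N}" if "(i, i') \<in> S" for i i'
  proof -
    have "\<mu> (x i, x i') \<le> N" unfolding N_def by (simp add: le_Suc_eq)
    then obtain m where "N = \<mu> (x i, x i') + m" using le_Suc_ex by blast
    then show ?thesis using persist \<mu>[of "(x i, x i')"] that unfolding good_def by blast
  qed
  have "int (card (mismatches (N * t) i i')) \<le> (l ^ N - 1) ^ t" if "(i, i') \<in> S" for i i' t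
    using that
  proof (induction t arbitrary: i i')
    case 0
    have "card (mismatches 0 i i') \<le> card {0..<(1::int)}"
      by (intro card_mono) (auto simp: mismatches_def)
    then show ?case by simp
  next
    case (Suc t)
    let ?M = "mismatches (N * t)"
    have M: "?M (l ^ N * i + j) (l ^ N * i' + j) = {}" if "j \<in> {0..<l ^ N} - mismatches N i i'" for j
    proof -
      have "x (l ^ N * i + j) = x (l ^ N * i' + j)" using that by (auto simp: mismatches_def)
      from step_pow[OF this] show ?thesis unfolding mismatches_def by blast
    qed
    have "mismatches (N * Suc t) i i' =
        (\<Union>j\<in>mismatches N i i'. (\<lambda>v. l ^ (N * t) * j + v) ` ?M (l ^ N * i + j) (l ^ N * i' + j))"
      unfolding mult_Suc_right mismatches_add
      using M by (auto simp: mismatches_def[of N])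
    then have "card (mismatches (N * Suc t) i i') \<le>
        (\<Sum>j\<in>mismatches N i i'. card ((\<lambda>v. l ^ (N * t) * j + v) ` ?M (l ^ N * i + j) (l ^ N * i' + j)))"
      using card_UN_le[OF finite_mismatches] by simp
    also have "\<dots> \<le> (\<Sum>j\<in>mismatches N i i'. card (?M (l ^ N * i + j) (l ^ N * i' + j)))"
      by (intro sum_mono card_image_le finite_mismatches)
    finally have "int (card (mismatches (N * Suc t) i i')) \<le>
        (\<Sum>j\<in>mismatches N i i'. int (card (?M (l ^ N * i + j) (l ^ N * i' + j))))"
      by (simp flip: of_nat_sum)
    also have "\<dots> \<le> (\<Sum>j\<in>mismatches N i i'. (l ^ N - 1) ^ t)"
    proof (intro sum_mono Suc.IH)
      fix j assume "j \<in> mismatches N i i'"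
      then show "(l ^ N * i + j, l ^ N * i' + j) \<in> S"
        using closed_pow[OF Suc.prems] by (auto simp: mismatches_def)
    qed
    also have "\<dots> = int (card (mismatches N i i')) * (l ^ N - 1) ^ t" by simp
    also have "\<dots> \<le> (l ^ N - 1) * (l ^ N - 1) ^ t"
    proof (intro mult_right_mono)
      have "mismatches N i i' \<subset> {0..<l ^ N}" using hit[OF Suc.prems] by (auto simp: mismatches_def)
      then have "card (mismatches N i i') < card {0..<l ^ N}" by (intro psubset_card_mono) auto
      then show "int (card (mismatches N i i')) \<le> l ^ N - 1" using l_pow_pos[of N] by simp
      show "0 \<le> (l ^ N - 1) ^ t" using l_pow_pos[of N] by simp
    qed
    finally show ?case by simp
  qed
  then show ?thesis by (intro that[of N]) (auto simp: N_def)
qed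

text \<open>The condition at distance \<open>k\<close> extends to all multiples of \<open>k\<close>: \<open>|q|\<close> steps produce at most
  \<open>|q|\<close> times as many mismatches, which is still less than a whole block at a high level.\<close>

lemma coincident_decay:
  assumes "coincident k"
  obtains N where "N > 0" "\<And>i q t. int (card (mismatches (N * t) i (i + k * q))) \<le> (l ^ N - 1) ^ t"
proof -
  define S1 where "S1 = {(i, i + k * l ^ n) |i n. True}"
  obtain N1 where N1: "N1 > 0" "\<And>i i' t. (i, i') \<in> S1 \<Longrightarrow> int (card (mismatches (N1 * t) i i')) \<le> (l ^ N1 - 1) ^ t"
  proof (rule mismatch_decay[of S1])
    fix i i' j assume "(i, i') \<in> S1"
    then obtain n where "i' = i + k * l ^ n" by (auto simp: S1_def)
    then have "l * i' + j = (l * i + j) + k * l ^ Suc n" by (simp add: algebra_simps)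
    then show "(l * i + j, l * i' + j) \<in> S1" unfolding S1_def by blast
  next
    fix i i' assume "(i, i') \<in> S1"
    then show "\<exists>m j. 0 \<le> j \<and> j < l ^ m \<and> x (l ^ m * i + j) = x (l ^ m * i' + j)"
      using assms unfolding S1_def coincident_def by blast
  qed blast
  have one: "int (card (mismatches (N1 * t) i (i + k))) \<le> (l ^ N1 - 1) ^ t" for i t
  proof -
    have "(i, i + k * l ^ 0) \<in> S1" unfolding S1_def by blast
    then show ?thesis using N1(2) by simp
  qed
  have steps: "int (card (mismatches (N1 * t) i (i + k * int q))) \<le> int q * (l ^ N1 - 1) ^ t" for i q t
  proof (induction q)
    case 0
    then show ?case by (simp add: mismatches_def)
  next
    case (Suc q)
    have "mismatches (N1 * t) i (i + k * int (Suc q)) \<subseteq>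
        mismatches (N1 * t) i (i + k * int q) \<union> mismatches (N1 * t) (i + k * int q) (i + k * int q + k)"
      by (auto simp: mismatches_def algebra_simps)
    then have "card (mismatches (N1 * t) i (i + k * int (Suc q))) \<le>
        card (mismatches (N1 * t) i (i + k * int q)) + card (mismatches (N1 * t) (i + k * int q) (i + k * int q + k))"
      by (meson card_Un_le card_mono finite_Un finite_mismatches le_trans)
    then show ?case using Suc one[of t "i + k * int q"] by (simp add: algebra_simps)
  qed
  have coin: "\<exists>m j. 0 \<le> j \<and> j < l ^ m \<and> x (l ^ m * i + j) = x (l ^ m * (i + k * int q) + j)" for i q
  proof -
    define b where "b = real_of_int (l ^ N1)"
    have "1 \<le> l ^ N1" using l_pow_pos[of N1] by simp
    then have b: "1 \<le> b" unfolding b_def by linarith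
    define r where "r = (b - 1) / b"
    have r: "0 \<le> r" "r < 1" using b by (auto simp: r_def)
    then have "(\<lambda>t. real q * r ^ t) \<longlonglongrightarrow> real q * 0" by (intro tendsto_intros LIMSEQ_power_zero) auto
    then have "eventually (\<lambda>t. real q * r ^ t < 1) sequentially" by (intro order_tendstoD) auto
    then obtain t where t: "real q * r ^ t < 1" by (auto simp: eventually_sequentially)
    have "real q * (b - 1) ^ t < b ^ t"
      using t b by (simp add: r_def power_divide field_simps)
    then have "real_of_int (int q * (l ^ N1 - 1) ^ t) < real_of_int (l ^ (N1 * t))"
      by (simp add: power_mult b_def)
    then have "int (card (mismatches (N1 * t) i (i + k * int q))) < l ^ (N1 * t)"
      using steps[of t i q] unfolding of_int_less_iff by linarith
    then have "mismatches (N1 * t) i (i + k * int q) \<noteq> {0..<l ^ (N1 * t)}"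
      using less_imp_le[OF l_pow_pos[of "N1 * t"]] by (metis card_atLeastLessThan_int diff_zero int_nat_eq less_irrefl)
    then show ?thesis unfolding mismatches_def by force
  qed
  define S2 where "S2 = {(i, i + k * q) |i q. True}"
  obtain N where "N > 0" "\<And>i i' t. (i, i') \<in> S2 \<Longrightarrow> int (card (mismatches (N * t) i i')) \<le> (l ^ N - 1) ^ t"
  proof (rule mismatch_decay[of S2])
    fix i i' j assume "(i, i') \<in> S2"
    then obtain q where "i' = i + k * q" by (auto simp: S2_def)
    then have "l * i' + j = (l * i + j) + k * (l * q)" by (simp add: algebra_simps)
    then show "(l * i + j, l * i' + j) \<in> S2" unfolding S2_def by blast
  next
    fix i i' assume "(i, i') \<in> S2"
    then obtain q where q: "i' = i + k * q" by (auto simp: S2_def)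
    show "\<exists>m j. 0 \<le> j \<and> j < l ^ m \<and> x (l ^ m * i + j) = x (l ^ m * i' + j)"
    proof (cases "q \<ge> 0")
      case True
      then show ?thesis using coin[of i "nat q"] q by simp
    next
      case False
      then show ?thesis using coin[of i' "nat (- q)"] q by auto (metis)
    qed
  qed blast
  then show ?thesis by (intro that[of N]) (auto simp: S2_def)
qed

end

section \<open>Mismatches along windows and phases\<close>

context self_similar
begin

text \<open>A window of length \<open>M\<close> meets at most \<open>M / l ^ n + 2\<close> blocks of level \<open>n\<close>.\<close>

lemma window_mismatches_le:
  assumes "\<And>i. int (card (mismatches n i (i + p))) \<le> C"
  shows "real (card {s. a \<le> s \<and> s < a + int M \<and> x s \<noteq> x (s + l ^ n * p)}) \<le>
    (real M / real_of_int (l ^ n) + 2) * real_of_int C"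
proof -
  define Q where "Q = l ^ n"
  have Q: "Q > 0" using l_pow_pos by (simp add: Q_def)
  define b1 b2 where "b1 = a div Q" and "b2 = (a + int M) div Q"
  have sub: "{s. a \<le> s \<and> s < a + int M \<and> x s \<noteq> x (s + Q * p)} \<subseteq>
      (\<Union>b\<in>{b1..b2}. (\<lambda>j. Q * b + j) ` mismatches n b (b + p))"
  proof
    fix s assume "s \<in> {s. a \<le> s \<and> s < a + int M \<and> x s \<noteq> x (s + Q * p)}"
    then have s: "a \<le> s" "s < a + int M" "x s \<noteq> x (s + Q * p)" by auto
    define b v where "b = s div Q" and "v = s mod Q"
    have sbv: "s = Q * b + v" by (simp add: b_def v_def)
    have "b1 \<le> b" "b \<le> b2"
      unfolding b_def b1_def b2_def using s Q by (auto intro!: zdiv_mono1)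
    moreover have "v \<in> mismatches n b (b + p)"
    proof -
      have "0 \<le> v" "v < Q" using Q by (auto simp: v_def)
      moreover have "x (Q * b + v) \<noteq> x (Q * (b + p) + v)"
        using s(3) by (simp add: sbv algebra_simps)
      ultimately show ?thesis by (simp add: mismatches_def Q_def)
    qed
    ultimately show "s \<in> (\<Union>b\<in>{b1..b2}. (\<lambda>j. Q * b + j) ` mismatches n b (b + p))"
      using sbv by auto
  qed
  have "0 \<le> C" using assms[of 0] by linarith
  have "card {s. a \<le> s \<and> s < a + int M \<and> x s \<noteq> x (s + Q * p)} \<le>
      card (\<Union>b\<in>{b1..b2}. (\<lambda>j. Q * b + j) ` mismatches n b (b + p))"
    by (rule card_mono[OF _ sub]) (simp add: finite_mismatches)
  also have "\<dots> \<le> (\<Sum>b\<in>{b1..b2}. card ((\<lambda>j. Q * b + j) ` mismatches n b (b + p)))"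
    by (rule card_UN_le) simp
  also have "\<dots> \<le> (\<Sum>b\<in>{b1..b2}. nat C)"
    using assms by (intro sum_mono order_trans[OF card_image_le[OF finite_mismatches]]) (simp add: nat_le_iff le_nat_iff \<open>0 \<le> C\<close>)
  also have "\<dots> = card {b1..b2} * nat C" by simp
  finally have "real (card {s. a \<le> s \<and> s < a + int M \<and> x s \<noteq> x (s + Q * p)}) \<le> real (card {b1..b2}) * real (nat C)"
    by (metis of_nat_le_iff of_nat_mult)
  also have "\<dots> = real (card {b1..b2}) * real_of_int C" using \<open>0 \<le> C\<close> by simp
  also have "\<dots> \<le> (real M / real_of_int Q + 2) * real_of_int C"
  proof (rule mult_right_mono)
    have "b1 \<le> b2" unfolding b1_def b2_def using Q by (intro zdiv_mono1) auto
    then have "real (card {b1..b2}) = real_of_int (b2 - b1 + 1)" by simp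
    moreover have "Q * b1 + a mod Q = a" "Q * b2 + (a + int M) mod Q = a + int M"
      by (simp_all add: b1_def b2_def)
    moreover have "a mod Q < Q" "0 \<le> (a + int M) mod Q" using Q by auto
    ultimately have "Q * b2 - Q * b1 \<le> int M + Q" by linarith
    then have "Q * (b2 - b1) \<le> int M + Q" by (simp add: algebra_simps)
    then have "real_of_int (Q * (b2 - b1)) \<le> real_of_int (int M + Q)" by linarith
    then have "real_of_int (b2 - b1) \<le> real M / real_of_int Q + 1"
      using Q by (simp add: field_simps)
    then show "real (card {b1..b2}) \<le> real M / real_of_int Q + 2"
      using \<open>real (card {b1..b2}) = real_of_int (b2 - b1 + 1)\<close> by simp
  qed (use \<open>0 \<le> C\<close> in simp)
  finally show ?thesis unfolding Q_def .
qed

text \<open>The orbit of \<open>x\<close> splits into \<open>m\<close> classes according to the time modulo \<open>m\<close>; the phases of \<open>y\<close> are the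
  classes that accumulate at \<open>y\<close>. Different classes may have the same closure, so a point can have
  several phases modulo \<open>m\<close>.\<close>

definition phase :: "int \<Rightarrow> (int \<Rightarrow> 'a) \<Rightarrow> int \<Rightarrow> bool" where
  "phase m y j \<longleftrightarrow> (\<forall>R. \<exists>q. agree R y (translate (j + m * q) x))"

lemma exists_phase:
  assumes "y \<in> X" "m > 0"
  obtains j where "0 \<le> j" "j < m" "phase m y j"
proof (rule ccontr)
  assume "\<not> thesis"
  then have "\<forall>j. \<exists>R. 0 \<le> j \<and> j < m \<longrightarrow> (\<forall>q. \<not> agree R y (translate (j + m * q) x))"
    using that unfolding phase_def by blast
  from choice[OF this] obtain \<rho> where
    \<rho>: "\<And>j q. 0 \<le> j \<Longrightarrow> j < m \<Longrightarrow> \<not> agree (\<rho> j) y (translate (j + m * q) x)" by blast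
  define R where "R = Max (insert 0 (\<rho> ` {0..<m}))"
  obtain t where t: "agree R y (translate t x)" using assms(1) in_orbit_closure by blast
  define j where "j = t mod m"
  have j: "0 \<le> j" "j < m" using assms(2) by (auto simp: j_def)
  have "\<rho> j \<le> R" unfolding R_def using j by (intro Max_ge) auto
  moreover have "t = j + m * (t div m)" by (simp add: j_def)
  ultimately show False using \<rho>[OF j] agree_mono[OF t] by metis
qed

text \<open>On each window \<open>y\<close> is a shift of \<open>x\<close> by some \<open>j + m * q'\<close> and is compared with another such shift; the two
  times differ by a multiple of \<open>k l ^ n\<close>.\<close>

lemma phase_mismatches_le:
  assumes "\<And>i q. int (card (mismatches n i (i + k * q))) \<le> C" "phase (k * l ^ n) y j"
  shows "real (card {s. a \<le> s \<and> s < a + int M \<and> y s \<noteq> x (s + j + k * l ^ n * q)}) \<le>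
    (real M / real_of_int (l ^ n) + 2) * real_of_int C"
proof -
  let ?m = "k * l ^ n"
  obtain q' where q': "agree (nat \<bar>a\<bar> + M) y (translate (j + ?m * q') x)"
    using assms(2) unfolding phase_def by blast
  define a' where "a' = a + j + ?m * q'"
  have y: "y s = x (s + j + ?m * q')" if "a \<le> s" "s < a + int M" for s
  proof -
    have "\<bar>s\<bar> \<le> int (nat \<bar>a\<bar> + M)" using that by auto
    then have "y s = translate (j + ?m * q') x s" using q' unfolding agree_def by blast
    then show ?thesis by (simp add: translate_nth add.assoc)
  qed
  have "{s. a \<le> s \<and> s < a + int M \<and> y s \<noteq> x (s + j + ?m * q)} \<subseteq>
      (\<lambda>s. s - (j + ?m * q')) ` {s. a' \<le> s \<and> s < a' + int M \<and> x s \<noteq> x (s + l ^ n * (k * (q - q')))}"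
  proof
    fix s assume "s \<in> {s. a \<le> s \<and> s < a + int M \<and> y s \<noteq> x (s + j + ?m * q)}"
    then have s: "a \<le> s" "s < a + int M" "y s \<noteq> x (s + j + ?m * q)" by auto
    then have "x (s + j + ?m * q') \<noteq> x (s + j + ?m * q' + l ^ n * (k * (q - q')))"
      using y[OF s(1,2)] by (simp add: algebra_simps)
    then show "s \<in> (\<lambda>s. s - (j + ?m * q')) ` {s. a' \<le> s \<and> s < a' + int M \<and> x s \<noteq> x (s + l ^ n * (k * (q - q')))}"
      using s(1,2) unfolding a'_def by (intro image_eqI[of _ _ "s + j + ?m * q'"]) auto
  qed
  moreover have fin: "finite {s. a' \<le> s \<and> s < a' + int M \<and> x s \<noteq> x (s + l ^ n * (k * (q - q')))}"
    by (rule finite_subset[of _ "{a'..<a' + int M}"]) auto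
  ultimately have "card {s. a \<le> s \<and> s < a + int M \<and> y s \<noteq> x (s + j + ?m * q)} \<le>
      card {s. a' \<le> s \<and> s < a' + int M \<and> x s \<noteq> x (s + l ^ n * (k * (q - q')))}"
    by (rule surj_card_le[rotated])
  then show ?thesis using window_mismatches_le[OF assms(1), of a' M "q - q'"] by linarith
qed

lemma common_phase_mismatches_le:
  assumes "\<And>i q. int (card (mismatches n i (i + k * q))) \<le> C" "phase (k * l ^ n) y j" "phase (k * l ^ n) z j"
  shows "real (card {s. a \<le> s \<and> s < a + int M \<and> y s \<noteq> z s}) \<le>
    (real M / real_of_int (l ^ n) + 2) * real_of_int C"
proof -
  let ?m = "k * l ^ n"
  obtain q where q: "agree (nat \<bar>a\<bar> + M) z (translate (j + ?m * q) x)"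
    using assms(3) unfolding phase_def by blast
  have "z s = x (s + j + ?m * q)" if "a \<le> s" "s < a + int M" for s
  proof -
    have "\<bar>s\<bar> \<le> int (nat \<bar>a\<bar> + M)" using that by auto
    then have "z s = translate (j + ?m * q) x s" using q unfolding agree_def by blast
    then show ?thesis by (simp add: translate_nth add.assoc)
  qed
  then have "{s. a \<le> s \<and> s < a + int M \<and> y s \<noteq> z s} = {s. a \<le> s \<and> s < a + int M \<and> y s \<noteq> x (s + j + ?m * q)}"
    by (intro Collect_cong) auto
  then show ?thesis using phase_mismatches_le[OF assms(1,2)] by simp
qed

end

section \<open>Separation of points\<close>

definition difference_density :: "(int \<Rightarrow> 'a) \<Rightarrow> (int \<Rightarrow> 'a) \<Rightarrow> ereal" where
  "difference_density y z = limsup (\<lambda>n. ereal (real (card {s. s < n \<and> y (int s) \<noteq> z (int s)}) / real n))"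

lemma difference_density_le_sep_density:
  fixes y z :: "int \<Rightarrow> 'a"
  assumes "\<And>y z :: int \<Rightarrow> 'a. y 0 \<noteq> z 0 \<Longrightarrow> \<delta> \<le> d y z"
  shows "difference_density y z \<le> sep_density d \<delta> y z"
  unfolding difference_density_def sep_density_def
proof (intro Limsup_mono always_eventually allI)
  fix n
  have "{s. s < n \<and> y (int s) \<noteq> z (int s)} \<subseteq> {k \<in> {..<n}. \<delta> \<le> d ((shift ^^ k) y) ((shift ^^ k) z)}"
    using assms by (auto simp: shift_funpow translate_nth)
  then have "card {s. s < n \<and> y (int s) \<noteq> z (int s)} \<le> card {k \<in> {..<n}. \<delta> \<le> d ((shift ^^ k) y) ((shift ^^ k) z)}"
    by (intro card_mono) auto
  then show "ereal (real (card {s. s < n \<and> y (int s) \<noteq> z (int s)}) / real n) \<le>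
      ereal (real (card {k \<in> {..<n}. \<delta> \<le> d ((shift ^^ k) y) ((shift ^^ k) z)}) / real n)"
    by (simp add: divide_right_mono)
qed

text \<open>The orbits are \<open>\<delta>\<close>-apart only at times at which the sequences differ somewhere in the window of radius
  \<open>R\<close>, so each difference counts at most \<open>2 R + 1\<close> times.\<close>

lemma sep_density_le_of_windows:
  fixes y z :: "int \<Rightarrow> 'a"
  assumes R: "\<And>y z :: int \<Rightarrow> 'a. agree R y z \<Longrightarrow> d y z < \<delta>"
    and count: "\<And>a M. real (card {s. a \<le> s \<and> s < a + int M \<and> y s \<noteq> z s}) \<le> (real M / Q + 2) * C"
  shows "sep_density d \<delta> y z \<le> ereal ((2 * real R + 1) * C / Q)"
proof -
  let ?far = "\<lambda>n. {k \<in> {..<n}. \<delta> \<le> d ((shift ^^ k) y) ((shift ^^ k) z)}"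
  define W where "W = 2 * real R + 1"
  have bound: "real (card (?far n)) \<le> W * ((real n / Q + 2) * C)" for n
  proof -
    have sub: "?far n \<subseteq>
        (\<Union>i\<in>{- int R..int R}. (\<lambda>s. nat (s - i)) ` {s. i \<le> s \<and> s < i + int n \<and> y s \<noteq> z s})"
    proof
      fix k assume "k \<in> ?far n"
      then have k: "k < n" "\<not> agree R (translate (int k) y) (translate (int k) z)"
        using R[of "translate (int k) y" "translate (int k) z"] by (auto simp: shift_funpow)
      then obtain i where i: "\<bar>i\<bar> \<le> int R" "y (i + int k) \<noteq> z (i + int k)"
        unfolding agree_def translate_nth by blast
      then have "k \<in> (\<lambda>s. nat (s - i)) ` {s. i \<le> s \<and> s < i + int n \<and> y s \<noteq> z s}"
        using k(1) by (intro image_eqI[of _ _ "i + int k"]) auto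
      then show "k \<in> (\<Union>i\<in>{- int R..int R}. (\<lambda>s. nat (s - i)) ` {s. i \<le> s \<and> s < i + int n \<and> y s \<noteq> z s})"
        using i(1) by (intro UN_I[of i]) auto
    qed
    have fin: "finite {s. i \<le> s \<and> s < i + int n \<and> y s \<noteq> z s}" for i
      by (rule finite_subset[of _ "{i..<i + int n}"]) auto
    have "card (?far n) \<le>
        card (\<Union>i\<in>{- int R..int R}. (\<lambda>s. nat (s - i)) ` {s. i \<le> s \<and> s < i + int n \<and> y s \<noteq> z s})"
      by (rule card_mono[OF _ sub]) (simp add: fin)
    also have "\<dots> \<le> (\<Sum>i\<in>{- int R..int R}. card ((\<lambda>s. nat (s - i)) ` {s. i \<le> s \<and> s < i + int n \<and> y s \<noteq> z s}))"
      by (rule card_UN_le) simp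
    also have "\<dots> \<le> (\<Sum>i\<in>{- int R..int R}. card {s. i \<le> s \<and> s < i + int n \<and> y s \<noteq> z s})"
      by (intro sum_mono card_image_le fin)
    finally have "real (card (?far n)) \<le>
        (\<Sum>i\<in>{- int R..int R}. real (card {s. i \<le> s \<and> s < i + int n \<and> y s \<noteq> z s}))"
      by (simp flip: of_nat_sum)
    also have "\<dots> \<le> (\<Sum>i\<in>{- int R..int R}. (real n / Q + 2) * C)"
      by (intro sum_mono count)
    also have "\<dots> = W * ((real n / Q + 2) * C)" by (simp add: W_def)
    finally show ?thesis .
  qed
  have "sep_density d \<delta> y z \<le> limsup (\<lambda>n. ereal (W * C / Q + (2 * W * C) * inverse (real n)))"
    unfolding sep_density_def
  proof (intro Limsup_mono eventually_mono[OF eventually_gt_at_top[of 0]])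
    fix n :: nat assume n: "n > 0"
    have "real (card (?far n)) / real n \<le>
        W * ((real n / Q + 2) * C) / real n"
      using bound[of n] by (intro divide_right_mono) auto
    also have "\<dots> = W * C / Q + (2 * W * C) * inverse (real n)"
      using n by (simp add: field_simps)
    finally show "ereal (real (card (?far n)) / real n) \<le>
        ereal (W * C / Q + (2 * W * C) * inverse (real n))" by simp
  qed
  also have "\<dots> = ereal (W * C / Q + (2 * W * C) * 0)"
  proof (rule lim_imp_Limsup)
    have "(\<lambda>n. W * C / Q + (2 * W * C) * inverse (real n)) \<longlonglongrightarrow> W * C / Q + (2 * W * C) * 0"
      by (intro tendsto_intros lim_inverse_n)
    then show "(\<lambda>n. ereal (W * C / Q + (2 * W * C) * inverse (real n))) \<longlonglongrightarrow> ereal (W * C / Q + (2 * W * C) * 0)"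
      by (simp only: lim_ereal)
  qed simp
  finally show ?thesis by (simp add: W_def)
qed

lemma often_differ_density:
  assumes "often X c {y. y 0 \<noteq> y m}" "y \<in> X" "\<And>t y. y \<in> X \<Longrightarrow> translate t y \<in> X"
  shows "ereal c \<le> difference_density y (translate m y)"
proof -
  obtain M where M: "M > 0" "\<And>y. y \<in> X \<Longrightarrow>
      c * real M \<le> real (card {s. s < M \<and> translate (int s) y \<in> {y. y 0 \<noteq> y m}})"
    using assms(1) unfolding often_def by blast
  define f where "f n = card {s. s < n \<and> y (int s) \<noteq> y (int s + m)}" for n
  have f: "c * real (M * r) \<le> real (f (M * r))" for r
  proof (induction r)
    case (Suc r)
    let ?A = "{s. s < M \<and> translate (int s) (translate (int (M * r)) y) \<in> {y. y 0 \<noteq> y m}}"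
    have "{s. s < M * r \<and> y (int s) \<noteq> y (int s + m)} \<union> (\<lambda>s. M * r + s) ` ?A \<subseteq>
        {s. s < M * Suc r \<and> y (int s) \<noteq> y (int s + m)}"
      by (auto simp: translate_nth algebra_simps)
    then have "card ({s. s < M * r \<and> y (int s) \<noteq> y (int s + m)} \<union> (\<lambda>s. M * r + s) ` ?A) \<le> f (M * Suc r)"
      unfolding f_def by (intro card_mono) auto
    moreover have "card ({s. s < M * r \<and> y (int s) \<noteq> y (int s + m)} \<union> (\<lambda>s. M * r + s) ` ?A) =
        f (M * r) + card ((\<lambda>s. M * r + s) ` ?A)"
      unfolding f_def by (intro card_Un_disjoint) auto
    moreover have "card ((\<lambda>s. M * r + s) ` ?A) = card ?A" by (intro card_image) auto
    moreover have "c * real M \<le> real (card ?A)" using M(2) assms(2,3) by blast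
    ultimately show ?case using Suc by (simp add: algebra_simps)
  qed (simp add: f_def)
  let ?g = "\<lambda>n. ereal (real (f n) / real n)"
  have "ereal c \<le> limsup (?g \<circ> (\<lambda>r. M * r))"
  proof (rule le_Limsup)
    show "eventually (\<lambda>r. ereal c \<le> (?g \<circ> (\<lambda>r. M * r)) r) sequentially"
      using eventually_gt_at_top[of 0]
    proof eventually_elim
      case (elim r)
      then have "real (M * r) > 0" using M(1) by simp
      then show ?case using f[of r] unfolding comp_def ereal_less_eq by (subst pos_le_divide_eq)
    qed
  qed simp
  also have "\<dots> \<le> limsup ?g"
    using M(1) by (intro limsup_subseq_mono) (simp add: strict_mono_def)
  also have "\<dots> = difference_density y (translate m y)"
    unfolding difference_density_def f_def translate_nth ..
  finally show ?thesis .
qed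

section \<open>Elementary properties of amorphic complexity\<close>

lemma eventually_at_right_0_less: "e > 0 \<Longrightarrow> eventually (\<lambda>\<nu>::real. 0 < \<nu> \<and> \<nu> < e) (at_right 0)"
  by (auto simp: eventually_at_right_field)

lemma tendsto_divide_neg_ln: "((\<lambda>\<nu>. A / (- ln \<nu>)) \<longlongrightarrow> 0) (at_right (0::real))"
proof -
  have "filterlim (\<lambda>\<nu>::real. - ln \<nu>) at_top (at_right 0)"
    using ln_at_0 by (simp add: filterlim_uminus_at_top)
  then show ?thesis
    by (intro tendsto_divide_0[OF tendsto_const] filterlim_at_top_imp_at_infinity)
qed

lemma ln_enat_mono: "m \<le> m' \<Longrightarrow> ln_enat m \<le> ln_enat m'"
proof (cases m')
  case (enat k')
  assume "m \<le> m'"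
  then obtain k where k: "m = enat k" "k \<le> k'" using enat by (cases m) auto
  then show ?thesis using enat by (cases "k = 0"; cases "k' = 0") (auto simp: ln_enat_def)
qed (simp add: ln_enat_def)

lemma ln_enat_nonneg: "0 \<le> ln_enat m"
proof (cases m)
  case (enat k)
  then show ?thesis by (cases k) (simp_all add: ln_enat_def)
qed (simp add: ln_enat_def)

lemma Sep_geI:
  assumes "finite Y" "Y \<subseteq> X" "\<And>y z. y \<in> Y \<Longrightarrow> z \<in> Y \<Longrightarrow> y \<noteq> z \<Longrightarrow> ereal \<nu> \<le> sep_density d \<delta> y z"
  shows "enat (card Y) \<le> Sep d X \<delta> \<nu>"
proof -
  have "enat (card Y) = (if finite Y then enat (card Y) else \<infinity>)" using assms(1) by simp
  also have "\<dots> \<le> Sep d X \<delta> \<nu>"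
    unfolding Sep_def by (rule SUP_upper) (use assms in auto)
  finally show ?thesis .
qed

lemma Sep_leI:
  assumes "\<And>Y. Y \<subseteq> X \<Longrightarrow> (\<And>y z. y \<in> Y \<Longrightarrow> z \<in> Y \<Longrightarrow> y \<noteq> z \<Longrightarrow> ereal \<nu> \<le> sep_density d \<delta> y z) \<Longrightarrow>
    finite Y \<and> card Y \<le> N"
  shows "Sep d X \<delta> \<nu> \<le> enat N"
  unfolding Sep_def
proof (rule SUP_least)
  fix Y assume "Y \<in> {Y. Y \<subseteq> X \<and> (\<forall>x\<in>Y. \<forall>y\<in>Y. x \<noteq> y \<longrightarrow> ereal \<nu> \<le> sep_density d \<delta> x y)}"
  then have "finite Y \<and> card Y \<le> N" using assms[of Y] by simp
  then show "(if finite Y then enat (card Y) else \<infinity>) \<le> enat N" by simp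
qed

lemma Sep_antimono: "\<nu> \<le> \<nu>' \<Longrightarrow> Sep d X \<delta> \<nu>' \<le> Sep d X \<delta> \<nu>"
  unfolding Sep_def
  by (rule SUP_subset_mono) (auto intro: order_trans[of "ereal \<nu>" "ereal \<nu>'"])

lemma lower_ac_le_upper_ac: "lower_ac d X \<le> upper_ac d X"
  unfolding lower_ac_def upper_ac_def
  by (intro SUP_mono') (auto intro!: Liminf_le_Limsup)

lemma ac_quotient_nonneg:
  "eventually (\<lambda>\<nu>. 0 \<le> ln_enat (Sep d X \<delta> \<nu>) / ereal (- ln \<nu>)) (at_right 0)"
  using eventually_at_right_0_less[OF zero_less_one]
proof eventually_elim
  case (elim \<nu>)
  then have "0 / ereal (- ln \<nu>) \<le> ln_enat (Sep d X \<delta> \<nu>) / ereal (- ln \<nu>)"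
    by (intro ereal_divide_right_mono ln_enat_nonneg) simp
  then show ?case by simp
qed

lemma lower_ac_nonneg: "0 \<le> lower_ac d X"
proof -
  have "0 \<le> Liminf (at_right 0) (\<lambda>\<nu>. ln_enat (Sep d X 1 \<nu>) / ereal (- ln \<nu>))"
    by (rule Liminf_bounded[OF ac_quotient_nonneg])
  also have "\<dots> \<le> lower_ac d X" unfolding lower_ac_def by (rule SUP_upper) simp
  finally show ?thesis .
qed

lemma upper_ac_le_of_polynomial_bound:
  assumes "\<And>\<delta>. \<delta> > 0 \<Longrightarrow> \<exists>A. eventually (\<lambda>\<nu>. ln_enat (Sep d X \<delta> \<nu>) \<le> ereal (A + s * (- ln \<nu>))) (at_right 0)"
  shows "upper_ac d X \<le> ereal s"
  unfolding upper_ac_def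
proof (rule SUP_least)
  fix \<delta> :: real assume "\<delta> \<in> {0<..}"
  then obtain A where A: "eventually (\<lambda>\<nu>. ln_enat (Sep d X \<delta> \<nu>) \<le> ereal (A + s * (- ln \<nu>))) (at_right 0)"
    using assms by auto
  have "Limsup (at_right 0) (\<lambda>\<nu>. ln_enat (Sep d X \<delta> \<nu>) / ereal (- ln \<nu>)) \<le>
      Limsup (at_right 0) (\<lambda>\<nu>. ereal (A / (- ln \<nu>) + s))"
  proof (rule Limsup_mono)
    show "eventually (\<lambda>\<nu>. ln_enat (Sep d X \<delta> \<nu>) / ereal (- ln \<nu>) \<le> ereal (A / (- ln \<nu>) + s)) (at_right 0)"
      using A eventually_at_right_0_less[OF zero_less_one]
    proof eventually_elim
      case (elim \<nu>)
      then have pos: "- ln \<nu> > 0" by simp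
      have "ln_enat (Sep d X \<delta> \<nu>) / ereal (- ln \<nu>) \<le> ereal (A + s * (- ln \<nu>)) / ereal (- ln \<nu>)"
        using elim pos by (intro ereal_divide_right_mono) auto
      also have "\<dots> = ereal ((A + s * (- ln \<nu>)) / (- ln \<nu>))" using pos by simp
      also have "(A + s * (- ln \<nu>)) / (- ln \<nu>) = A / (- ln \<nu>) + s"
        using pos by (subst add_divide_distrib) simp
      finally show ?case .
    qed
  qed
  also have "\<dots> = ereal (0 + s)"
  proof (rule lim_imp_Limsup)
    have "((\<lambda>\<nu>. A / (- ln \<nu>) + s) \<longlongrightarrow> 0 + s) (at_right 0)"
      by (intro tendsto_add tendsto_const tendsto_divide_neg_ln)
    then show "((\<lambda>\<nu>. ereal (A / (- ln \<nu>) + s)) \<longlongrightarrow> ereal (0 + s)) (at_right 0)"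
      by (simp only: lim_ereal)
  qed simp
  finally show "Limsup (at_right 0) (\<lambda>\<nu>. ln_enat (Sep d X \<delta> \<nu>) / ereal (- ln \<nu>)) \<le> ereal s" by simp
qed

lemma lower_ac_ge_of_polynomial_bound:
  assumes "\<delta> > 0" "eventually (\<lambda>\<nu>. ereal (s * (- ln \<nu>) - A) \<le> ln_enat (Sep d X \<delta> \<nu>)) (at_right 0)"
  shows "ereal s \<le> lower_ac d X"
proof -
  have "ereal s = ereal (s - 0)" by simp
  also have "\<dots> = Liminf (at_right 0) (\<lambda>\<nu>. ereal (s - A / (- ln \<nu>)))"
  proof (rule lim_imp_Liminf[symmetric])
    have "((\<lambda>\<nu>. s - A / (- ln \<nu>)) \<longlongrightarrow> s - 0) (at_right 0)"
      by (intro tendsto_diff tendsto_const tendsto_divide_neg_ln)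
    then show "((\<lambda>\<nu>. ereal (s - A / (- ln \<nu>))) \<longlongrightarrow> ereal (s - 0)) (at_right 0)"
      by (simp only: lim_ereal)
  qed simp
  also have "\<dots> \<le> Liminf (at_right 0) (\<lambda>\<nu>. ln_enat (Sep d X \<delta> \<nu>) / ereal (- ln \<nu>))"
  proof (rule Liminf_mono)
    show "eventually (\<lambda>\<nu>. ereal (s - A / (- ln \<nu>)) \<le> ln_enat (Sep d X \<delta> \<nu>) / ereal (- ln \<nu>)) (at_right 0)"
      using assms(2) eventually_at_right_0_less[OF zero_less_one]
    proof eventually_elim
      case (elim \<nu>)
      then have pos: "- ln \<nu> > 0" by simp
      have "ereal (s - A / (- ln \<nu>)) = ereal (s * (- ln \<nu>) - A) / ereal (- ln \<nu>)"
        using pos by (simp add: diff_divide_distrib)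
      also have "\<dots> \<le> ln_enat (Sep d X \<delta> \<nu>) / ereal (- ln \<nu>)"
        using elim pos by (intro ereal_divide_right_mono) auto
      finally show ?case .
    qed
  qed
  also have "\<dots> \<le> lower_ac d X" unfolding lower_ac_def using assms(1) by (intro SUP_upper) simp
  finally show ?thesis .
qed

lemma lower_ac_infinity:
  assumes "\<delta> > 0" "\<nu>0 > 0" "Sep d X \<delta> \<nu>0 = \<infinity>"
  shows "lower_ac d X = \<infinity>"
proof -
  have "ereal s \<le> lower_ac d X" for s
  proof (rule lower_ac_ge_of_polynomial_bound[OF assms(1), of s 0])
    show "eventually (\<lambda>\<nu>. ereal (s * (- ln \<nu>) - 0) \<le> ln_enat (Sep d X \<delta> \<nu>)) (at_right 0)"
      using eventually_at_right_0_less[OF assms(2)]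
    proof eventually_elim
      case (elim \<nu>)
      then have "Sep d X \<delta> \<nu> = \<infinity>" using Sep_antimono[of \<nu> \<nu>0 d X \<delta>] assms(3) by simp
      then show ?case by (simp add: ln_enat_def)
    qed
  qed
  then show ?thesis by (rule ereal_top)
qed

lemma finite_imp_upper_ac_le_0:
  assumes "finite X" shows "upper_ac d X \<le> 0"
proof -
  have "upper_ac d X \<le> ereal 0"
  proof (rule upper_ac_le_of_polynomial_bound)
    fix \<delta> :: real
    have "Sep d X \<delta> \<nu> \<le> enat (card X)" for \<nu>
      using assms by (intro Sep_leI) (auto intro: finite_subset card_mono)
    then have "ln_enat (Sep d X \<delta> \<nu>) \<le> ereal (ln (real (card X)) + 0 * (- ln \<nu>))" for \<nu>
      using ln_enat_mono[of "Sep d X \<delta> \<nu>" "enat (card X)"] by (simp add: ln_enat_def)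
    then show "\<exists>A. eventually (\<lambda>\<nu>. ln_enat (Sep d X \<delta> \<nu>) \<le> ereal (A + 0 * (- ln \<nu>))) (at_right 0)"
      by (intro exI always_eventually allI)
  qed
  then show ?thesis by (simp add: zero_ereal_def)
qed

section \<open>Amorphic complexity of self-similar subshifts\<close>

context self_similar
begin

text \<open>The first \<open>l ^ n\<close> shifts of \<open>x\<close> are pairwise separated at the scale \<open>1 / (L l ^ n)\<close>, so the separation
  numbers grow at least linearly in \<open>1 / \<nu>\<close>.\<close>

lemma aperiodic_imp_lower_ac_ge_1:
  assumes "\<And>k. k > 0 \<Longrightarrow> \<exists>i. x i \<noteq> x (i + k)" "induces_shift_topology d"
  shows "1 \<le> lower_ac d X"
proof -
  interpret Metric_space UNIV d using assms(2) by (simp add: induces_shift_topology_def)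
  obtain \<delta> where \<delta>: "\<delta> > 0" "\<And>y z. y 0 \<noteq> z 0 \<Longrightarrow> \<delta> \<le> d y z"
    using metric_separates_coordinate_0[OF assms(2)] by blast
  obtain L where L: "L > 0"
    "\<And>n k. 0 < k \<Longrightarrow> k \<le> l ^ n \<Longrightarrow> often X (1 / real_of_int (L * l ^ n)) {y. y 0 \<noteq> y k}"
    using aperiodic_often_differ[OF assms(1)] by blast
  have sep: "ereal (1 / real_of_int (L * l ^ n)) \<le> sep_density d \<delta> (translate i x) (translate j x)"
    if "0 \<le> i" "i < j" "j < l ^ n" for i j n
  proof -
    have "ereal (1 / real_of_int (L * l ^ n)) \<le> difference_density (translate i x) (translate (j - i) (translate i x))"
      using that by (intro often_differ_density[OF L(2)] orbit_in_orbit_closure translate_in_orbit_closure) auto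
    also have "\<dots> \<le> sep_density d \<delta> (translate i x) (translate (j - i) (translate i x))"
      using \<delta>(2) by (rule difference_density_le_sep_density)
    finally show ?thesis by simp
  qed
  have sym: "sep_density d \<delta> y z = sep_density d \<delta> z y" for y z
    unfolding sep_density_def by (subst commute) simp
  have inj: "inj (\<lambda>i. translate i x)"
  proof (rule linorder_injI)
    fix i j :: int assume "i < j"
    then obtain s where "x s \<noteq> x (s + (j - i))" using assms(1)[of "j - i"] by auto
    then have "translate i x (s - i) \<noteq> translate j x (s - i)" by (simp add: translate_nth algebra_simps)
    then show "translate i x \<noteq> translate j x" by metis
  qed
  have Sep_ge: "enat (nat (l ^ n)) \<le> Sep d X \<delta> \<nu>" if "\<nu> \<le> 1 / real_of_int (L * l ^ n)" for n \<nu>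
  proof -
    let ?Y = "(\<lambda>i. translate i x) ` {0..<l ^ n}"
    have "enat (card ?Y) \<le> Sep d X \<delta> \<nu>"
    proof (rule Sep_geI)
      show "?Y \<subseteq> X" using orbit_in_orbit_closure by blast
      fix y z assume "y \<in> ?Y" "z \<in> ?Y" "y \<noteq> z"
      then obtain i j where ij: "0 \<le> i" "i < l ^ n" "0 \<le> j" "j < l ^ n" "y = translate i x" "z = translate j x"
        by auto
      with \<open>y \<noteq> z\<close> have "i \<noteq> j" by blast
      have "ereal (1 / real_of_int (L * l ^ n)) \<le> sep_density d \<delta> y z"
        using sep[of i j n] sep[of j i n] ij \<open>i \<noteq> j\<close> sym[of y z] by (cases "i < j") auto
      moreover have "ereal \<nu> \<le> ereal (1 / real_of_int (L * l ^ n))" using that by simp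
      ultimately show "ereal \<nu> \<le> sep_density d \<delta> y z" by (rule order_trans[rotated])
    qed simp
    moreover have "card ?Y = nat (l ^ n)" using card_image[OF inj_on_subset[OF inj]] by simp
    ultimately show ?thesis by simp
  qed
  define A where "A = ln (real_of_int (L * l))"
  have "eventually (\<lambda>\<nu>. ereal (1 * (- ln \<nu>) - A) \<le> ln_enat (Sep d X \<delta> \<nu>)) (at_right 0)"
    using eventually_at_right_0_less[of "1 / real_of_int L"] L(1)
  proof (simp, elim eventually_mono)
    fix \<nu> :: real assume \<nu>: "0 < \<nu> \<and> \<nu> < 1 / real_of_int L"
    define b where "b = real_of_int l"
    have b: "b \<ge> 2" using l_ge_2 by (simp add: b_def)
    \<comment> \<open>the level at which blocks have length about \<open>1 / \<nu>\<close>\<close>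
    define n where "n = (LEAST n. 1 / (real_of_int L * \<nu>) < b ^ n)"
    have ex: "\<exists>n. 1 / (real_of_int L * \<nu>) < b ^ n" using b by (intro real_arch_pow) auto
    have n: "1 / (real_of_int L * \<nu>) < b ^ n" unfolding n_def using ex by (rule LeastI_ex)
    have "n \<noteq> 0"
    proof
      assume "n = 0"
      then show False using n \<nu> L(1) by (simp add: field_simps)
    qed
    then obtain n' where n': "n = Suc n'" using not0_implies_Suc by blast
    have "\<not> 1 / (real_of_int L * \<nu>) < b ^ n'"
      using not_less_Least[of n' "\<lambda>n. 1 / (real_of_int L * \<nu>) < b ^ n"] n' unfolding n_def by simp
    then have "b ^ n' \<le> 1 / (real_of_int L * \<nu>)" by simp
    then have "\<nu> \<le> 1 / (real_of_int L * b ^ n')"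
      using \<nu> L(1) b by (simp add: field_simps)
    then have "enat (nat (l ^ n')) \<le> Sep d X \<delta> \<nu>" by (intro Sep_ge) (simp add: b_def)
    then have "ln_enat (enat (nat (l ^ n'))) \<le> ln_enat (Sep d X \<delta> \<nu>)" by (rule ln_enat_mono)
    moreover have "real (nat (l ^ n')) = b ^ n'" using l_pow_pos[of n'] by (simp add: b_def less_imp_le)
    ultimately have le: "ereal (ln (b ^ n')) \<le> ln_enat (Sep d X \<delta> \<nu>)" by (simp add: ln_enat_def)
    have "- ln \<nu> - A = ln (1 / (real_of_int L * \<nu>) / b)"
      using \<nu> L(1) b by (simp add: A_def b_def ln_div ln_mult)
    also have "\<dots> \<le> ln (b ^ n')"
      using n b \<nu> L(1) unfolding n' by (subst ln_le_cancel_iff) (auto simp: field_simps)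
    finally have "ereal (- ln \<nu> - A) \<le> ereal (ln (b ^ n'))" by simp
    then show "ereal (- ln \<nu> - A) \<le> ln_enat (Sep d X \<delta> \<nu>)" using le by (rule order_trans)
  qed
  from lower_ac_ge_of_polynomial_bound[OF \<delta>(1) this] show ?thesis by (simp add: one_ereal_def)
qed

text \<open>A periodic point has a finite orbit, and a finite orbit is closed.\<close>

lemma infinite_imp_aperiodic:
  assumes "infinite X" "k > 0" shows "\<exists>i. x i \<noteq> x (i + k)"
proof (rule ccontr)
  assume "\<not> ?thesis"
  then have per: "x (i + k) = x i" for i by metis
  have perq: "x (i + k * int q) = x i" for i q
  proof (induction q)
    case (Suc q)
    have "x (i + k * int (Suc q)) = x (i + k * int q + k)" by (simp add: algebra_simps)
    then show ?case using Suc per by simp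
  qed simp
  have "translate t x \<in> (\<lambda>t. translate t x) ` {0..<k}" for t
  proof (rule image_eqI)
    show "t mod k \<in> {0..<k}" using assms(2) by simp
    have t: "t = t mod k + k * (t div k)" by simp
    show "translate t x = translate (t mod k) x"
    proof
      fix i
      show "translate t x i = translate (t mod k) x i"
      proof (cases "t div k \<ge> 0")
        case True
        then show ?thesis using perq[of "i + t mod k" "nat (t div k)"] t
          by (simp add: translate_nth add.assoc)
      next
        case False
        then have "i + t + k * int (nat (- (t div k))) = i + t mod k"
          using t by (simp add: algebra_simps)
        then show ?thesis using perq[of "i + t" "nat (- (t div k))"]
          by (simp add: translate_nth add.assoc)
      qed
    qed
  qed
  then have orbit: "range (\<lambda>t. translate t x) \<subseteq> (\<lambda>t. translate t x) ` {0..<k}" by blast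
  define F where "F = (\<lambda>t. translate t x) ` {0..<k}"
  have F: "finite F" "\<And>t. translate t x \<in> F" using orbit by (auto simp: F_def)
  have "y \<in> F" if y: "y \<in> X" for y
  proof (rule ccontr)
    assume "y \<notin> F"
    then have "\<forall>z. \<exists>i. z \<in> F \<longrightarrow> y i \<noteq> z i" by (metis ext)
    from choice[OF this] obtain \<iota> where \<iota>: "\<And>z. z \<in> F \<Longrightarrow> y (\<iota> z) \<noteq> z (\<iota> z)" by blast
    define R where "R = Max (insert 0 ((\<lambda>z. nat \<bar>\<iota> z\<bar>) ` F))"
    obtain t where t: "agree R y (translate t x)" using y in_orbit_closure by blast
    have "nat \<bar>\<iota> (translate t x)\<bar> \<le> R" unfolding R_def using F by (intro Max_ge) auto
    then have "\<bar>\<iota> (translate t x)\<bar> \<le> int R" by linarith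
    then show False using t \<iota>[OF F(2)] unfolding agree_def by blast
  qed
  then have "X \<subseteq> F" by blast
  then show False using assms(1) F(1) finite_subset by blast
qed

text \<open>Points with a common phase modulo \<open>k l ^ n\<close> are close in density, so at most \<open>k l ^ n\<close> points
  are separated at a scale proportional to \<open>(1 - 1 / l ^ N) ^ (n / N)\<close>, for \<open>n\<close> a multiple of \<open>N\<close>. Both
  numbers are exponential in \<open>n\<close>, so the growth is polynomial.\<close>

lemma coincident_imp_upper_ac_finite:
  assumes "coincident k" "k > 0" "induces_shift_topology d"
  shows "upper_ac d X < \<infinity>"
proof -
  obtain N where N: "N > 0" "\<And>i q t. int (card (mismatches (N * t) i (i + k * q))) \<le> (l ^ N - 1) ^ t"
    using coincident_decay[OF assms(1)] by blast
  define b where "b = real_of_int (l ^ N)"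
  define r where "r = (b - 1) / b"
  have "l ^ 1 \<le> l ^ N" using N(1) l_pos by (intro power_increasing) auto
  then have "2 \<le> l ^ N" using l_ge_2 by simp
  then have b: "b \<ge> 2" unfolding b_def by linarith
  have r: "0 < r" "r < 1" using b by (auto simp: r_def)
  define s where "s = ln b / (- ln r)"
  have lr: "ln r < 0" using r by simp
  have "upper_ac d X \<le> ereal s"
  proof (rule upper_ac_le_of_polynomial_bound)
    fix \<delta> :: real assume "\<delta> > 0"
    then obtain R where R: "\<And>y z. agree R y z \<Longrightarrow> d y z < \<delta>"
      using metric_uniform_window[OF assms(3)] by blast
    define C where "C = 2 * real R + 1"
    have C: "C > 0" by (simp add: C_def)
    have Sep: "Sep d X \<delta> \<nu> \<le> enat (nat (k * l ^ (N * t)))" if \<nu>: "C * r ^ t < \<nu>" for t \<nu>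
    proof (rule Sep_leI)
      fix Y assume Y: "Y \<subseteq> X" "\<And>y z. y \<in> Y \<Longrightarrow> z \<in> Y \<Longrightarrow> y \<noteq> z \<Longrightarrow> ereal \<nu> \<le> sep_density d \<delta> y z"
      let ?m = "k * l ^ (N * t)"
      have "?m > 0" using assms(2) l_pow_pos by simp
      have "\<forall>y. \<exists>j. y \<in> X \<longrightarrow> 0 \<le> j \<and> j < ?m \<and> phase ?m y j"
        using exists_phase[OF _ \<open>?m > 0\<close>] by metis
      from choice[OF this] obtain \<phi> where
        \<phi>: "\<And>y. y \<in> X \<Longrightarrow> 0 \<le> \<phi> y \<and> \<phi> y < ?m \<and> phase ?m y (\<phi> y)" by blast
      have "inj_on \<phi> Y"
      proof (rule inj_onI, rule ccontr)
        fix y z assume yz: "y \<in> Y" "z \<in> Y" "\<phi> y = \<phi> z" "y \<noteq> z"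
        have "y \<in> X" "z \<in> X" using yz(1,2) Y(1) by auto
        then have ph: "phase ?m y (\<phi> y)" "phase ?m z (\<phi> y)"
          using \<phi>[of y] \<phi>[of z] unfolding yz(3) by blast+
        have "sep_density d \<delta> y z \<le> ereal ((2 * real R + 1) * real_of_int ((l ^ N - 1) ^ t) / real_of_int (l ^ (N * t)))"
          using R common_phase_mismatches_le[OF N(2) ph] by (rule sep_density_le_of_windows)
        also have "\<dots> = ereal (C * r ^ t)"
          by (simp add: C_def r_def b_def power_divide power_mult)
        also have "\<dots> < ereal \<nu>" using \<nu> by simp
        finally show False using Y(2)[OF yz(1,2,4)] by simp
      qed
      moreover have "\<phi> ` Y \<subseteq> {0..<?m}" using \<phi> Y(1) by auto
      ultimately have "finite Y" "card Y \<le> card {0..<?m}"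
        using inj_on_finite card_inj_on_le by (blast intro: finite_atLeastLessThan_int)+
      then show "finite Y \<and> card Y \<le> nat ?m" by simp
    qed
    define A where "A = ln (real_of_int k) + (ln C / (- ln r) + 2) * ln b"
    have "eventually (\<lambda>\<nu>. ln_enat (Sep d X \<delta> \<nu>) \<le> ereal (A + s * (- ln \<nu>))) (at_right 0)"
      using eventually_at_right_0_less[OF C]
    proof eventually_elim
      case (elim \<nu>)
      then have \<nu>: "0 < \<nu>" "\<nu> < C" by auto
      \<comment> \<open>the least \<open>t\<close>, up to rounding, with \<open>C r ^ t < \<nu>\<close>\<close>
      define \<tau> where "\<tau> = (ln C - ln \<nu>) / (- ln r)"
      have "\<tau> > 0" using \<nu> C lr by (simp add: \<tau>_def divide_pos_neg)
      define t where "t = nat \<lceil>\<tau>\<rceil> + 1"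
      have t: "\<tau> < real t" "real t \<le> \<tau> + 2" using \<open>\<tau> > 0\<close> unfolding t_def by linarith+
      have "ln (C * r ^ t) < ln \<nu>"
      proof -
        have "ln C - ln \<nu> = \<tau> * (- ln r)" using lr by (simp add: \<tau>_def)
        also have "\<dots> < real t * (- ln r)" using t(1) lr by (intro mult_strict_right_mono) auto
        finally show ?thesis using C r by (simp add: ln_mult ln_realpow)
      qed
      then have "C * r ^ t < \<nu>" using C r \<nu> by (subst (asm) ln_less_cancel_iff) auto
      then have "ln_enat (Sep d X \<delta> \<nu>) \<le> ln_enat (enat (nat (k * l ^ (N * t))))"
        by (intro ln_enat_mono Sep)
      also have "\<dots> = ereal (ln (real_of_int k) + real t * ln b)"
      proof -
        have "k * l ^ (N * t) > 0" using assms(2) l_pow_pos by simp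
        then have "real (nat (k * l ^ (N * t))) = real_of_int (k * l ^ (N * t))" by (intro of_nat_nat less_imp_le)
        also have "\<dots> = real_of_int k * b ^ t" by (simp add: b_def power_mult)
        finally show ?thesis using assms(2) b by (simp add: ln_enat_def ln_mult ln_realpow)
      qed
      also have "\<dots> \<le> ereal (A + s * (- ln \<nu>))"
      proof -
        have "real t * ln b \<le> (\<tau> + 2) * ln b" using t b by (intro mult_right_mono) auto
        also have "\<dots> = (ln C / (- ln r) + 2) * ln b + s * (- ln \<nu>)"
          using lr by (simp add: \<tau>_def s_def field_simps)
        finally show ?thesis by (simp add: A_def)
      qed
      finally show ?case .
    qed
    then show "\<exists>A. eventually (\<lambda>\<nu>. ln_enat (Sep d X \<delta> \<nu>) \<le> ereal (A + s * (- ln \<nu>))) (at_right 0)"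
      by blast
  qed
  also have "\<dots> < \<infinity>" by simp
  finally show ?thesis .
qed

end

section \<open>Approximation in measure and in mean square\<close>

text \<open>The sets that can be approximated by members of the algebra form a sigma-algebra.\<close>

lemma (in finite_measure) approx_by_algebra:
  assumes alg: "algebra (space M) \<A>" "\<A> \<subseteq> sets M"
    and gen: "sets M = sigma_sets (space M) \<G>"
    and base: "\<And>B \<epsilon>. B \<in> \<G> \<Longrightarrow> \<epsilon> > 0 \<Longrightarrow> \<exists>A\<in>\<A>. measure M (A - B \<union> (B - A)) < \<epsilon>"
    and "B \<in> sets M" "\<epsilon> > 0"
  shows "\<exists>A\<in>\<A>. measure M (A - B \<union> (B - A)) < \<epsilon>"
proof -
  interpret algebra "space M" \<A> by (rule alg)
  have "B \<in> sigma_sets (space M) \<G>" using assms(5) gen by simp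
  then show ?thesis using \<open>\<epsilon> > 0\<close>
  proof (induction arbitrary: \<epsilon>)
    case (Basic B)
    then show ?case using base by blast
  next
    case Empty
    then show ?case by (intro bexI[of _ "{}"]) auto
  next
    case (Compl B)
    then obtain A where A: "A \<in> \<A>" "measure M (A - B \<union> (B - A)) < \<epsilon>" by blast
    have "A \<in> sets M" "B \<in> sets M" using A(1) alg(2) Compl(1) gen by auto
    then have "A \<subseteq> space M" "B \<subseteq> space M" by (auto dest: sets.sets_into_space)
    then have "(space M - A) - (space M - B) \<union> ((space M - B) - (space M - A)) = A - B \<union> (B - A)" by blast
    then show ?case using A by (intro bexI[of _ "space M - A"]) auto
  next
    case (Union B)
    have B: "B i \<in> sets M" for i using Union(1) gen by simp
    define U where "U = (\<Union>i. B i)"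
    define rest where "rest n = U - (\<Union>i<n. B i)" for n
    have rest: "rest n \<in> sets M" for n unfolding rest_def U_def using B by auto
    have "(\<lambda>n. measure M (rest n)) \<longlonglongrightarrow> measure M (\<Inter>n. rest n)"
      using rest by (intro finite_Lim_measure_decseq) (auto simp: decseq_def rest_def)
    moreover have "(\<Inter>n. rest n) = {}" unfolding rest_def U_def by auto
    ultimately have "(\<lambda>n. measure M (rest n)) \<longlonglongrightarrow> 0" by simp
    then have "eventually (\<lambda>n. measure M (rest n) < \<epsilon> / 2) sequentially"
      using Union.prems by (intro order_tendstoD) auto
    then obtain n where n: "measure M (rest n) < \<epsilon> / 2" by (auto simp: eventually_sequentially)
    define \<eta> where "\<eta> = \<epsilon> / (2 * (real n + 1))"
    have "\<eta> > 0" using Union.prems by (simp add: \<eta>_def)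
    then have "\<forall>i. \<exists>A. A \<in> \<A> \<and> measure M (A - B i \<union> (B i - A)) < \<eta>" using Union.IH by blast
    from choice[OF this] obtain A where A: "\<And>i. A i \<in> \<A>" "\<And>i. measure M (A i - B i \<union> (B i - A i)) < \<eta>"
      by blast
    have AM: "A i \<in> sets M" for i using A(1) alg(2) by blast
    let ?D = "\<lambda>i. A i - B i \<union> (B i - A i)"
    let ?A = "\<Union>i<n. A i"
    have "?A - U \<union> (U - ?A) \<subseteq> (\<Union>i<n. ?D i) \<union> rest n" unfolding rest_def U_def by blast
    then have "measure M (?A - U \<union> (U - ?A)) \<le> measure M ((\<Union>i<n. ?D i) \<union> rest n)"
      using AM B rest by (intro finite_measure_mono) auto
    also have "\<dots> \<le> measure M (\<Union>i<n. ?D i) + measure M (rest n)"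
      using AM B rest by (intro measure_Un_le) auto
    also have "measure M (\<Union>i<n. ?D i) \<le> (\<Sum>i<n. measure M (?D i))"
      using AM B by (intro measure_UNION_le) auto
    also have "\<dots> \<le> (\<Sum>i<n. \<eta>)" by (intro sum_mono less_imp_le A)
    also have "\<dots> \<le> \<epsilon> / 2" using Union.prems by (simp add: \<eta>_def field_simps)
    finally have "measure M (?A - U \<union> (U - ?A)) < \<epsilon>" using n by simp
    moreover have "?A \<in> \<A>" using A(1) by auto
    ultimately show ?case unfolding U_def by blast
  qed
qed

lemma cmod_add_square_le: "(cmod (a + b))\<^sup>2 \<le> 2 * (cmod a)\<^sup>2 + 2 * (cmod b)\<^sup>2"
proof -
  have "(cmod (a + b))\<^sup>2 \<le> (cmod a + cmod b)\<^sup>2"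
    by (intro power_mono norm_triangle_ineq) simp
  also have "\<dots> \<le> 2 * (cmod a)\<^sup>2 + 2 * (cmod b)\<^sup>2"
    using sum_squares_bound[of "cmod a" "cmod b"] by (simp add: power2_sum)
  finally show ?thesis .
qed

definition sqnorm :: "'b measure \<Rightarrow> ('b \<Rightarrow> complex) \<Rightarrow> real" where
  "sqnorm M f = (LINT x|M. (cmod (f x))\<^sup>2)"

lemma sqnorm_nonneg [simp]: "0 \<le> sqnorm M f"
  unfolding sqnorm_def by (intro integral_nonneg_AE) auto

lemma sqnorm_cong: "(\<And>x. x \<in> space M \<Longrightarrow> f x = g x) \<Longrightarrow> sqnorm M f = sqnorm M g"
  unfolding sqnorm_def by (intro Bochner_Integration.integral_cong) auto

lemma L2_measurable: "f \<in> L2 M \<Longrightarrow> f \<in> borel_measurable M"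
  and L2_integrable: "f \<in> L2 M \<Longrightarrow> integrable M (\<lambda>x. (cmod (f x))\<^sup>2)"
  by (simp_all add: L2_def)

lemma L2_dominated:
  assumes "f \<in> borel_measurable M" "integrable M g" "\<And>x. x \<in> space M \<Longrightarrow> (cmod (f x))\<^sup>2 \<le> g x"
  shows "f \<in> L2 M" "sqnorm M f \<le> (LINT x|M. g x)"
proof -
  have "integrable M (\<lambda>x. (cmod (f x))\<^sup>2)"
  proof (rule Bochner_Integration.integrable_bound[OF assms(2)])
    show "(\<lambda>x. (cmod (f x))\<^sup>2) \<in> borel_measurable M" using assms(1) by measurable
    show "AE x in M. norm ((cmod (f x))\<^sup>2) \<le> norm (g x)"
    proof (rule AE_I2)
      fix x assume "x \<in> space M"
      then have "(cmod (f x))\<^sup>2 \<le> g x" by (rule assms(3))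
      moreover have "0 \<le> (cmod (f x))\<^sup>2" by simp
      ultimately show "norm ((cmod (f x))\<^sup>2) \<le> norm (g x)" by simp
    qed
  qed
  then show "f \<in> L2 M" "sqnorm M f \<le> (LINT x|M. g x)"
    using assms unfolding L2_def sqnorm_def by (auto intro!: integral_mono)
qed

lemma
  assumes "f \<in> L2 M" "g \<in> L2 M"
  shows L2_add: "(\<lambda>x. f x + g x) \<in> L2 M"
    and sqnorm_add_le: "sqnorm M (\<lambda>x. f x + g x) \<le> 2 * sqnorm M f + 2 * sqnorm M g"
proof -
  have int: "integrable M (\<lambda>x. 2 * (cmod (f x))\<^sup>2 + 2 * (cmod (g x))\<^sup>2)"
    using assms by (intro Bochner_Integration.integrable_add integrable_mult_right L2_integrable)
  have meas: "(\<lambda>x. f x + g x) \<in> borel_measurable M"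
    using assms by (intro borel_measurable_add L2_measurable)
  note D = L2_dominated[OF meas int cmod_add_square_le]
  show "(\<lambda>x. f x + g x) \<in> L2 M" by (rule D)
  have "(LINT x|M. 2 * (cmod (f x))\<^sup>2 + 2 * (cmod (g x))\<^sup>2) = 2 * sqnorm M f + 2 * sqnorm M g"
    unfolding sqnorm_def using assms
    by (subst Bochner_Integration.integral_add) (auto intro!: integrable_mult_right L2_integrable)
  then show "sqnorm M (\<lambda>x. f x + g x) \<le> 2 * sqnorm M f + 2 * sqnorm M g" using D(2) by simp
qed

lemma
  assumes "f \<in> L2 M"
  shows L2_mult: "(\<lambda>x. c * f x) \<in> L2 M"
    and sqnorm_mult: "sqnorm M (\<lambda>x. c * f x) = (cmod c)\<^sup>2 * sqnorm M f"
  using assms unfolding L2_def sqnorm_def by (auto simp: norm_mult power_mult_distrib)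

lemma
  assumes "f \<in> L2 M" "g \<in> L2 M"
  shows L2_diff: "(\<lambda>x. f x - g x) \<in> L2 M"
    and sqnorm_diff_le: "sqnorm M (\<lambda>x. f x - g x) \<le> 2 * sqnorm M f + 2 * sqnorm M g"
  using L2_add[OF assms(1) L2_mult[OF assms(2), of "-1"]]
    sqnorm_add_le[OF assms(1) L2_mult[OF assms(2), of "-1"]] sqnorm_mult[OF assms(2), of "-1"]
  by auto

lemma (in finite_measure) L2_bounded:
  assumes "f \<in> borel_measurable M" "\<And>x. x \<in> space M \<Longrightarrow> cmod (f x) \<le> K"
  shows "f \<in> L2 M"
proof (rule L2_dominated(1)[OF assms(1)])
  show "integrable M (\<lambda>_. K\<^sup>2)" by simp
  show "(cmod (f x))\<^sup>2 \<le> K\<^sup>2" if "x \<in> space M" for x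
    using assms(2)[OF that] by (intro power_mono) auto
qed

lemma (in finite_measure) simple_function_L2_limit:
  assumes "h \<in> L2 M"
  obtains s where "\<And>i. simple_function M (s i)" "\<And>i. s i \<in> L2 M"
    "(\<lambda>i. sqnorm M (\<lambda>x. h x - s i x)) \<longlonglongrightarrow> 0"
proof -
  have h: "h \<in> borel_measurable M" using assms by (rule L2_measurable)
  obtain s where s: "\<And>i. simple_function M (s i)" "\<And>x. x \<in> space M \<Longrightarrow> (\<lambda>i. s i x) \<longlonglongrightarrow> h x"
    "\<And>i x. x \<in> space M \<Longrightarrow> dist (s i x) 0 \<le> 2 * dist (h x) 0"
    using borel_measurable_implies_sequence_metric[OF h, of 0] by blast
  have sm: "s i \<in> borel_measurable M" for i using s(1) by (rule borel_measurable_simple_function)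
  have "s i \<in> L2 M" for i
  proof (rule L2_dominated(1)[OF sm])
    show "integrable M (\<lambda>x. 4 * (cmod (h x))\<^sup>2)" using L2_integrable[OF assms] by simp
    show "(cmod (s i x))\<^sup>2 \<le> 4 * (cmod (h x))\<^sup>2" if "x \<in> space M" for x
    proof -
      have "(cmod (s i x))\<^sup>2 \<le> (2 * cmod (h x))\<^sup>2"
        using s(3)[OF that, of i] by (intro power_mono) auto
      then show ?thesis by (simp add: power_mult_distrib)
    qed
  qed
  moreover have "(\<lambda>i. LINT x|M. (cmod (h x - s i x))\<^sup>2) \<longlonglongrightarrow> (LINT x|M. 0)"
  proof (rule integral_dominated_convergence[where w = "\<lambda>x. 9 * (cmod (h x))\<^sup>2"])
    show "integrable M (\<lambda>x. 9 * (cmod (h x))\<^sup>2)" using L2_integrable[OF assms] by simp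
    show "(\<lambda>x. (cmod (h x - s i x))\<^sup>2) \<in> borel_measurable M" for i using h sm[of i] by measurable
    show "AE x in M. (\<lambda>i. (cmod (h x - s i x))\<^sup>2) \<longlonglongrightarrow> 0"
    proof (rule AE_I2)
      fix x assume "x \<in> space M"
      then have "(\<lambda>i. (cmod (h x - s i x))\<^sup>2) \<longlonglongrightarrow> (cmod (h x - h x))\<^sup>2"
        by (intro tendsto_intros s(2))
      then show "(\<lambda>i. (cmod (h x - s i x))\<^sup>2) \<longlonglongrightarrow> 0" by simp
    qed
    show "AE x in M. norm ((cmod (h x - s i x))\<^sup>2) \<le> 9 * (cmod (h x))\<^sup>2" for i
    proof (rule AE_I2)
      fix x assume x: "x \<in> space M"
      have "cmod (h x - s i x) \<le> cmod (h x) + cmod (s i x)" by (rule norm_triangle_ineq4)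
      also have "\<dots> \<le> 3 * cmod (h x)" using s(3)[OF x, of i] by simp
      finally have "(cmod (h x - s i x))\<^sup>2 \<le> (3 * cmod (h x))\<^sup>2" by (intro power_mono) auto
      then show "norm ((cmod (h x - s i x))\<^sup>2) \<le> 9 * (cmod (h x))\<^sup>2" by (simp add: power_mult_distrib)
    qed
  qed simp
  ultimately show ?thesis using s(1) by (intro that[of s]) (simp_all add: sqnorm_def)
qed

text \<open>Square-integrable functions are limits of simple functions, that is, of sums of multiples of
  indicators.\<close>

lemma (in finite_measure) L2_dense:
  assumes V: "V \<subseteq> L2 M" "\<And>f g. f \<in> V \<Longrightarrow> g \<in> V \<Longrightarrow> (\<lambda>x. f x + g x) \<in> V"
    and ind: "\<And>B c \<epsilon>. B \<in> sets M \<Longrightarrow> \<epsilon> > 0 \<Longrightarrow> \<exists>g\<in>V. sqnorm M (\<lambda>x. c * indicator B x - g x) < \<epsilon>"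
    and h: "h \<in> L2 M" "\<epsilon> > 0"
  shows "\<exists>g\<in>V. sqnorm M (\<lambda>x. h x - g x) < \<epsilon>"
proof -
  have sum: "\<exists>g\<in>V. sqnorm M (\<lambda>x. (\<Sum>c\<in>F. c * indicator (B c) x) - g x) < \<epsilon>"
    if "finite F" and BM: "\<And>c. B c \<in> sets M" and "\<epsilon> > 0" for F :: "complex set" and B and \<epsilon>
    using that(1,3)
  proof (induction F arbitrary: \<epsilon>)
    case empty
    then show ?case using ind[of "{}" \<epsilon> 0] by simp
  next
    case (insert c F)
    obtain g where g: "g \<in> V" "sqnorm M (\<lambda>x. (\<Sum>c\<in>F. c * indicator (B c) x) - g x) < \<epsilon> / 4"
      using insert.IH[of "\<epsilon> / 4"] insert.prems by auto
    obtain g' where g': "g' \<in> V" "sqnorm M (\<lambda>x. c * indicator (B c) x - g' x) < \<epsilon> / 4"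
      using ind[OF BM[of c], of "\<epsilon> / 4" c] insert.prems by auto
    have indL2: "(\<lambda>x. c * indicator (B c) x) \<in> L2 M" for c
      using BM by (intro L2_bounded[of _ "cmod c"]) (auto simp: indicator_def)
    have "(\<lambda>x. \<Sum>c\<in>F. c * indicator (B c) x) \<in> L2 M"
    proof (rule L2_bounded[of _ "\<Sum>c\<in>F. cmod c"])
      show "(\<lambda>x. \<Sum>c\<in>F. c * indicator (B c) x) \<in> borel_measurable M"
        using BM by (intro borel_measurable_sum borel_measurable_times borel_measurable_indicator) auto
      show "cmod (\<Sum>c\<in>F. c * indicator (B c) x) \<le> (\<Sum>c\<in>F. cmod c)" for x
        by (rule sum_norm_le) (simp add: indicator_def)
    qed
    then have "(\<lambda>x. (\<Sum>c\<in>F. c * indicator (B c) x) - g x) \<in> L2 M" "(\<lambda>x. c * indicator (B c) x - g' x) \<in> L2 M"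
      using g(1) g'(1) V(1) indL2 by (auto intro!: L2_diff)
    from sqnorm_add_le[OF this] have
      "sqnorm M (\<lambda>x. ((\<Sum>c\<in>F. c * indicator (B c) x) - g x) + (c * indicator (B c) x - g' x)) < \<epsilon>"
      using g(2) g'(2) by linarith
    moreover have "((\<Sum>c\<in>F. c * indicator (B c) x) - g x) + (c * indicator (B c) x - g' x) =
        (\<Sum>c\<in>insert c F. c * indicator (B c) x) - (g x + g' x)" for x
      unfolding sum.insert[OF insert.hyps] by algebra
    ultimately have "sqnorm M (\<lambda>x. (\<Sum>c\<in>insert c F. c * indicator (B c) x) - (g x + g' x)) < \<epsilon>"
      by (simp only:)
    then show ?case using V(2)[OF g(1) g'(1)] by (intro bexI[of _ "\<lambda>x. g x + g' x"])
  qed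
  obtain s where s: "\<And>i. simple_function M (s i)" "\<And>i. s i \<in> L2 M"
    "(\<lambda>i. sqnorm M (\<lambda>x. h x - s i x)) \<longlonglongrightarrow> 0"
    using simple_function_L2_limit[OF h(1)] by blast
  have "eventually (\<lambda>i. sqnorm M (\<lambda>x. h x - s i x) < \<epsilon> / 4) sequentially"
    using s(3) h(2) by (intro order_tendstoD) auto
  then obtain i where i: "sqnorm M (\<lambda>x. h x - s i x) < \<epsilon> / 4" by (auto simp: eventually_sequentially)
  define B where "B c = s i -` {c} \<inter> space M" for c
  have B: "B c \<in> sets M" for c unfolding B_def using s(1) by (rule simple_functionD(2))
  have F: "finite (s i ` space M)" using s(1) by (rule simple_functionD(1))
  have rep: "s i x = (\<Sum>c\<in>s i ` space M. c * indicator (B c) x)" if "x \<in> space M" for x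
  proof -
    have "(\<Sum>c\<in>s i ` space M. c * indicator (B c) x) = (\<Sum>c\<in>s i ` space M. if c = s i x then c else 0)"
      using that by (intro sum.cong) (auto simp: B_def indicator_def)
    then show ?thesis using F that by simp
  qed
  have "\<exists>g\<in>V. sqnorm M (\<lambda>x. (\<Sum>c\<in>s i ` space M. c * indicator (B c) x) - g x) < \<epsilon> / 4"
    by (rule sum[OF F B]) (use h(2) in simp)
  then obtain g where g: "g \<in> V"
    "sqnorm M (\<lambda>x. (\<Sum>c\<in>s i ` space M. c * indicator (B c) x) - g x) < \<epsilon> / 4" by blast
  have "sqnorm M (\<lambda>x. s i x - g x) = sqnorm M (\<lambda>x. (\<Sum>c\<in>s i ` space M. c * indicator (B c) x) - g x)"
    by (intro sqnorm_cong arg_cong2[where f = "(-)"] rep refl)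
  then have "sqnorm M (\<lambda>x. s i x - g x) < \<epsilon> / 4" using g(2) by simp
  moreover have "(\<lambda>x. h x - s i x) \<in> L2 M" "(\<lambda>x. s i x - g x) \<in> L2 M"
    using h(1) s(2) g(1) V(1) by (auto intro!: L2_diff)
  from sqnorm_add_le[OF this] have
    "sqnorm M (\<lambda>x. (h x - s i x) + (s i x - g x)) \<le>
       2 * sqnorm M (\<lambda>x. h x - s i x) + 2 * sqnorm M (\<lambda>x. s i x - g x)" .
  ultimately have "sqnorm M (\<lambda>x. h x - g x) < \<epsilon>" using i by simp
  then show ?thesis using g(1) by blast
qed

text \<open>Approximation of measurable sets by an algebra yields approximation of square-integrable functions.\<close>

lemma (in finite_measure) L2_dense_of_sets:
  assumes V: "V \<subseteq> L2 M" "\<And>f g. f \<in> V \<Longrightarrow> g \<in> V \<Longrightarrow> (\<lambda>x. f x + g x) \<in> V"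
    and \<A>: "\<A> \<subseteq> sets M" "\<And>A c. A \<in> \<A> \<Longrightarrow> (\<lambda>x. c * indicator A x) \<in> V"
      "\<And>B \<epsilon>. B \<in> sets M \<Longrightarrow> \<epsilon> > 0 \<Longrightarrow> \<exists>A\<in>\<A>. measure M (A - B \<union> (B - A)) < \<epsilon>"
    and h: "h \<in> L2 M" "\<epsilon> > 0"
  shows "\<exists>g\<in>V. sqnorm M (\<lambda>x. h x - g x) < \<epsilon>"
proof (rule L2_dense[OF V _ h])
  fix B c and \<epsilon> :: real assume B: "B \<in> sets M" "\<epsilon> > 0"
  define \<eta> where "\<eta> = \<epsilon> / ((cmod c)\<^sup>2 + 1)"
  have c: "(cmod c)\<^sup>2 + 1 > 0" by (simp add: add_nonneg_pos)
  then have "\<eta> > 0" using B(2) by (simp add: \<eta>_def)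
  then obtain A where A: "A \<in> \<A>" "measure M (A - B \<union> (B - A)) < \<eta>" using \<A>(3)[OF B(1)] by blast
  have AB: "A - B \<union> (B - A) \<in> sets M" using A(1) \<A>(1) B(1) by auto
  have "(cmod (c * indicator B x - c * indicator A x))\<^sup>2 = (cmod c)\<^sup>2 * indicator (A - B \<union> (B - A)) x" for x
    by (simp add: indicator_def)
  then have "sqnorm M (\<lambda>x. c * indicator B x - c * indicator A x) = (cmod c)\<^sup>2 * measure M (A - B \<union> (B - A))"
    unfolding sqnorm_def using AB by simp
  also have "\<dots> \<le> (cmod c)\<^sup>2 * \<eta>" using A(2) by (intro mult_left_mono) auto
  also have "\<dots> < \<epsilon>" using B(2) c by (simp add: \<eta>_def field_simps)
  finally show "\<exists>g\<in>V. sqnorm M (\<lambda>x. c * indicator B x - g x) < \<epsilon>"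
    using \<A>(2)[OF A(1), of c] by (intro bexI[of _ "\<lambda>x. c * indicator A x"])
qed

section \<open>Invariant measures of self-similar subshifts\<close>

text \<open>The locally constant functions on \<open>X\<close>: by compactness these depend on the coordinates in one window.\<close>

definition local_fun :: "(int \<Rightarrow> 'a) set \<Rightarrow> ((int \<Rightarrow> 'a) \<Rightarrow> 'c) \<Rightarrow> bool" where
  "local_fun X F \<longleftrightarrow> (\<exists>R. \<forall>y\<in>X. \<forall>z\<in>X. agree R y z \<longrightarrow> F y = F z)"

lemma local_fun_cases2:
  assumes "local_fun X F" "local_fun X G"
  obtains R where "\<And>y z. y \<in> X \<Longrightarrow> z \<in> X \<Longrightarrow> agree R y z \<Longrightarrow> F y = F z \<and> G y = G z"
proof -
  obtain R1 R2 where R: "\<And>y z. y \<in> X \<Longrightarrow> z \<in> X \<Longrightarrow> agree R1 y z \<Longrightarrow> F y = F z"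
    "\<And>y z. y \<in> X \<Longrightarrow> z \<in> X \<Longrightarrow> agree R2 y z \<Longrightarrow> G y = G z"
    using assms unfolding local_fun_def by metis
  show ?thesis
    by (rule that[of "max R1 R2"]) (metis R agree_mono max.cobounded1 max.cobounded2)
qed

lemma local_fun_comp2:
  assumes "local_fun X F" "local_fun X G" shows "local_fun X (\<lambda>y. h (F y) (G y))"
proof -
  obtain R where R: "\<And>y z. y \<in> X \<Longrightarrow> z \<in> X \<Longrightarrow> agree R y z \<Longrightarrow> F y = F z \<and> G y = G z"
    using local_fun_cases2[OF assms] by blast
  have "h (F y) (G y) = h (F z) (G z)" if "y \<in> X" "z \<in> X" "agree R y z" for y z
    using R[OF that] by simp
  then show ?thesis unfolding local_fun_def by blast
qed

lemma local_fun_const: "local_fun X (\<lambda>_. c)"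
  by (simp add: local_fun_def)

lemma local_fun_comp: "local_fun X F \<Longrightarrow> local_fun X (\<lambda>y. h (F y))"
  unfolding local_fun_def by metis

lemma local_fun_translate:
  assumes "local_fun X F" "\<And>y. y \<in> X \<Longrightarrow> translate t y \<in> X"
  shows "local_fun X (\<lambda>y. F (translate t y))"
proof -
  obtain R where R: "\<And>y z. y \<in> X \<Longrightarrow> z \<in> X \<Longrightarrow> agree R y z \<Longrightarrow> F y = F z"
    using assms(1) unfolding local_fun_def by blast
  have "F (translate t y) = F (translate t z)" if "y \<in> X" "z \<in> X" "agree (R + nat \<bar>t\<bar>) y z" for y z
    using that assms(2) by (intro R agree_translate[OF that(3)]) auto
  then show ?thesis unfolding local_fun_def by blast
qed

lemma local_fun_sum:
  fixes F :: "'i \<Rightarrow> (int \<Rightarrow> 'a) \<Rightarrow> 'c::comm_monoid_add"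
  assumes "finite I" "\<And>i. i \<in> I \<Longrightarrow> local_fun X (F i)"
  shows "local_fun X (\<lambda>y. \<Sum>i\<in>I. F i y)"
  using assms
proof (induction I)
  case (insert i I)
  then have "local_fun X (\<lambda>y. F i y + (\<Sum>i\<in>I. F i y))"
    by (intro local_fun_comp2[where h = "(+)"]) auto
  then show ?case using insert.hyps by simp
qed (simp add: local_fun_const)

lemma local_set_iff_local_fun: "local_set X B \<longleftrightarrow> local_fun X (\<lambda>y. y \<in> B)"
  by (simp add: local_set_def local_fun_def)

lemma agree_iff_map: "agree R y z \<longleftrightarrow> map y [- int R..int R] = map z [- int R..int R]"
proof -
  have "\<bar>i\<bar> \<le> int R \<longleftrightarrow> i \<in> set [- int R..int R]" for i by auto
  then show ?thesis unfolding agree_def map_eq_conv by blast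
qed

lemma local_fun_factor:
  assumes "local_fun X F"
  obtains R G where "\<And>y. y \<in> X \<Longrightarrow> F y = G (map y [- int R..int R])"
proof -
  obtain R where R: "\<And>y z. y \<in> X \<Longrightarrow> z \<in> X \<Longrightarrow> agree R y z \<Longrightarrow> F y = F z"
    using assms unfolding local_fun_def by blast
  define G where "G w = F (SOME y. y \<in> X \<and> map y [- int R..int R] = w)" for w
  have "F y = G (map y [- int R..int R])" if y: "y \<in> X" for y
  proof -
    define z where "z = (SOME z. z \<in> X \<and> map z [- int R..int R] = map y [- int R..int R])"
    have z: "z \<in> X \<and> map z [- int R..int R] = map y [- int R..int R]"
      unfolding z_def by (rule someI[of _ y]) (simp add: y)
    then have "agree R y z" by (simp only: agree_iff_map)
    then show ?thesis unfolding G_def z_def[symmetric] using R[OF y] z by blast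
  qed
  then show ?thesis by (rule that)
qed

lemma finite_words: "finite {w :: 'a::finite list. length w = n}"
  using finite_lists_length_eq[of "UNIV :: 'a set" n] by simp

lemma local_fun_finite_range:
  fixes F :: "(int \<Rightarrow> 'a::finite) \<Rightarrow> 'c"
  assumes "local_fun X F" shows "finite (F ` X)"
proof -
  obtain R G where "\<And>y. y \<in> X \<Longrightarrow> F y = G (map y [- int R..int R])"
    using local_fun_factor[OF assms] by blast
  then have "F ` X \<subseteq> G ` {w. length w = nat (2 * int R + 1)}" by auto
  then show ?thesis using finite_words finite_subset by blast
qed

locale self_similar_measure = self_similar +
  fixes \<mu> :: "(int \<Rightarrow> 'a) measure"
  assumes invariant: "invariant_prob X \<mu>"
begin

sublocale prob_space \<mu>
  using invariant by (simp add: invariant_prob_def)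

lemma sets_opens: "sets \<mu> = sigma_sets X {U. openin (subtopology shift_topology X) U}"
proof -
  have "{U. openin (subtopology shift_topology X) U} \<subseteq> Pow X"
    using openin_subset by fastforce
  then show ?thesis using invariant by (simp add: invariant_prob_def sets_measure_of)
qed

lemma space_eq: "space \<mu> = X"
proof -
  have "sets \<mu> = sets (sigma X {U. openin (subtopology shift_topology X) U})"
    using invariant by (simp add: invariant_prob_def)
  then have "space \<mu> = space (sigma X {U. openin (subtopology shift_topology X) U})"
    by (rule sets_eq_imp_space_eq)
  also have "\<dots> = X"
    using openin_subset by (intro space_measure_of) fastforce
  finally show ?thesis .
qed

lemma translate_X: "y \<in> X \<Longrightarrow> translate t y \<in> X"
  by (rule translate_in_orbit_closure)

lemma local_in_sets:
  assumes "local_set X B" shows "B \<inter> X \<in> sets \<mu>"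
proof -
  obtain R where R: "\<And>y z. y \<in> X \<Longrightarrow> z \<in> X \<Longrightarrow> agree R y z \<Longrightarrow> y \<in> B \<longleftrightarrow> z \<in> B"
    using assms unfolding local_set_def by blast
  have "openin shift_topology {z. \<exists>y\<in>B \<inter> X. agree R y z}"
    unfolding openin_shift_topology using agree_trans by blast
  moreover have "B \<inter> X = {z. \<exists>y\<in>B \<inter> X. agree R y z} \<inter> X"
    using R agree_refl by blast
  ultimately have "openin (subtopology shift_topology X) (B \<inter> X)"
    unfolding openin_subtopology by blast
  then show ?thesis unfolding sets_opens by (intro sigma_sets.Basic) simp
qed

lemma local_set_cylinder: "local_set X {y. y i = a}"
  unfolding local_set_def by (rule exI[of _ "nat \<bar>i\<bar>"]) (auto simp: agree_def)

text \<open>There are only countably many cylinders, so open sets are countable unions of cylinders.\<close>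

lemma sets_cylinders: "sets \<mu> = sigma_sets X {{y \<in> X. y i = a} |i a. True}"
proof -
  let ?G = "{{y \<in> X. y i = a} |i a. True}"
  interpret S: sigma_algebra X "sigma_sets X ?G" by (rule sigma_algebra_sigma_sets) auto
  have cyl: "{y \<in> X. map y [- int R..int R] = w} \<in> sigma_sets X ?G" for R and w :: "'a list"
  proof (cases "\<exists>z\<in>X. map z [- int R..int R] = w")
    case True
    then obtain z where z: "map z [- int R..int R] = w" by blast
    have "{y \<in> X. map y [- int R..int R] = w} = (\<Inter>i\<in>{- int R..int R}. {y \<in> X. y i = z i})"
    proof -
      have "map y [- int R..int R] = w \<longleftrightarrow> (\<forall>i\<in>{- int R..int R}. y i = z i)" for y
        unfolding z[symmetric] map_eq_conv by simp
      then show ?thesis by auto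
    qed
    also have "\<dots> \<in> sigma_sets X ?G"
    proof (rule S.finite_INT)
      show "{y \<in> X. y i = z i} \<in> sigma_sets X ?G" for i by (rule sigma_sets.Basic) blast
    qed auto
    finally show ?thesis .
  next
    case False
    then have "{y \<in> X. map y [- int R..int R] = w} = {}" by blast
    then show ?thesis by (simp only: sigma_sets.Empty)
  qed
  have "U \<in> sigma_sets X ?G" if "openin (subtopology shift_topology X) U" for U
  proof -
    obtain V where V: "openin shift_topology V" "U = V \<inter> X" using \<open>openin _ U\<close> unfolding openin_subtopology by blast
    define W where "W = (\<lambda>(R::nat, w). {y \<in> X. map y [- int R..int R] = w})"
    define I where "I = {(R, w). length w = nat (2 * int R + 1) \<and> W (R, w) \<subseteq> U}"
    have "I \<subseteq> (\<Union>R. {R} \<times> {w. length w = nat (2 * int R + 1)})" by (auto simp: I_def)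
    moreover have "countable (\<Union>R. {R} \<times> {w :: 'a list. length w = nat (2 * int R + 1)})"
      by (rule countable_UN) (auto intro!: countable_finite finite_cartesian_product finite_words)
    ultimately have "countable I" by (rule countable_subset)
    moreover have "U = (\<Union>p\<in>I. W p)"
    proof (intro equalityI subsetI)
      fix y assume y: "y \<in> U"
      then obtain R where R: "\<And>z. agree R y z \<Longrightarrow> z \<in> V" using V unfolding openin_shift_topology by blast
      have "z \<in> U" if "z \<in> W (R, map y [- int R..int R])" for z
      proof -
        have "agree R y z" using that by (simp only: W_def agree_iff_map) simp
        then show ?thesis using R V(2) that by (auto simp: W_def)
      qed
      then have "(R, map y [- int R..int R]) \<in> I" by (auto simp: I_def)
      moreover have "y \<in> W (R, map y [- int R..int R])" using y V(2) by (simp add: W_def)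
      ultimately show "y \<in> (\<Union>p\<in>I. W p)" by blast
    qed (auto simp: I_def)
    moreover have "W p \<in> sigma_sets X ?G" for p using cyl by (cases p) (simp add: W_def)
    ultimately show ?thesis using S.countable_UN''[of I W] by presburger
  qed
  then have "sets \<mu> \<subseteq> sigma_sets X ?G"
    unfolding sets_opens by (intro S.sigma_sets_subset) blast
  moreover have "?G \<subseteq> sets \<mu>"
  proof
    fix B assume "B \<in> ?G"
    then obtain i a where "B = {y \<in> X. y i = a}" by blast
    then have "B = {y. y i = a} \<inter> X" by blast
    then show "B \<in> sets \<mu>" using local_in_sets[OF local_set_cylinder] by simp
  qed
  then have "sigma_sets X ?G \<subseteq> sets \<mu>" using sets.sigma_sets_subset[of ?G \<mu>] by (simp add: space_eq)
  ultimately show ?thesis by blast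
qed

lemma measurable_translate: "translate t \<in> measurable \<mu> \<mu>"
proof (rule measurable_sigma_sets[OF sets_cylinders])
  show "{{y \<in> X. y i = a} |i a. True} \<subseteq> Pow X" by auto
  show "translate t \<in> space \<mu> \<rightarrow> X" using translate_X by (auto simp: space_eq)
  fix B assume "B \<in> {{y \<in> X. y i = a} |i a. True}"
  then obtain i a where "B = {y \<in> X. y i = a}" by blast
  then have "translate t -` B \<inter> space \<mu> = {y. y (i + t) = a} \<inter> X"
    using translate_X by (auto simp: space_eq translate_nth)
  then show "translate t -` B \<inter> space \<mu> \<in> sets \<mu>" using local_in_sets[OF local_set_cylinder] by simp
qed

lemma distr_translate: "distr \<mu> \<mu> (translate (int s)) = \<mu>"
proof (induction s)
  case 0
  have "distr \<mu> \<mu> (translate (int 0)) = distr \<mu> \<mu> (\<lambda>y. y)" by (rule distr_cong) auto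
  then show ?case by (simp add: distr_id)
next
  case (Suc s)
  have one: "distr \<mu> \<mu> (translate 1) = \<mu>"
  proof (rule measure_eqI)
    fix B assume B: "B \<in> sets (distr \<mu> \<mu> (translate 1))"
    then have "emeasure (distr \<mu> \<mu> (translate 1)) B = emeasure \<mu> (shift -` B \<inter> X)"
      using measurable_translate by (subst emeasure_distr) (auto simp: space_eq shift_eq_translate)
    then show "emeasure (distr \<mu> \<mu> (translate 1)) B = emeasure \<mu> B"
      using invariant B by (simp add: invariant_prob_def)
  qed simp
  have "distr \<mu> \<mu> (translate (int (Suc s))) = distr (distr \<mu> \<mu> (translate (int s))) \<mu> (translate 1)"
    using measurable_translate
    by (subst distr_distr) (auto simp: comp_def translate_translate intro!: distr_cong)
  then show ?case using Suc one by simp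
qed

lemma integral_translate:
  fixes f :: "(int \<Rightarrow> 'a) \<Rightarrow> 'c::{banach, second_countable_topology}"
  assumes "f \<in> borel_measurable \<mu>"
  shows "(LINT y|\<mu>. f (translate (int s) y)) = (LINT y|\<mu>. f y)"
  using integral_distr[OF measurable_translate assms, of "int s"] by (simp add: distr_translate)

lemma AE_translate:
  assumes "AE y in \<mu>. P y" shows "AE y in \<mu>. P (translate (int s) y)"
proof (rule AE_distrD[OF measurable_translate])
  show "AE y in distr \<mu> \<mu> (translate (int s)). P y" unfolding distr_translate by (rule assms)
qed

lemma borel_measurable_translate:
  "f \<in> borel_measurable \<mu> \<Longrightarrow> (\<lambda>y. f (translate t y)) \<in> borel_measurable \<mu>"
  using measurable_compose[OF measurable_translate] .

lemma L2_translate: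
  assumes "f \<in> L2 \<mu>"
  shows "(\<lambda>y. f (translate (int s) y)) \<in> L2 \<mu>" "sqnorm \<mu> (\<lambda>y. f (translate (int s) y)) = sqnorm \<mu> f"
proof -
  have f: "f \<in> borel_measurable \<mu>" and int: "integrable \<mu> (\<lambda>y. (cmod (f y))\<^sup>2)"
    using assms by (auto simp: L2_def)
  have "integrable (distr \<mu> \<mu> (translate (int s))) (\<lambda>y. (cmod (f y))\<^sup>2)" using int by (simp add: distr_translate)
  then have "integrable \<mu> (\<lambda>y. (cmod (f (translate (int s) y)))\<^sup>2)"
    by (rule integrable_distr[OF measurable_translate])
  then show "(\<lambda>y. f (translate (int s) y)) \<in> L2 \<mu>"
    using borel_measurable_translate[OF f] by (simp add: L2_def)
  have "(\<lambda>y. (cmod (f y))\<^sup>2) \<in> borel_measurable \<mu>" using f by measurable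
  from integral_translate[OF this] show "sqnorm \<mu> (\<lambda>y. f (translate (int s) y)) = sqnorm \<mu> f"
    by (simp add: sqnorm_def)
qed

lemma local_fun_measurable:
  assumes "local_fun X F" shows "F \<in> measurable \<mu> (count_space UNIV)"
proof (rule measurableI)
  fix B
  have "local_fun X (\<lambda>y. F y \<in> B)" using assms by (rule local_fun_comp)
  then have "local_set X {y. F y \<in> B}" by (simp add: local_set_iff_local_fun)
  moreover have "F -` B \<inter> space \<mu> = {y. F y \<in> B} \<inter> X" by (auto simp: space_eq)
  ultimately show "F -` B \<inter> space \<mu> \<in> sets \<mu>" using local_in_sets by simp
qed simp

lemma local_fun_borel:
  fixes F :: "(int \<Rightarrow> 'a) \<Rightarrow> 'c::topological_space"
  assumes "local_fun X F" shows "F \<in> borel_measurable \<mu>"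
proof -
  have "(\<lambda>z :: 'c. z) \<in> measurable (count_space UNIV) borel" by simp
  from measurable_compose[OF local_fun_measurable[OF assms] this] show ?thesis .
qed

lemma local_fun_L2:
  assumes "local_fun X F" shows "F \<in> L2 \<mu>"
proof (rule L2_bounded)
  show "F \<in> borel_measurable \<mu>" using assms by (rule local_fun_borel)
  have fin: "finite (F ` X)" using assms by (rule local_fun_finite_range)
  show "cmod (F y) \<le> Max (cmod ` F ` X)" if "y \<in> space \<mu>" for y
    using fin that by (intro Max_ge) (auto simp: space_eq)
qed

lemma algebra_local: "algebra X {B. B \<subseteq> X \<and> local_set X B}"
proof -
  have "local_set X (X - B)" if "local_set X B" for B
    using that unfolding local_set_def by blast
  moreover have "local_set X (B \<union> C)" if "local_set X B" "local_set X C" for B C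
    using that unfolding local_set_iff_local_fun Un_iff by (rule local_fun_comp2)
  moreover have "local_set X {}" by (simp add: local_set_def)
  ultimately show ?thesis unfolding algebra_iff_Un by blast
qed

lemma approx_local_fun:
  assumes "h \<in> L2 \<mu>" "\<epsilon> > 0"
  obtains F where "local_fun X F" "sqnorm \<mu> (\<lambda>y. h y - F y) < \<epsilon>"
proof -
  have "\<exists>F\<in>{F. local_fun X F}. sqnorm \<mu> (\<lambda>y. h y - F y) < \<epsilon>"
  proof (rule L2_dense_of_sets[OF _ _ _ _ _ assms])
    show "{F. local_fun X F} \<subseteq> L2 \<mu>" using local_fun_L2 by blast
    show "(\<lambda>y. f y + g y) \<in> {F. local_fun X F}" if "f \<in> {F. local_fun X F}" "g \<in> {F. local_fun X F}" for f g
      using that local_fun_comp2[of X f g "(+)"] by simp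
    show sub: "{B. B \<subseteq> X \<and> local_set X B} \<subseteq> sets \<mu>"
    proof
      fix B assume "B \<in> {B. B \<subseteq> X \<and> local_set X B}"
      then show "B \<in> sets \<mu>" using local_in_sets[of B] by (simp add: Int_absorb2)
    qed
    show "(\<lambda>y. c * indicator A y) \<in> {F. local_fun X F}" if "A \<in> {B. B \<subseteq> X \<and> local_set X B}" for A c
      using that local_fun_comp[of X "\<lambda>y. y \<in> A" "\<lambda>b. c * of_bool b"]
      by (simp add: local_set_iff_local_fun indicator_def)
    show "\<exists>A\<in>{B. B \<subseteq> X \<and> local_set X B}. measure \<mu> (A - B \<union> (B - A)) < \<eta>"
      if B: "B \<in> sets \<mu>" "\<eta> > 0" for B \<eta>
    proof (rule approx_by_algebra[OF _ sub _ _ B])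
      show "algebra (space \<mu>) {B. B \<subseteq> X \<and> local_set X B}" using algebra_local by (simp add: space_eq)
      show "sets \<mu> = sigma_sets (space \<mu>) {{y \<in> X. y i = a} |i a. True}"
        using sets_cylinders by (simp add: space_eq)
      fix B and \<epsilon> :: real assume "B \<in> {{y \<in> X. y i = a} |i a. True}" "\<epsilon> > 0"
      then obtain i a where Bia: "B = {y \<in> X. y i = a}" by blast
      have "local_set X B"
        using local_set_cylinder[of i a] unfolding Bia local_set_def by blast
      then show "\<exists>A\<in>{B. B \<subseteq> X \<and> local_set X B}. measure \<mu> (A - B \<union> (B - A)) < \<epsilon>"
        using \<open>\<epsilon> > 0\<close> Bia by (intro bexI[of _ B]) auto
    qed
  qed
  then show ?thesis using that by blast
qed

text \<open>A set that every point visits with frequency at least \<open>c\<close> carries at least the fraction \<open>c\<close> of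
  every invariant density: average the visits over a window and use invariance.\<close>

lemma often_integral:
  fixes f :: "(int \<Rightarrow> 'a) \<Rightarrow> real"
  assumes "often X c W" "W \<in> sets \<mu>" "integrable \<mu> f" "\<And>y. 0 \<le> f y"
    and inv: "\<And>s. AE y in \<mu>. f (translate (int s) y) = f y"
  shows "c * (LINT y|\<mu>. f y) \<le> (LINT y|\<mu>. f y * indicator W y)"
proof -
  obtain M where M: "M > 0" "\<And>y. y \<in> X \<Longrightarrow> c * real M \<le> real (card {s. s < M \<and> translate (int s) y \<in> W})"
    using assms(1) unfolding often_def by blast
  have fm: "f \<in> borel_measurable \<mu>" using assms(3) by simp
  have intW: "integrable \<mu> (\<lambda>y. f y * indicator W (translate (int s) y))" for s
  proof (rule Bochner_Integration.integrable_bound[OF assms(3)])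
    have "(\<lambda>y. indicator W (translate (int s) y) :: real) \<in> borel_measurable \<mu>"
      using assms(2) by (intro borel_measurable_translate) simp
    then show "(\<lambda>y. f y * indicator W (translate (int s) y)) \<in> borel_measurable \<mu>" using fm by simp
  qed (auto simp: indicator_def)
  have eq: "(LINT y|\<mu>. f y * indicator W (translate (int s) y)) = (LINT y|\<mu>. f y * indicator W y)" for s
  proof -
    have fW: "(\<lambda>y. f y * indicator W y) \<in> borel_measurable \<mu>" using fm assms(2) by simp
    have "(LINT y|\<mu>. f y * indicator W (translate (int s) y)) =
        (LINT y|\<mu>. f (translate (int s) y) * indicator W (translate (int s) y))"
    proof (rule integral_cong_AE)
      show "(\<lambda>y. f y * indicator W (translate (int s) y)) \<in> borel_measurable \<mu>" using intW by simp
      show "(\<lambda>y. f (translate (int s) y) * indicator W (translate (int s) y)) \<in> borel_measurable \<mu>"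
        using borel_measurable_translate[OF fW] .
      show "AE y in \<mu>. f y * indicator W (translate (int s) y) =
          f (translate (int s) y) * indicator W (translate (int s) y)"
        using inv[of s] by eventually_elim simp
    qed
    also have "\<dots> = (LINT y|\<mu>. f y * indicator W y)" by (rule integral_translate[OF fW])
    finally show ?thesis .
  qed
  have "c * real M * (LINT y|\<mu>. f y) = (LINT y|\<mu>. c * real M * f y)" by simp
  also have "\<dots> \<le> (LINT y|\<mu>. (\<Sum>s<M. f y * indicator W (translate (int s) y)))"
  proof (rule integral_mono)
    show "integrable \<mu> (\<lambda>y. c * real M * f y)" using assms(3) by simp
    show "integrable \<mu> (\<lambda>y. \<Sum>s<M. f y * indicator W (translate (int s) y))"
      by (intro Bochner_Integration.integrable_sum intW)
    fix y assume "y \<in> space \<mu>"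
    then have "c * real M \<le> real (card {s. s < M \<and> translate (int s) y \<in> W})"
      by (intro M) (simp add: space_eq)
    also have "\<dots> = (\<Sum>s<M. indicator W (translate (int s) y))"
    proof -
      have "{s. s < M \<and> translate (int s) y \<in> W} = {..<M} \<inter> {s. translate (int s) y \<in> W}" by auto
      then show ?thesis by (simp add: indicator_def sum.If_cases)
    qed
    finally have "f y * (c * real M) \<le> f y * (\<Sum>s<M. indicator W (translate (int s) y))"
      using assms(4) by (intro mult_left_mono)
    then show "c * real M * f y \<le> (\<Sum>s<M. f y * indicator W (translate (int s) y))"
      unfolding sum_distrib_left by (simp only: mult.commute)
  qed
  also have "\<dots> = (\<Sum>s<M. (LINT y|\<mu>. f y * indicator W (translate (int s) y)))"
    using intW by (intro Bochner_Integration.integral_sum)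
  also have "\<dots> = real M * (LINT y|\<mu>. f y * indicator W y)" using eq by simp
  finally show ?thesis using M(1) by simp
qed

lemma often_measure:
  assumes "often X c W" "W \<in> sets \<mu>" shows "c \<le> measure \<mu> W"
  using often_integral[OF assms, of "\<lambda>_. 1"] assms(2) by (simp add: prob_space)

text \<open>Replacing a square-integrable function by one that depends on finitely many coordinates turns the
  combinatorial return of blocks into a return of the values of the function.\<close>

lemma often_L2_return:
  assumes "x i = x (i + k)" "k > 0"
  obtains c where "c > 0" "\<And>h \<epsilon>. h \<in> L2 \<mu> \<Longrightarrow> \<epsilon> > 0 \<Longrightarrow> \<exists>n0. \<forall>n\<ge>n0. \<exists>W\<in>sets \<mu>. often X c W \<and>
      sqnorm \<mu> (\<lambda>y. indicator W y * (h (translate (k * l ^ n) y) - h y)) < \<epsilon>"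
proof -
  obtain c where c: "c > 0" "\<And>R. \<exists>n0. \<forall>n\<ge>n0. often X c {y. agree R y (translate (k * l ^ n) y)}"
    using often_return[OF assms] by blast
  show ?thesis
  proof (rule that[OF c(1)])
    fix h and \<epsilon> :: real assume h: "h \<in> L2 \<mu>" "\<epsilon> > 0"
    obtain F where F: "local_fun X F" "sqnorm \<mu> (\<lambda>y. h y - F y) < \<epsilon> / 4"
      using approx_local_fun[OF h(1), of "\<epsilon> / 4"] h(2) by auto
    obtain R where R: "\<And>y z. y \<in> X \<Longrightarrow> z \<in> X \<Longrightarrow> agree R y z \<Longrightarrow> F y = F z"
      using F(1) unfolding local_fun_def by blast
    obtain n0 where n0: "\<And>n. n \<ge> n0 \<Longrightarrow> often X c {y. agree R y (translate (k * l ^ n) y)}" using c(2) by blast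
    have "\<exists>W\<in>sets \<mu>. often X c W \<and> sqnorm \<mu> (\<lambda>y. indicator W y * (h (translate (k * l ^ n) y) - h y)) < \<epsilon>"
      if n: "n \<ge> n0" for n
    proof -
      define m where "m = nat (k * l ^ n)"
      have "0 < k * l ^ n" using assms(2) l_pow_pos by (intro mult_pos_pos)
      then have m: "int m = k * l ^ n" unfolding m_def by linarith
      define W where "W = {y. agree R y (translate (int m) y)} \<inter> X"
      have W: "W \<in> sets \<mu>" unfolding W_def by (rule local_in_sets[OF local_set_return])
      have "often X c W" using n0[OF n] translate_X unfolding often_def W_def m by simp
      define g where "g = (\<lambda>y. h y - F y)"
      have g: "g \<in> L2 \<mu>" unfolding g_def using h(1) local_fun_L2[OF F(1)] by (rule L2_diff)
      have gm: "(\<lambda>y. g (translate (int m) y)) \<in> L2 \<mu>" "sqnorm \<mu> (\<lambda>y. g (translate (int m) y)) = sqnorm \<mu> g"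
        using L2_translate[OF g] by auto
      have eq: "indicator W y * (h (translate (int m) y) - h y) = indicator W y * (g (translate (int m) y) - g y)"
        if "y \<in> X" for y
      proof (cases "y \<in> W")
        case True
        then have "F y = F (translate (int m) y)" using that translate_X by (intro R) (auto simp: W_def)
        then show ?thesis by (simp add: g_def)
      qed simp
      have "sqnorm \<mu> (\<lambda>y. indicator W y * (h (translate (int m) y) - h y)) \<le> (LINT y|\<mu>. (cmod (g (translate (int m) y) - g y))\<^sup>2)"
      proof (rule L2_dominated(2))
        have "h \<in> borel_measurable \<mu>" using h(1) by (rule L2_measurable)
        then show "(\<lambda>y. indicator W y * (h (translate (int m) y) - h y)) \<in> borel_measurable \<mu>"
          using W borel_measurable_translate by (intro borel_measurable_times borel_measurable_diff borel_measurable_indicator)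
        show "integrable \<mu> (\<lambda>y. (cmod (g (translate (int m) y) - g y))\<^sup>2)"
          using L2_diff[OF gm(1) g] by (rule L2_integrable)
        fix y assume "y \<in> space \<mu>"
        then have "y \<in> X" by (simp add: space_eq)
        show "(cmod (indicator W y * (h (translate (int m) y) - h y)))\<^sup>2 \<le> (cmod (g (translate (int m) y) - g y))\<^sup>2"
          unfolding eq[OF \<open>y \<in> X\<close>] by (simp add: indicator_def)
      qed
      also have "\<dots> = sqnorm \<mu> (\<lambda>y. g (translate (int m) y) - g y)" by (simp add: sqnorm_def)
      also have "\<dots> \<le> 2 * sqnorm \<mu> g + 2 * sqnorm \<mu> g" using sqnorm_diff_le[OF gm(1) g] gm(2) by simp
      also have "\<dots> < \<epsilon>" using F(2) by (simp add: g_def)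
      finally show ?thesis using W \<open>often X c W\<close> unfolding m by blast
    qed
    then show "\<exists>n0. \<forall>n\<ge>n0. \<exists>W\<in>sets \<mu>. often X c W \<and>
        sqnorm \<mu> (\<lambda>y. indicator W y * (h (translate (k * l ^ n) y) - h y)) < \<epsilon>" by blast
  qed
qed

end

section \<open>Without coincidences: continuous spectrum and infinite separation\<close>

context self_similar_measure
begin

lemma eigenfunction_translate:
  fixes \<phi> :: "(int \<Rightarrow> 'a) \<Rightarrow> complex"
  assumes "AE y in \<mu>. \<phi> (shift y) = \<omega> * \<phi> y"
  shows "AE y in \<mu>. \<phi> (translate (int s) y) = \<omega> ^ s * \<phi> y"
proof (induction s)
  case (Suc s)
  have "AE y in \<mu>. \<phi> (shift (translate (int s) y)) = \<omega> * \<phi> (translate (int s) y)"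
    using AE_translate[OF assms] .
  then show ?case using Suc
  proof eventually_elim
    case (elim y)
    have "translate (int (Suc s)) y = shift (translate (int s) y)"
      by (simp add: shift_eq_translate)
    then show ?case using elim by simp
  qed
qed simp

lemma sqnorm_cong_AE:
  assumes "f \<in> borel_measurable \<mu>" "g \<in> borel_measurable \<mu>" "AE y in \<mu>. f y = g y"
  shows "sqnorm \<mu> f = sqnorm \<mu> g"
  unfolding sqnorm_def
proof (rule integral_cong_AE)
  show "(\<lambda>y. (cmod (f y))\<^sup>2) \<in> borel_measurable \<mu>" using assms(1) by measurable
  show "(\<lambda>y. (cmod (g y))\<^sup>2) \<in> borel_measurable \<mu>" using assms(2) by measurable
  show "AE y in \<mu>. (cmod (f y))\<^sup>2 = (cmod (g y))\<^sup>2" using assms(3) by eventually_elim simp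
qed

lemma eigenvalue_norm:
  assumes "\<phi> \<in> L2 \<mu>" "sqnorm \<mu> \<phi> = 1" "AE y in \<mu>. \<phi> (shift y) = \<omega> * \<phi> y"
  shows "cmod \<omega> = 1"
proof -
  have m: "\<phi> \<in> borel_measurable \<mu>" using assms(1) by (rule L2_measurable)
  have "sqnorm \<mu> (\<lambda>y. \<phi> (translate (int 1) y)) = sqnorm \<mu> (\<lambda>y. \<omega> * \<phi> y)"
  proof (rule sqnorm_cong_AE)
    show "(\<lambda>y. \<phi> (translate (int 1) y)) \<in> borel_measurable \<mu>" using m by (rule borel_measurable_translate)
    show "(\<lambda>y. \<omega> * \<phi> y) \<in> borel_measurable \<mu>" using m by simp
    show "AE y in \<mu>. \<phi> (translate (int 1) y) = \<omega> * \<phi> y" using assms(3) by (simp add: shift_eq_translate)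
  qed
  then have "1 = (cmod \<omega>)\<^sup>2" using L2_translate(2)[OF assms(1), of 1] sqnorm_mult[OF assms(1), of \<omega>] assms(2) by simp
  then show ?thesis by (metis norm_ge_zero one_power2 power2_eq_iff_nonneg zero_le_one)
qed

text \<open>Functions that return along the times \<open>k l ^ n\<close> in mean square form a closed subspace.\<close>

definition returning :: "int \<Rightarrow> ((int \<Rightarrow> 'a) \<Rightarrow> complex) \<Rightarrow> bool" where
  "returning k h \<longleftrightarrow> h \<in> L2 \<mu> \<and>
     (\<forall>\<epsilon>>0. \<exists>n0. \<forall>n\<ge>n0. sqnorm \<mu> (\<lambda>y. h (translate (k * l ^ n) y) - h y) < \<epsilon>)"

lemma nonneg_times: "k > 0 \<Longrightarrow> int (nat (k * l ^ n)) = k * l ^ n"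
  using mult_pos_pos[of k "l ^ n"] l_pow_pos by (metis int_nat_eq less_imp_le)

lemma L2_translate_difference:
  assumes "h \<in> L2 \<mu>" "k > 0"
  shows "(\<lambda>y. h (translate (k * l ^ n) y) - h y) \<in> L2 \<mu>"
  using L2_diff[OF L2_translate(1)[OF assms(1), of "nat (k * l ^ n)"] assms(1)]
  unfolding nonneg_times[OF assms(2)] .

lemma returning_add:
  assumes "returning k f" "returning k g" "k > 0" shows "returning k (\<lambda>y. f y + g y)"
  unfolding returning_def
proof (intro conjI allI impI)
  have fg: "f \<in> L2 \<mu>" "g \<in> L2 \<mu>" using assms by (auto simp: returning_def)
  then show "(\<lambda>y. f y + g y) \<in> L2 \<mu>" by (rule L2_add)
  fix \<epsilon> :: real assume "\<epsilon> > 0"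
  then have "\<epsilon> / 4 > 0" by simp
  obtain n1 where n1: "\<And>n. n \<ge> n1 \<Longrightarrow> sqnorm \<mu> (\<lambda>y. f (translate (k * l ^ n) y) - f y) < \<epsilon> / 4"
    using assms(1) \<open>\<epsilon> / 4 > 0\<close> unfolding returning_def by blast
  obtain n2 where n2: "\<And>n. n \<ge> n2 \<Longrightarrow> sqnorm \<mu> (\<lambda>y. g (translate (k * l ^ n) y) - g y) < \<epsilon> / 4"
    using assms(2) \<open>\<epsilon> / 4 > 0\<close> unfolding returning_def by blast
  have "sqnorm \<mu> (\<lambda>y. f (translate (k * l ^ n) y) + g (translate (k * l ^ n) y) - (f y + g y)) < \<epsilon>"
    if "n \<ge> max n1 n2" for n
  proof -
    have "sqnorm \<mu> (\<lambda>y. (f (translate (k * l ^ n) y) - f y) + (g (translate (k * l ^ n) y) - g y)) < \<epsilon>"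
      using sqnorm_add_le[OF L2_translate_difference[OF fg(1) assms(3), of n] L2_translate_difference[OF fg(2) assms(3), of n]]
        n1[of n] n2[of n] that by simp
    then show ?thesis by (simp add: algebra_simps)
  qed
  then show "\<exists>n0. \<forall>n\<ge>n0. sqnorm \<mu> (\<lambda>y. f (translate (k * l ^ n) y) + g (translate (k * l ^ n) y) - (f y + g y)) < \<epsilon>"
    by blast
qed

lemma returning_mult:
  assumes "returning k f" "k > 0" shows "returning k (\<lambda>y. c * f y)"
  unfolding returning_def
proof (intro conjI allI impI)
  have f: "f \<in> L2 \<mu>" using assms by (auto simp: returning_def)
  then show "(\<lambda>y. c * f y) \<in> L2 \<mu>" by (rule L2_mult)
  fix \<epsilon> :: real assume \<epsilon>: "\<epsilon> > 0"
  have c: "(cmod c)\<^sup>2 + 1 > 0" by (simp add: add_nonneg_pos)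
  then have "\<epsilon> / ((cmod c)\<^sup>2 + 1) > 0" using \<epsilon> by simp
  then obtain n0 where n0: "\<And>n. n \<ge> n0 \<Longrightarrow> sqnorm \<mu> (\<lambda>y. f (translate (k * l ^ n) y) - f y) < \<epsilon> / ((cmod c)\<^sup>2 + 1)"
    using assms(1) unfolding returning_def by blast
  have "sqnorm \<mu> (\<lambda>y. c * f (translate (k * l ^ n) y) - c * f y) < \<epsilon>" if "n \<ge> n0" for n
  proof -
    let ?S = "sqnorm \<mu> (\<lambda>y. f (translate (k * l ^ n) y) - f y)"
    have "sqnorm \<mu> (\<lambda>y. c * (f (translate (k * l ^ n) y) - f y)) = (cmod c)\<^sup>2 * ?S"
      by (rule sqnorm_mult[OF L2_translate_difference[OF f assms(2)]])
    also have "\<dots> \<le> ((cmod c)\<^sup>2 + 1) * ?S" by (intro mult_right_mono) auto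
    also have "\<dots> < \<epsilon>" using n0[OF that] c by (simp add: field_simps)
    finally show ?thesis by (simp add: algebra_simps)
  qed
  then show "\<exists>n0. \<forall>n\<ge>n0. sqnorm \<mu> (\<lambda>y. c * f (translate (k * l ^ n) y) - c * f y) < \<epsilon>" by blast
qed

lemma returning_zero: "returning k (\<lambda>_. 0)"
  unfolding returning_def by (auto simp: sqnorm_def L2_def)

lemma returning_sum:
  assumes "finite F" "\<And>f. f \<in> F \<Longrightarrow> returning k f" "k > 0"
  shows "returning k (\<lambda>y. \<Sum>f\<in>F. c f * f y)"
  using assms(1,2)
proof (induction F)
  case (insert f F)
  then have "returning k (\<lambda>y. c f * f y + (\<Sum>f\<in>F. c f * f y))"
    using assms(3) by (intro returning_add returning_mult) auto
  then show ?case using insert.hyps by simp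
qed (simp add: returning_zero)

lemma returning_closed:
  assumes "h \<in> L2 \<mu>" "k > 0" "\<And>\<epsilon>. \<epsilon> > 0 \<Longrightarrow> \<exists>g. returning k g \<and> sqnorm \<mu> (\<lambda>y. h y - g y) < \<epsilon>"
  shows "returning k h"
  unfolding returning_def
proof (intro conjI allI impI assms(1))
  fix \<epsilon> :: real assume "\<epsilon> > 0"
  then have \<epsilon>: "\<epsilon> / 12 > 0" by simp
  obtain g where g: "returning k g" "sqnorm \<mu> (\<lambda>y. h y - g y) < \<epsilon> / 12" using assms(3)[OF \<epsilon>] by blast
  obtain n0 where n0: "\<And>n. n \<ge> n0 \<Longrightarrow> sqnorm \<mu> (\<lambda>y. g (translate (k * l ^ n) y) - g y) < \<epsilon> / 12"
    using g(1) \<epsilon> unfolding returning_def by blast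
  have gL: "g \<in> L2 \<mu>" using g(1) by (simp add: returning_def)
  define f where "f = (\<lambda>y. h y - g y)"
  have f: "f \<in> L2 \<mu>" unfolding f_def using assms(1) gL by (rule L2_diff)
  have "sqnorm \<mu> (\<lambda>y. h (translate (k * l ^ n) y) - h y) < \<epsilon>" if "n \<ge> n0" for n
  proof -
    have "sqnorm \<mu> (\<lambda>y. f (translate (k * l ^ n) y) - f y) \<le> 2 * sqnorm \<mu> f + 2 * sqnorm \<mu> f"
      using sqnorm_diff_le[OF L2_translate(1)[OF f, of "nat (k * l ^ n)"] f] L2_translate(2)[OF f, of "nat (k * l ^ n)"]
      unfolding nonneg_times[OF assms(2)] by simp
    moreover have "sqnorm \<mu> f < \<epsilon> / 12" using g(2) by (simp add: f_def)
    moreover have "sqnorm \<mu> (\<lambda>y. (f (translate (k * l ^ n) y) - f y) + (g (translate (k * l ^ n) y) - g y)) \<le>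
        2 * sqnorm \<mu> (\<lambda>y. f (translate (k * l ^ n) y) - f y) + 2 * sqnorm \<mu> (\<lambda>y. g (translate (k * l ^ n) y) - g y)"
      by (rule sqnorm_add_le[OF L2_translate_difference[OF f assms(2)] L2_translate_difference[OF gL assms(2)]])
    ultimately have "sqnorm \<mu> (\<lambda>y. (f (translate (k * l ^ n) y) - f y) + (g (translate (k * l ^ n) y) - g y)) < \<epsilon>"
      using n0[OF that] \<open>\<epsilon> > 0\<close> by linarith
    then show ?thesis by (simp add: f_def)
  qed
  then show "\<exists>n0. \<forall>n\<ge>n0. sqnorm \<mu> (\<lambda>y. h (translate (k * l ^ n) y) - h y) < \<epsilon>" by blast
qed

text \<open>On the returning set of positive frequency an eigenfunction almost returns, but it also picks up
  the factor \<open>\<omega> ^ (k l ^ n)\<close>; hence these factors tend to 1.\<close>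

lemma eigenfunction_returning:
  assumes "x i = x (i + k)" "k > 0" "\<phi> \<in> L2 \<mu>" "sqnorm \<mu> \<phi> = 1" "AE y in \<mu>. \<phi> (shift y) = \<omega> * \<phi> y"
  shows "returning k \<phi>"
  unfolding returning_def
proof (intro conjI allI impI assms(3))
  fix \<epsilon> :: real assume \<epsilon>: "\<epsilon> > 0"
  obtain c where c: "c > 0" "\<And>h \<epsilon>. h \<in> L2 \<mu> \<Longrightarrow> \<epsilon> > 0 \<Longrightarrow> \<exists>n0. \<forall>n\<ge>n0. \<exists>W\<in>sets \<mu>. often X c W \<and>
      sqnorm \<mu> (\<lambda>y. indicator W y * (h (translate (k * l ^ n) y) - h y)) < \<epsilon>"
    using often_L2_return[OF assms(1,2)] by blast
  have m: "\<phi> \<in> borel_measurable \<mu>" using assms(3) by (rule L2_measurable)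
  have "c * \<epsilon> > 0" using c(1) \<epsilon> by simp
  then obtain n0 where n0: "\<And>n. n \<ge> n0 \<Longrightarrow> \<exists>W\<in>sets \<mu>. often X c W \<and>
      sqnorm \<mu> (\<lambda>y. indicator W y * (\<phi> (translate (k * l ^ n) y) - \<phi> y)) < c * \<epsilon>"
    using c(2)[OF assms(3)] by blast
  have "sqnorm \<mu> (\<lambda>y. \<phi> (translate (k * l ^ n) y) - \<phi> y) < \<epsilon>" if n: "n \<ge> n0" for n
  proof -
    obtain W where W: "W \<in> sets \<mu>" "often X c W"
      "sqnorm \<mu> (\<lambda>y. indicator W y * (\<phi> (translate (k * l ^ n) y) - \<phi> y)) < c * \<epsilon>"
      using n0[OF n] by blast
    define s where "s = nat (k * l ^ n)"
    have s: "int s = k * l ^ n" unfolding s_def by (rule nonneg_times[OF assms(2)])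
    define \<kappa> where "\<kappa> = (cmod (\<omega> ^ s - 1))\<^sup>2"
    have eig: "AE y in \<mu>. \<phi> (translate (k * l ^ n) y) = \<omega> ^ s * \<phi> y"
      using eigenfunction_translate[OF assms(5), of s] unfolding s .
    have tm: "(\<lambda>y. \<phi> (translate (k * l ^ n) y)) \<in> borel_measurable \<mu>" using m by (rule borel_measurable_translate)
    have im: "(\<lambda>y. indicator W y :: complex) \<in> borel_measurable \<mu>" using W(1) by simp
    have "sqnorm \<mu> (\<lambda>y. \<phi> (translate (k * l ^ n) y) - \<phi> y) = sqnorm \<mu> (\<lambda>y. (\<omega> ^ s - 1) * \<phi> y)"
    proof (rule sqnorm_cong_AE)
      show "AE y in \<mu>. \<phi> (translate (k * l ^ n) y) - \<phi> y = (\<omega> ^ s - 1) * \<phi> y"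
        using eig by eventually_elim (simp add: algebra_simps)
    qed (use tm m in auto)
    also have "\<dots> = \<kappa>" using sqnorm_mult[OF assms(3)] assms(4) by (simp add: \<kappa>_def)
    finally have full: "sqnorm \<mu> (\<lambda>y. \<phi> (translate (k * l ^ n) y) - \<phi> y) = \<kappa>" .
    have "sqnorm \<mu> (\<lambda>y. indicator W y * (\<phi> (translate (k * l ^ n) y) - \<phi> y)) =
        sqnorm \<mu> (\<lambda>y. (\<omega> ^ s - 1) * (indicator W y * \<phi> y))"
    proof (rule sqnorm_cong_AE)
      show "AE y in \<mu>. indicator W y * (\<phi> (translate (k * l ^ n) y) - \<phi> y) = (\<omega> ^ s - 1) * (indicator W y * \<phi> y)"
        using eig by eventually_elim (simp add: algebra_simps)
    qed (use tm m im in \<open>auto intro!: borel_measurable_times borel_measurable_diff\<close>)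
    also have "\<dots> = (LINT y|\<mu>. \<kappa> * ((cmod (\<phi> y))\<^sup>2 * indicator W y))"
      unfolding sqnorm_def
    proof (rule Bochner_Integration.integral_cong[OF refl])
      show "(cmod ((\<omega> ^ s - 1) * (indicator W y * \<phi> y)))\<^sup>2 = \<kappa> * ((cmod (\<phi> y))\<^sup>2 * indicator W y)" for y
        by (cases "y \<in> W") (simp_all add: \<kappa>_def norm_mult power_mult_distrib)
    qed
    also have "\<dots> = \<kappa> * (LINT y|\<mu>. (cmod (\<phi> y))\<^sup>2 * indicator W y)" by simp
    also have "\<dots> \<ge> \<kappa> * (c * (LINT y|\<mu>. (cmod (\<phi> y))\<^sup>2))"
    proof (intro mult_left_mono often_integral[OF W(2,1) L2_integrable[OF assms(3)]])
      fix s
      show "AE y in \<mu>. (cmod (\<phi> (translate (int s) y)))\<^sup>2 = (cmod (\<phi> y))\<^sup>2"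
        using eigenfunction_translate[OF assms(5), of s]
        by eventually_elim (simp add: norm_mult norm_power eigenvalue_norm[OF assms(3-5)])
    qed (auto simp: \<kappa>_def)
    finally have "\<kappa> * c < c * \<epsilon>" using W(3) assms(4) by (simp add: sqnorm_def)
    then have "\<kappa> < \<epsilon>" using c(1) by (simp add: mult.commute)
    then show ?thesis using full by simp
  qed
  then show "\<exists>n0. \<forall>n\<ge>n0. sqnorm \<mu> (\<lambda>y. \<phi> (translate (k * l ^ n) y) - \<phi> y) < \<epsilon>" by blast
qed

text \<open>The returning functions form a closed subspace, which contains all eigenfunctions and hence everything
  if these span. But the letter at 0 does not return if a pair of letters has no coincidence.\<close>

lemma discrete_spectrum_imp_coincident:
  assumes "x i = x (i + k)" "k > 0" "discrete_spectrum \<mu>"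
  shows "coincident k"
proof (rule ccontr)
  assume "\<not> coincident k"
  then obtain c n0 where c: "c > 0" "\<And>n. n \<ge> n0 \<Longrightarrow> often X c {y. y 0 \<noteq> y (k * l ^ n)}"
    using not_coincident_often_differ assms(2) by blast
  obtain \<Phi> where \<Phi>: "L2_orthonormal_basis \<mu> \<Phi>" "\<And>\<phi>. \<phi> \<in> \<Phi> \<Longrightarrow> eigenfunction \<mu> \<phi>"
    using assms(3) unfolding discrete_spectrum_def by blast
  have ret: "returning k \<phi>" if \<phi>: "\<phi> \<in> \<Phi>" for \<phi>
  proof -
    have "L2_inner \<mu> \<phi> \<phi> = 1" using \<Phi>(1) \<phi> unfolding L2_orthonormal_basis_def by auto
    moreover have "L2_inner \<mu> \<phi> \<phi> = complex_of_real (sqnorm \<mu> \<phi>)"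
      unfolding L2_inner_def sqnorm_def complex_norm_square[symmetric] by (rule integral_complex_of_real)
    ultimately have "sqnorm \<mu> \<phi> = 1" by simp
    moreover obtain \<omega> where "AE y in \<mu>. \<phi> (shift y) = \<omega> * \<phi> y" "\<phi> \<in> L2 \<mu>"
      using \<Phi>(2)[OF \<phi>] unfolding eigenfunction_def by blast
    ultimately show ?thesis using eigenfunction_returning[OF assms(1,2)] by blast
  qed
  \<comment> \<open>a numbering of the letters\<close>
  obtain e :: "'a \<Rightarrow> nat" where e: "inj e" using countable_finite[of "UNIV :: 'a set"] by (auto simp: countable_def)
  define h where "h = (\<lambda>y :: int \<Rightarrow> 'a. complex_of_nat (e (y 0)))"
  have "local_fun X h"
    unfolding local_fun_def h_def by (rule exI[of _ 0]) (auto simp: agree_def)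
  then have h: "h \<in> L2 \<mu>" by (rule local_fun_L2)
  have "returning k h"
  proof (rule returning_closed[OF h assms(2)])
    fix \<epsilon> :: real assume "\<epsilon> > 0"
    then obtain F a where F: "finite F" "F \<subseteq> \<Phi>" "(LINT y|\<mu>. (cmod (h y - (\<Sum>f\<in>F. a f * f y)))\<^sup>2) < \<epsilon>"
      using \<Phi>(1) h unfolding L2_orthonormal_basis_def by meson
    have "returning k (\<lambda>y. \<Sum>f\<in>F. a f * f y)" using F(1,2) ret assms(2) by (intro returning_sum) auto
    then show "\<exists>g. returning k g \<and> sqnorm \<mu> (\<lambda>y. h y - g y) < \<epsilon>"
      using F(3) by (intro exI[of _ "\<lambda>y. \<Sum>f\<in>F. a f * f y"]) (simp add: sqnorm_def)
  qed
  then obtain n1 where n1: "\<And>n. n \<ge> n1 \<Longrightarrow> sqnorm \<mu> (\<lambda>y. h (translate (k * l ^ n) y) - h y) < c"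
    using c(1) unfolding returning_def by blast
  define n where "n = max n0 n1"
  define D where "D = {y. y 0 \<noteq> y (k * l ^ n)} \<inter> X"
  have D: "D \<in> sets \<mu>" unfolding D_def by (rule local_in_sets[OF local_set_differ])
  have "often X c {y. y 0 \<noteq> y (k * l ^ n)}" using c(2)[of n] by (simp add: n_def)
  then have "often X c D" using translate_X unfolding often_def D_def by simp
  then have "c \<le> measure \<mu> D" using D by (rule often_measure)
  also have "\<dots> = (LINT y|\<mu>. indicator D y)" using D by simp
  also have "\<dots> \<le> sqnorm \<mu> (\<lambda>y. h (translate (k * l ^ n) y) - h y)"
    unfolding sqnorm_def
  proof (rule integral_mono)
    show "integrable \<mu> (indicator D :: _ \<Rightarrow> real)" using D by (simp add: emeasure_finite less_top[symmetric])
    show "integrable \<mu> (\<lambda>y. (cmod (h (translate (k * l ^ n) y) - h y))\<^sup>2)"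
      by (rule L2_integrable[OF L2_translate_difference[OF h assms(2)]])
    fix y
    show "indicator D y \<le> (cmod (h (translate (k * l ^ n) y) - h y))\<^sup>2"
    proof (cases "y \<in> D")
      case True
      then have "e (y (k * l ^ n)) \<noteq> e (y 0)" using e by (auto simp: D_def inj_def)
      then have "1 \<le> \<bar>int (e (y (k * l ^ n))) - int (e (y 0))\<bar>" by linarith
      then have "1 \<le> real_of_int \<bar>int (e (y (k * l ^ n))) - int (e (y 0))\<bar>" by linarith
      also have "\<dots> = cmod (of_int (int (e (y (k * l ^ n))) - int (e (y 0))))" by (simp only: norm_of_int of_int_abs)
      also have "\<dots> = cmod (h (translate (k * l ^ n) y) - h y)" by (simp add: h_def translate_nth)
      finally have "1 \<le> (cmod (h (translate (k * l ^ n) y) - h y))\<^sup>2" by (rule one_le_power)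
      then show ?thesis using True by simp
    qed simp
  qed
  also have "\<dots> < c" using n1[of n] by (simp add: n_def)
  finally show False by simp
qed

lemma difference_density_measurable:
  "(\<lambda>y. difference_density y z) \<in> borel_measurable \<mu>"
  unfolding difference_density_def
proof (rule borel_measurable_limsup)
  fix n
  have "local_fun X (\<lambda>y. ereal (real (card {s. s < n \<and> y (int s) \<noteq> z (int s)}) / real n))"
    unfolding local_fun_def
  proof (rule exI[of _ n], intro ballI impI)
    fix y y' :: "int \<Rightarrow> 'a" assume yy: "agree n y y'"
    have "{s. s < n \<and> y (int s) \<noteq> z (int s)} = {s. s < n \<and> y' (int s) \<noteq> z (int s)}"
      using yy by (intro Collect_cong) (auto simp: agree_def)
    then show "ereal (real (card {s. s < n \<and> y (int s) \<noteq> z (int s)}) / real n) =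
        ereal (real (card {s. s < n \<and> y' (int s) \<noteq> z (int s)}) / real n)" by simp
  qed
  then show "(\<lambda>y. ereal (real (card {s. s < n \<and> y (int s) \<noteq> z (int s)}) / real n)) \<in> borel_measurable \<mu>"
    by (rule local_fun_borel)
qed

lemma difference_density_triangle:
  "difference_density y z \<le> difference_density y w + difference_density z w"
proof -
  have "difference_density y z \<le> limsup (\<lambda>n. ereal (real (card {s. s < n \<and> y (int s) \<noteq> w (int s)}) / real n) +
      ereal (real (card {s. s < n \<and> z (int s) \<noteq> w (int s)}) / real n))"
    unfolding difference_density_def
  proof (intro Limsup_mono always_eventually allI)
    fix n
    have "card {s. s < n \<and> y (int s) \<noteq> z (int s)} \<le>
        card ({s. s < n \<and> y (int s) \<noteq> w (int s)} \<union> {s. s < n \<and> z (int s) \<noteq> w (int s)})"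
      by (intro card_mono) auto
    also have "\<dots> \<le> card {s. s < n \<and> y (int s) \<noteq> w (int s)} + card {s. s < n \<and> z (int s) \<noteq> w (int s)}"
      by (rule card_Un_le)
    finally have "real (card {s. s < n \<and> y (int s) \<noteq> z (int s)}) / real n \<le>
        (real (card {s. s < n \<and> y (int s) \<noteq> w (int s)}) + real (card {s. s < n \<and> z (int s) \<noteq> w (int s)})) / real n"
      by (intro divide_right_mono) auto
    then show "ereal (real (card {s. s < n \<and> y (int s) \<noteq> z (int s)}) / real n) \<le>
        ereal (real (card {s. s < n \<and> y (int s) \<noteq> w (int s)}) / real n) +
        ereal (real (card {s. s < n \<and> z (int s) \<noteq> w (int s)}) / real n)"
      by (simp add: add_divide_distrib)
  qed
  also have "\<dots> \<le> difference_density y w + difference_density z w"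
    unfolding difference_density_def by (rule ereal_limsup_add_mono)
  finally show ?thesis .
qed

text \<open>If only finitely many points were separated, finitely many small balls for the density of
  differences would cover \<open>X\<close>. The index of the ball containing a point is a measurable function, so it
  takes the same value at some \<open>y\<close> and its shift by \<open>k l ^ n\<close>, although these differ with a frequency
  bounded below.\<close>

lemma not_coincident_imp_lower_ac_infinite:
  assumes "x i = x (i + k)" "k > 0" "\<not> coincident k" "induces_shift_topology d"
  shows "lower_ac d X = \<infinity>"
proof -
  interpret Metric_space UNIV d using assms(4) by (simp add: induces_shift_topology_def)
  obtain \<delta> where \<delta>: "\<delta> > 0" "\<And>y z. y 0 \<noteq> z 0 \<Longrightarrow> \<delta> \<le> d y z"
    using metric_separates_coordinate_0[OF assms(4)] by blast
  obtain c n0 where c: "c > 0" "\<And>n. n \<ge> n0 \<Longrightarrow> often X c {y. y 0 \<noteq> y (k * l ^ n)}"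
    using not_coincident_often_differ[OF assms(3,2)] by blast
  define \<nu> where "\<nu> = c / 2"
  have sym: "sep_density d \<delta> y z = sep_density d \<delta> z y" for y z
    unfolding sep_density_def by (subst commute) simp
  have "Sep d X \<delta> \<nu> = \<infinity>"
  proof (rule ccontr)
    assume "Sep d X \<delta> \<nu> \<noteq> \<infinity>"
    then obtain K where K: "Sep d X \<delta> \<nu> = enat K" by auto
    define sep where "sep Y \<longleftrightarrow> Y \<subseteq> X \<and> (\<forall>y\<in>Y. \<forall>z\<in>Y. y \<noteq> z \<longrightarrow> ereal \<nu> \<le> sep_density d \<delta> y z)" for Y
    have sep: "finite Y \<and> card Y \<le> K" if "sep Y" for Y
    proof -
      have "(if finite Y then enat (card Y) else \<infinity>) \<le> Sep d X \<delta> \<nu>"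
        unfolding Sep_def by (rule SUP_upper) (use that in \<open>auto simp: sep_def\<close>)
      then show ?thesis using K by (auto split: if_splits)
    qed
    have "\<exists>N. (\<exists>Y. sep Y \<and> card Y = N) \<and> (\<forall>N'. (\<exists>Y. sep Y \<and> card Y = N') \<longrightarrow> N' \<le> N)"
    proof (rule Nat.ex_has_greatest_nat[of _ 0 K])
      show "\<exists>Y. sep Y \<and> card Y = 0" by (intro exI[of _ "{}"]) (simp add: sep_def)
    qed (use sep in blast)
    then obtain Y where Y: "sep Y" "\<And>Y'. sep Y' \<Longrightarrow> card Y' \<le> card Y" by blast
    have near: "\<exists>z\<in>Y. difference_density y z < ereal \<nu>" if "y \<in> X" for y
    proof (cases "y \<in> Y")
      case True
      have "difference_density y y = 0"
        unfolding difference_density_def by (simp add: Limsup_const flip: zero_ereal_def)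
      then show ?thesis using True c(1) by (intro bexI[of _ y]) (auto simp: \<nu>_def)
    next
      case False
      have "finite Y" using sep Y(1) by blast
      then have "\<not> sep (insert y Y)" using Y(2)[of "insert y Y"] False by auto
      then obtain z where "z \<in> Y" "\<not> ereal \<nu> \<le> sep_density d \<delta> y z"
        using Y(1) \<open>y \<in> X\<close> sym unfolding sep_def by auto
      then show ?thesis
        using difference_density_le_sep_density[of \<delta> d y z] \<delta>(2) by (intro bexI[of _ z]) (auto simp: not_le intro: le_less_trans)
    qed
    obtain ys where ys: "set ys = Y" using sep Y(1) finite_list by blast
    define P where "P y j \<longleftrightarrow> difference_density y (ys ! j) < ereal \<nu>" for y j
    have P: "\<exists>j. P y j" if "y \<in> X" for y
      using near[OF that] ys unfolding P_def by (metis in_set_conv_nth)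
    define idx where "idx y = (LEAST j. P y j)" for y
    have idx: "P y (idx y)" if "y \<in> X" for y
      unfolding idx_def using P[OF that] by (rule LeastI_ex)
    have idx_less: "idx y < length ys" if yX: "y \<in> X" for y
    proof -
      obtain z where "z \<in> Y" "difference_density y z < ereal \<nu>" using near[OF yX] by blast
      then obtain j where "j < length ys" "P y j" using ys unfolding P_def by (metis in_set_conv_nth)
      then show ?thesis unfolding idx_def using Least_le[of "P y" j] by linarith
    qed
    have "(\<lambda>y. P y j) \<in> measurable \<mu> (count_space UNIV)" for j
      unfolding P_def using difference_density_measurable[of "ys ! j"] by measurable
    then have idx_meas: "idx \<in> measurable \<mu> (count_space UNIV)"
      unfolding idx_def[abs_def] by (rule measurable_Least)
    define h where "h = (\<lambda>y. complex_of_nat (idx y))"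
    have "h \<in> L2 \<mu>"
    proof (rule L2_bounded[of _ "real (length ys)"])
      show "h \<in> borel_measurable \<mu>" unfolding h_def
        by (rule measurable_compose[OF idx_meas]) simp
      show "cmod (h y) \<le> real (length ys)" if "y \<in> space \<mu>" for y
        using idx_less[of y] that by (simp add: h_def space_eq)
    qed
    obtain c' where c': "c' > 0" "\<And>h \<epsilon>. h \<in> L2 \<mu> \<Longrightarrow> \<epsilon> > 0 \<Longrightarrow> \<exists>n0. \<forall>n\<ge>n0. \<exists>W\<in>sets \<mu>. often X c' W \<and>
        sqnorm \<mu> (\<lambda>y. indicator W y * (h (translate (k * l ^ n) y) - h y)) < \<epsilon>"
      using often_L2_return[OF assms(1,2)] by blast
    obtain n1 where n1: "\<And>n. n \<ge> n1 \<Longrightarrow> \<exists>W\<in>sets \<mu>. often X c' W \<and>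
        sqnorm \<mu> (\<lambda>y. indicator W y * (h (translate (k * l ^ n) y) - h y)) < c'"
      using c'(2)[OF \<open>h \<in> L2 \<mu>\<close> c'(1)] by blast
    define n where "n = max n0 n1"
    obtain W where W: "W \<in> sets \<mu>" "often X c' W"
      "sqnorm \<mu> (\<lambda>y. indicator W y * (h (translate (k * l ^ n) y) - h y)) < c'"
      using n1[of n] by (auto simp: n_def)
    have "\<exists>y\<in>W. idx (translate (k * l ^ n) y) = idx y"
    proof (rule ccontr)
      assume no: "\<not> ?thesis"
      have "c' \<le> measure \<mu> W" by (rule often_measure[OF W(2,1)])
      also have "\<dots> = (LINT y|\<mu>. indicator W y)" using W(1) by simp
      also have "\<dots> \<le> sqnorm \<mu> (\<lambda>y. indicator W y * (h (translate (k * l ^ n) y) - h y))"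
        unfolding sqnorm_def
      proof (rule integral_mono)
        show "integrable \<mu> (indicator W :: _ \<Rightarrow> real)" using W(1) by (simp add: emeasure_finite less_top[symmetric])
        have hd: "(\<lambda>y. h (translate (k * l ^ n) y) - h y) \<in> L2 \<mu>"
          by (rule L2_translate_difference[OF \<open>h \<in> L2 \<mu>\<close> assms(2)])
        have "(\<lambda>y. indicator W y * (h (translate (k * l ^ n) y) - h y)) \<in> L2 \<mu>"
        proof (rule L2_dominated(1)[OF _ L2_integrable[OF hd]])
          show "(\<lambda>y. indicator W y * (h (translate (k * l ^ n) y) - h y)) \<in> borel_measurable \<mu>"
            using L2_measurable[OF hd] W(1) by (intro borel_measurable_times borel_measurable_indicator)
        qed (simp add: indicator_def)
        then show "integrable \<mu> (\<lambda>y. (cmod (indicator W y * (h (translate (k * l ^ n) y) - h y)))\<^sup>2)"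
          by (rule L2_integrable)
        fix y
        show "indicator W y \<le> (cmod (indicator W y * (h (translate (k * l ^ n) y) - h y)))\<^sup>2"
        proof (cases "y \<in> W")
          case True
          then have "1 \<le> \<bar>int (idx (translate (k * l ^ n) y)) - int (idx y)\<bar>" using no by (auto simp: abs_if)
          then have "1 \<le> real_of_int \<bar>int (idx (translate (k * l ^ n) y)) - int (idx y)\<bar>" by linarith
          also have "\<dots> = cmod (of_int (int (idx (translate (k * l ^ n) y)) - int (idx y)))"
            by (simp only: norm_of_int of_int_abs)
          also have "\<dots> = cmod (h (translate (k * l ^ n) y) - h y)" by (simp add: h_def)
          finally have "1 \<le> (cmod (h (translate (k * l ^ n) y) - h y))\<^sup>2" by (rule one_le_power)
          then show ?thesis using True by simp
        qed simp
      qed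
      also have "\<dots> < c'" by (rule W(3))
      finally show False by simp
    qed
    then obtain y where y: "y \<in> W" "idx (translate (k * l ^ n) y) = idx y" by blast
    have "y \<in> X" using sets.sets_into_space[OF W(1)] y(1) unfolding space_eq by blast
    let ?y' = "translate (k * l ^ n) y"
    have "P y (idx y)" "P ?y' (idx y)" using idx[OF \<open>y \<in> X\<close>] idx[OF translate_X[OF \<open>y \<in> X\<close>]] y(2) by metis+
    then have "difference_density y (ys ! idx y) + difference_density ?y' (ys ! idx y) < ereal \<nu> + ereal \<nu>"
      unfolding P_def by (rule ereal_add_strict_mono2)
    then have "difference_density y ?y' < ereal c"
      using difference_density_triangle[of y ?y' "ys ! idx y"] by (simp add: \<nu>_def)
    moreover have "ereal c \<le> difference_density y ?y'"
      using c(2)[of n] \<open>y \<in> X\<close> translate_X by (intro often_differ_density) (auto simp: n_def)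
    ultimately show False by simp
  qed
  moreover have "\<nu> > 0" using c(1) by (simp add: \<nu>_def)
  ultimately show ?thesis using lower_ac_infinity[OF \<delta>(1)] by blast
qed

end

section \<open>Coincidences give discrete spectrum\<close>

context self_similar
begin

lemma phase_translateI: "phase m y j \<Longrightarrow> phase m (translate s y) (j + s)"
  unfolding phase_def
proof
  fix R
  assume "\<forall>R. \<exists>q. agree R y (translate (j + m * q) x)"
  then obtain q where "agree (R + nat \<bar>s\<bar>) y (translate (j + m * q) x)" by blast
  then have "agree R (translate s y) (translate s (translate (j + m * q) x))" by (rule agree_translate) simp
  moreover have "translate s (translate (j + m * q) x) = translate (j + s + m * q) x"
    by (simp add: algebra_simps)
  ultimately show "\<exists>q. agree R (translate s y) (translate (j + s + m * q) x)" by metis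
qed

lemma phase_translate: "phase m (translate s y) j \<longleftrightarrow> phase m y (j - s)"
proof
  assume "phase m (translate s y) j"
  then have "phase m (translate (- s) (translate s y)) (j + - s)" by (rule phase_translateI)
  then show "phase m y (j - s)" by simp
next
  assume "phase m y (j - s)"
  then have "phase m (translate s y) (j - s + s)" by (rule phase_translateI)
  then show "phase m (translate s y) j" by simp
qed

lemma phase_add_multiple: "phase m y (j + m * p) \<longleftrightarrow> phase m y j"
proof -
  have imp: "phase m y (j + m * p)" if ph: "phase m y j" for j p
    unfolding phase_def
  proof
    fix R
    obtain q where q: "agree R y (translate (j + m * q) x)" using ph unfolding phase_def by blast
    have "j + m * p + m * (q - p) = j + m * q" by (simp add: algebra_simps)
    then show "\<exists>q. agree R y (translate (j + m * p + m * q) x)" using q by metis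
  qed
  show ?thesis
  proof
    assume "phase m y (j + m * p)"
    then have "phase m y (j + m * p + m * (- p))" by (rule imp)
    then show "phase m y j" by simp
  qed (rule imp)
qed

lemma phase_mod: "phase m y j \<longleftrightarrow> phase m y (j mod m)"
  using phase_add_multiple[of m y "j mod m" "j div m"] by simp

definition phases :: "int \<Rightarrow> (int \<Rightarrow> 'a) \<Rightarrow> int set" where
  "phases m y = {j. 0 \<le> j \<and> j < m \<and> phase m y j}"

lemma finite_phases: "finite (phases m y)"
  by (rule finite_subset[of _ "{0..<m}"]) (auto simp: phases_def)

lemma phases_nonempty: "y \<in> X \<Longrightarrow> m > 0 \<Longrightarrow> phases m y \<noteq> {}"
  using exists_phase[of y m] unfolding phases_def by blast

lemma phases_eq_imp_phase_eq:
  assumes "phases m y = phases m z" "m > 0" shows "phase m y j \<longleftrightarrow> phase m z j"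
proof -
  have "j mod m \<in> phases m y \<longleftrightarrow> j mod m \<in> phases m z" using assms(1) by simp
  then have "phase m y (j mod m) \<longleftrightarrow> phase m z (j mod m)" using assms(2) by (simp add: phases_def)
  then show ?thesis using phase_mod[of m y j] phase_mod[of m z j] by simp
qed

text \<open>That a class of times does not accumulate at \<open>y\<close> is visible in a finite window.\<close>

lemma phases_upper_semicontinuous:
  obtains R where "\<And>z. agree R y z \<Longrightarrow> phases m z \<subseteq> phases m y"
proof -
  have "\<forall>j. \<exists>R. \<not> phase m y j \<longrightarrow> (\<forall>q. \<not> agree R y (translate (j + m * q) x))"
    unfolding phase_def by blast
  from choice[OF this] obtain \<rho> where
    \<rho>: "\<And>j q. \<not> phase m y j \<Longrightarrow> \<not> agree (\<rho> j) y (translate (j + m * q) x)" by blast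
  define R where "R = Max (insert 0 (\<rho> ` {0..<m}))"
  show ?thesis
  proof (rule that[of R], rule subsetI)
    fix z j assume z: "agree R y z" and j: "j \<in> phases m z"
    have "\<rho> j \<le> R" unfolding R_def using j by (intro Max_ge) (auto simp: phases_def)
    obtain q where "agree R z (translate (j + m * q) x)" using j unfolding phases_def phase_def by blast
    then have "agree R y (translate (j + m * q) x)" using agree_trans[OF z] by blast
    then have "agree (\<rho> j) y (translate (j + m * q) x)" using \<open>\<rho> j \<le> R\<close> by (rule agree_mono)
    then have "phase m y j" using \<rho> by blast
    then show "j \<in> phases m y" using j by (simp add: phases_def)
  qed
qed

text \<open>Near a point with the least number of phases the set of phases is constant, by semicontinuity.
  Every orbit comes near this point within a bounded time, and the phases move along with the shift;
  so a bounded window determines the phases of a point.\<close>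

lemma phase_local:
  assumes "m > 0"
  obtains R where "\<And>y z j. y \<in> X \<Longrightarrow> z \<in> X \<Longrightarrow> agree R y z \<Longrightarrow> phase m y j \<longleftrightarrow> phase m z j"
proof -
  have "\<exists>y. y \<in> X \<and> (\<forall>z. z \<in> X \<longrightarrow> card (phases m y) \<le> card (phases m z))"
    using self_in_orbit_closure by (rule ex_has_least_nat)
  then obtain y0 where y0: "y0 \<in> X" "\<And>z. z \<in> X \<Longrightarrow> card (phases m y0) \<le> card (phases m z)" by blast
  obtain R0 where R0: "\<And>z. agree R0 y0 z \<Longrightarrow> phases m z \<subseteq> phases m y0"
    by (rule phases_upper_semicontinuous[of y0 m]) blast
  have near: "phases m z = phases m y0" if "z \<in> X" "agree R0 y0 z" for z
    using R0[OF that(2)] y0(2)[OF that(1)] finite_phases by (intro card_seteq) auto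
  obtain t0 where t0: "agree R0 y0 (translate t0 x)" using y0(1) in_orbit_closure by blast
  obtain L where L: "L > 0" "\<And>u a. \<exists>t. a \<le> t \<and> t < a + L \<and> (\<forall>i. 0 \<le> i \<and> i \<le> 2 * int R0 \<longrightarrow> x (t + i) = x (u + i))"
    by (rule word_recurs[of "2 * int R0"]) blast
  define R where "R = nat L + 2 * R0"
  show ?thesis
  proof (rule that[of R])
    fix y z j assume yz: "y \<in> X" "z \<in> X" "agree R y z"
    obtain a where a: "agree R y (translate a x)" using yz(1) in_orbit_closure by blast
    obtain t where t: "a \<le> t" "t < a + L" "\<And>i. 0 \<le> i \<and> i \<le> 2 * int R0 \<Longrightarrow> x (t + i) = x (t0 - int R0 + i)"
      using L(2) by blast
    define s where "s = t - a + int R0"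
    have s: "R0 + nat \<bar>s\<bar> \<le> R" using t L(1) by (simp add: s_def R_def)
    have "agree R0 (translate t0 x) (translate (s + a) x)"
      unfolding agree_def translate_nth
    proof (intro allI impI)
      fix i :: int assume "\<bar>i\<bar> \<le> int R0"
      then have "0 \<le> i + int R0 \<and> i + int R0 \<le> 2 * int R0" by linarith
      then show "x (i + t0) = x (i + (s + a))" using t(3)[of "i + int R0"] by (simp add: s_def algebra_simps)
    qed
    then have ya: "agree R0 y0 (translate s (translate a x))" using agree_trans[OF t0] by simp
    have "agree R0 (translate s (translate a x)) (translate s y)"
      using agree_translate[OF a s] by (rule agree_sym)
    then have y: "agree R0 y0 (translate s y)" using agree_trans[OF ya] by blast
    then have z: "agree R0 y0 (translate s z)" using agree_trans agree_translate[OF yz(3) s] by blast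
    have "phases m (translate s y) = phases m (translate s z)"
      using near y z yz(1,2) translate_in_orbit_closure by metis
    then have "phase m (translate s y) (j + s) \<longleftrightarrow> phase m (translate s z) (j + s)"
      using assms by (rule phases_eq_imp_phase_eq)
    then show "phase m y j \<longleftrightarrow> phase m z j" by (simp add: phase_translate)
  qed
qed

lemma card_phases_translate:
  assumes "m > 0" shows "card (phases m y) \<le> card (phases m (translate s y))"
proof (rule card_inj_on_le[of "\<lambda>j. (j + s) mod m"])
  show "inj_on (\<lambda>j. (j + s) mod m) (phases m y)"
  proof (rule inj_onI)
    fix j j' assume "j \<in> phases m y" "j' \<in> phases m y" and eq: "(j + s) mod m = (j' + s) mod m"
    then have "0 \<le> j" "j < m" "0 \<le> j'" "j' < m" by (auto simp: phases_def)
    moreover have "j mod m = j' mod m" using eq by (metis add_diff_cancel_right' mod_diff_left_eq)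
    ultimately show "j = j'" by simp
  qed
  show "(\<lambda>j. (j + s) mod m) ` phases m y \<subseteq> phases m (translate s y)"
  proof
    fix i assume "i \<in> (\<lambda>j. (j + s) mod m) ` phases m y"
    then obtain j where j: "phase m y j" "i = (j + s) mod m" by (auto simp: phases_def)
    have "phase m (translate s y) (j + s)" using phase_translateI[OF j(1)] .
    then have "phase m (translate s y) i" using phase_mod[of m _ "j + s"] j(2) by simp
    then show "i \<in> phases m (translate s y)" using j(2) assms by (simp add: phases_def)
  qed
qed (rule finite_phases)

text \<open>Predict whether the letter of \<open>y\<close> at \<open>i\<close> is \<open>a\<close> by a majority vote of the shifts of \<open>x\<close>
  with a phase of \<open>y\<close>.\<close>

definition prediction :: "int \<Rightarrow> int \<Rightarrow> 'a \<Rightarrow> (int \<Rightarrow> 'a) set" where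
  "prediction m i a = {y. card (phases m y) \<le> 2 * card {j \<in> phases m y. x (j + i) = a}}"

text \<open>Each wrong prediction needs half of the voters to differ from \<open>y\<close>. Over a period, each voter differs
  from \<open>y\<close> at few places; exchange the two sums.\<close>

lemma prediction_errors_le:
  assumes mism: "\<And>i q. int (card (mismatches n i (i + k * q))) \<le> C" and "k > 0" "y \<in> X"
    and m: "m = k * l ^ n"
  shows "real (card {s. s < nat m \<and> (translate (int s) y \<in> prediction m i a \<longleftrightarrow> y (int s + i) \<noteq> a)}) \<le>
    4 * real_of_int ((k + 2) * C)"
proof -
  have m_pos: "m > 0" unfolding m using assms(2) l_pow_pos by (intro mult_pos_pos)
  define P where "P = {j. - m < j \<and> j < m \<and> phase m y j}"
  have finP: "finite P" by (rule finite_subset[of _ "{- m<..<m}"]) (auto simp: P_def)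
  define bad where "bad = {s. s < nat m \<and> (translate (int s) y \<in> prediction m i a \<longleftrightarrow> y (int s + i) \<noteq> a)}"
  define votes where "votes s = {j \<in> P. x (j + int s + i) \<noteq> y (int s + i)}" for s
  have bad_votes: "card (phases m y) \<le> 2 * card (votes s)" if s: "s \<in> bad" for s
  proof -
    let ?J = "phases m (translate (int s) y)"
    let ?A = "{j \<in> ?J. x (j + i) = a}" and ?D = "{j \<in> ?J. x (j + i) \<noteq> y (int s + i)}"
    have "card ?J \<le> 2 * card ?D"
    proof (cases "y (int s + i) = a")
      case True
      then have "2 * card ?A < card ?J" using s by (auto simp: bad_def prediction_def)
      moreover have "card ?J = card ?A + card ?D"
      proof -
        have "?J = ?A \<union> ?D" "?A \<inter> ?D = {}" using True by auto
        then show ?thesis using card_Un_disjoint[of ?A ?D] finite_phases by simp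
      qed
      ultimately show ?thesis by simp
    next
      case False
      then have "card ?J \<le> 2 * card ?A" using s by (auto simp: bad_def prediction_def)
      moreover have "card ?A \<le> card ?D" using False finite_phases by (intro card_mono) auto
      ultimately show ?thesis by simp
    qed
    moreover have "card ?D \<le> card (votes s)"
    proof (rule card_inj_on_le[of "\<lambda>j. j - int s"])
      show "(\<lambda>j. j - int s) ` ?D \<subseteq> votes s"
      proof
        fix j' assume "j' \<in> (\<lambda>j. j - int s) ` ?D"
        then obtain j where j: "j' = j - int s" "0 \<le> j" "j < m" "phase m (translate (int s) y) j" "x (j + i) \<noteq> y (int s + i)"
          by (auto simp: phases_def)
        have "int s < m" using s m_pos by (auto simp: bad_def)
        then show "j' \<in> votes s" using j by (auto simp: votes_def P_def phase_translate)
      qed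
    qed (auto simp: votes_def finP)
    ultimately show ?thesis using card_phases_translate[OF m_pos, of y "int s"] by linarith
  qed
  have "card P \<le> 2 * card (phases m y)"
  proof -
    have "P \<subseteq> phases m y \<union> (\<lambda>j. j - m) ` phases m y"
    proof
      fix j assume j: "j \<in> P"
      show "j \<in> phases m y \<union> (\<lambda>j. j - m) ` phases m y"
      proof (cases "j \<ge> 0")
        case True
        then show ?thesis using j by (simp add: P_def phases_def)
      next
        case False
        have "phase m y (j + m * 1)" unfolding phase_add_multiple using j by (simp add: P_def)
        then have "j + m \<in> phases m y" using False j by (simp add: P_def phases_def)
        then show ?thesis by (intro UnI2 image_eqI[of _ _ "j + m"]) auto
      qed
    qed
    then have "card P \<le> card (phases m y \<union> (\<lambda>j. j - m) ` phases m y)"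
      using finite_phases by (intro card_mono) auto
    also have "\<dots> \<le> card (phases m y) + card ((\<lambda>j. j - m) ` phases m y)" by (rule card_Un_le)
    also have "card ((\<lambda>j. j - m) ` phases m y) \<le> card (phases m y)" by (rule card_image_le[OF finite_phases])
    finally show ?thesis by simp
  qed
  define E where "E = real_of_int ((k + 2) * C)"
  have "C \<ge> 0" using mism[of 0 0] by linarith
  then have "E \<ge> 0" using assms(2) by (simp add: E_def)
  have col: "real (card {s. s < nat m \<and> x (j + int s + i) \<noteq> y (int s + i)}) \<le> E" if j: "j \<in> P" for j
  proof -
    have "phase (k * l ^ n) y j" using j by (simp add: P_def m)
    from phase_mismatches_le[OF mism this, of i "nat m" 0]
    have "real (card {s. i \<le> s \<and> s < i + m \<and> y s \<noteq> x (s + j)}) \<le> (real (nat m) / real_of_int (l ^ n) + 2) * real_of_int C"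
      using m_pos by simp
    moreover have "real (nat m) / real_of_int (l ^ n) = real_of_int k"
    proof -
      have "real (nat m) = real_of_int m" using m_pos by simp
      also have "\<dots> = real_of_int k * real_of_int (l ^ n)" unfolding m by (rule of_int_mult)
      finally show ?thesis using l_ge_2 by simp
    qed
    moreover have "card {s. s < nat m \<and> x (j + int s + i) \<noteq> y (int s + i)} \<le> card {s. i \<le> s \<and> s < i + m \<and> y s \<noteq> x (s + j)}"
    proof (rule card_inj_on_le[of "\<lambda>s. int s + i"])
      show "inj_on (\<lambda>s. int s + i) {s. s < nat m \<and> x (j + int s + i) \<noteq> y (int s + i)}" by (auto simp: inj_on_def)
      show "(\<lambda>s. int s + i) ` {s. s < nat m \<and> x (j + int s + i) \<noteq> y (int s + i)} \<subseteq> {s. i \<le> s \<and> s < i + m \<and> y s \<noteq> x (s + j)}"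
        using m_pos by (auto simp: algebra_simps)
      show "finite {s. i \<le> s \<and> s < i + m \<and> y s \<noteq> x (s + j)}"
        by (rule finite_subset[of _ "{i..<i + m}"]) auto
    qed
    ultimately have "real (card {s. s < nat m \<and> x (j + int s + i) \<noteq> y (int s + i)}) \<le> (real_of_int k + 2) * real_of_int C"
      by simp
    then show ?thesis by (simp add: E_def)
  qed
  have count: "real (card {j \<in> J. Q j}) = (\<Sum>j\<in>J. of_bool (Q j))" if "finite J" for J :: "'i set" and Q
    using that by (simp add: Int_def)
  have finb: "finite bad" by (rule finite_subset[of _ "{..<nat m}"]) (auto simp: bad_def)
  have "real (card (phases m y)) * real (card bad) = (\<Sum>s\<in>bad. real (card (phases m y)))" by simp
  also have "\<dots> \<le> (\<Sum>s\<in>bad. 2 * real (card (votes s)))"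
  proof (rule sum_mono)
    fix s assume "s \<in> bad"
    then have "card (phases m y) \<le> 2 * card (votes s)" by (rule bad_votes)
    then show "real (card (phases m y)) \<le> 2 * real (card (votes s))" by linarith
  qed
  also have "\<dots> \<le> (\<Sum>s\<in>{..<nat m}. 2 * real (card (votes s)))"
    by (rule sum_mono2) (auto simp: bad_def)
  also have "\<dots> = 2 * (\<Sum>s\<in>{..<nat m}. real (card (votes s)))" by (rule sum_distrib_left[symmetric])
  also have "\<dots> = 2 * (\<Sum>s\<in>{..<nat m}. \<Sum>j\<in>P. of_bool (x (j + int s + i) \<noteq> y (int s + i)))"
    unfolding votes_def by (simp only: count[OF finP])
  also have "\<dots> = 2 * (\<Sum>j\<in>P. \<Sum>s\<in>{..<nat m}. of_bool (x (j + int s + i) \<noteq> y (int s + i)))"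
    by (subst sum.swap) simp
  also have "\<dots> = 2 * (\<Sum>j\<in>P. real (card {s. s < nat m \<and> x (j + int s + i) \<noteq> y (int s + i)}))"
    using count[of "{..<nat m}"] by simp
  also have "\<dots> \<le> 2 * (\<Sum>j\<in>P. E)" by (intro mult_left_mono sum_mono col) auto
  also have "\<dots> = 2 * real (card P) * E" by simp
  also have "\<dots> \<le> 2 * (2 * real (card (phases m y))) * E"
    using \<open>card P \<le> 2 * card (phases m y)\<close> \<open>E \<ge> 0\<close> by (intro mult_right_mono mult_left_mono) linarith+
  finally have "real (card (phases m y)) * real (card bad) \<le> real (card (phases m y)) * (4 * E)" by simp
  moreover have "card (phases m y) > 0"
    using phases_nonempty[OF assms(3) m_pos] finite_phases card_gt_0_iff by blast
  ultimately show ?thesis unfolding bad_def E_def by simp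
qed

end

context self_similar_measure
begin

text \<open>The counterpart of \<open>often_measure\<close> for an upper bound on the visits.\<close>

lemma rarely_measure:
  assumes D: "D \<in> sets \<mu>" and "\<And>y. y \<in> X \<Longrightarrow> real (card {s. s < M \<and> translate (int s) y \<in> D}) \<le> K"
  shows "real M * measure \<mu> D \<le> K"
proof -
  have Dm: "(\<lambda>y. indicator D y :: real) \<in> borel_measurable \<mu>" using D by simp
  have int: "integrable \<mu> (\<lambda>y. indicator D (translate (int s) y) :: real)" for s
    by (rule integrable_const_bound[of _ 1]) (auto simp: indicator_def intro!: borel_measurable_translate[OF Dm, unfolded indicator_def])
  have "real M * measure \<mu> D = (\<Sum>s<M. (LINT y|\<mu>. indicator D y))" using D by simp
  also have "\<dots> = (\<Sum>s<M. (LINT y|\<mu>. indicator D (translate (int s) y)))"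
    by (intro sum.cong refl integral_translate[symmetric] Dm)
  also have "\<dots> = (LINT y|\<mu>. (\<Sum>s<M. indicator D (translate (int s) y)))"
    by (rule Bochner_Integration.integral_sum[symmetric]) (rule int)
  also have "\<dots> \<le> (LINT y|\<mu>. K)"
  proof (rule integral_mono)
    show "integrable \<mu> (\<lambda>y. \<Sum>s<M. indicator D (translate (int s) y) :: real)"
      by (intro Bochner_Integration.integrable_sum int)
    fix y assume "y \<in> space \<mu>"
    then have "real (card {s. s < M \<and> translate (int s) y \<in> D}) \<le> K" using assms(2) by (simp add: space_eq)
    moreover have "{s. s < M \<and> translate (int s) y \<in> D} = {..<M} \<inter> {s. translate (int s) y \<in> D}" by auto
    ultimately show "(\<Sum>s<M. indicator D (translate (int s) y)) \<le> K"
      by (simp add: indicator_def sum.If_cases)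
  qed simp
  also have "\<dots> = K" by (simp add: prob_space)
  finally show ?thesis .
qed

text \<open>The locally constant functions invariant under a power of the shift. They will turn out to be spanned by
  eigenfunctions.\<close>

definition periodic_fun :: "((int \<Rightarrow> 'a) \<Rightarrow> 'c) \<Rightarrow> bool" where
  "periodic_fun F \<longleftrightarrow> local_fun X F \<and> (\<exists>m>0. \<forall>y\<in>X. F (translate (int m) y) = F y)"

lemma period_multiple:
  assumes "\<And>y. y \<in> X \<Longrightarrow> F (translate (int m) y) = F y" "y \<in> X"
  shows "F (translate (int (m * p)) y) = F y"
proof (induction p)
  case (Suc p)
  have "translate (int (m * Suc p)) y = translate (int m) (translate (int (m * p)) y)" by simp
  then show ?case using assms(1)[OF translate_X[OF assms(2)]] Suc by metis
qed simp

lemma periodic_fun_comp2: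
  assumes "periodic_fun F" "periodic_fun G" shows "periodic_fun (\<lambda>y. h (F y) (G y))"
proof -
  obtain m1 m2 where m: "m1 > 0" "\<And>y. y \<in> X \<Longrightarrow> F (translate (int m1) y) = F y"
    "m2 > 0" "\<And>y. y \<in> X \<Longrightarrow> G (translate (int m2) y) = G y"
    using assms unfolding periodic_fun_def by blast
  have "F (translate (int (m1 * m2)) y) = F y" "G (translate (int (m1 * m2)) y) = G y" if "y \<in> X" for y
    using period_multiple[of F m1 y m2] period_multiple[of G m2 y m1] m that by (auto simp: mult.commute)
  then have "\<forall>y\<in>X. h (F (translate (int (m1 * m2)) y)) (G (translate (int (m1 * m2)) y)) = h (F y) (G y)"
    by simp
  moreover have "m1 * m2 > 0" using m by simp
  ultimately show ?thesis
    using assms local_fun_comp2[of X F G h] unfolding periodic_fun_def by blast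
qed

lemma periodic_fun_comp:
  assumes "periodic_fun F" shows "periodic_fun (\<lambda>y. h (F y))"
  using periodic_fun_comp2[OF assms assms, of "\<lambda>u v. h u"] .

lemma periodic_fun_const: "periodic_fun (\<lambda>_. c)"
  unfolding periodic_fun_def by (auto simp: local_fun_const)

lemma periodic_prediction:
  assumes "m > 0" shows "periodic_fun (\<lambda>y. y \<in> prediction m i a)"
proof -
  obtain R where R: "\<And>y z j. y \<in> X \<Longrightarrow> z \<in> X \<Longrightarrow> agree R y z \<Longrightarrow> phase m y j \<longleftrightarrow> phase m z j"
    by (rule phase_local[OF assms]) blast
  have eq: "phases m y = phases m z" if "y \<in> X" "z \<in> X" "agree R y z" for y z
    unfolding phases_def using R[OF that] by blast
  have "y \<in> prediction m i a \<longleftrightarrow> z \<in> prediction m i a" if "y \<in> X" "z \<in> X" "agree R y z" for y z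
    unfolding prediction_def by (simp only: mem_Collect_eq eq[OF that])
  then have "local_fun X (\<lambda>y. y \<in> prediction m i a)" unfolding local_fun_def by blast
  moreover have "translate (int (nat m)) y \<in> prediction m i a \<longleftrightarrow> y \<in> prediction m i a" for y
  proof -
    have "phase m (translate m y) j \<longleftrightarrow> phase m y j" for j
      using phase_add_multiple[of m y j "-1"] by (simp add: phase_translate)
    then have "phases m (translate m y) = phases m y" by (simp add: phases_def)
    then show ?thesis using assms by (simp add: prediction_def)
  qed
  ultimately show ?thesis using assms unfolding periodic_fun_def by (metis zero_less_nat_eq)
qed

text \<open>With \<open>m = k l ^ n\<close> the predictions depend only on phases modulo \<open>m\<close>, so they are invariant under the \<open>m\<close>-th
  power of the shift; the proportion of errors decays geometrically along multiples of \<open>N\<close>.\<close>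

lemma periodic_approximation:
  assumes "coincident k" "k > 0" "\<epsilon> > 0"
  shows "\<exists>S. periodic_fun (\<lambda>y. y \<in> S) \<and>
    measure \<mu> (S \<inter> X - {y \<in> X. y i = a} \<union> ({y \<in> X. y i = a} - S \<inter> X)) < \<epsilon>"
proof -
  obtain N where N: "N > 0" "\<And>i q t. int (card (mismatches (N * t) i (i + k * q))) \<le> (l ^ N - 1) ^ t"
    using coincident_decay[OF assms(1)] by blast
  define b where "b = real_of_int (l ^ N)"
  have "1 \<le> l ^ N" using l_pow_pos[of N] by simp
  then have b: "1 \<le> b" unfolding b_def by linarith
  define r where "r = (b - 1) / b"
  have r: "0 \<le> r" "r < 1" using b by (auto simp: r_def)
  define K where "K = 4 * (real_of_int k + 2) / real_of_int k"
  have "(\<lambda>t. K * r ^ t) \<longlonglongrightarrow> K * 0" using r by (intro tendsto_intros LIMSEQ_power_zero) auto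
  then have "eventually (\<lambda>t. K * r ^ t < \<epsilon>) sequentially" using assms(3) by (intro order_tendstoD) auto
  then obtain t where t: "K * r ^ t < \<epsilon>" by (auto simp: eventually_sequentially)
  define m where "m = k * l ^ (N * t)"
  have m: "m > 0" unfolding m_def using assms(2) l_pow_pos by (intro mult_pos_pos)
  define S where "S = prediction m i a"
  define B where "B = {y \<in> X. y i = a}"
  define D where "D = S \<inter> X - B \<union> (B - S \<inter> X)"
  have per: "periodic_fun (\<lambda>y. y \<in> S)" unfolding S_def using m by (rule periodic_prediction)
  have "S \<inter> X \<in> sets \<mu>"
    using per local_in_sets[of S] by (simp add: periodic_fun_def local_set_iff_local_fun)
  moreover have "B \<in> sets \<mu>"
  proof -
    have "B = {y. y i = a} \<inter> X" by (auto simp: B_def)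
    then show ?thesis using local_in_sets[OF local_set_cylinder] by simp
  qed
  ultimately have D: "D \<in> sets \<mu>" by (auto simp: D_def)
  have "real (nat m) * measure \<mu> D \<le> 4 * real_of_int ((k + 2) * (l ^ N - 1) ^ t)"
  proof (rule rarely_measure[OF D])
    fix y assume y: "y \<in> X"
    have "{s. s < nat m \<and> translate (int s) y \<in> D} =
        {s. s < nat m \<and> (translate (int s) y \<in> prediction m i a \<longleftrightarrow> y (int s + i) \<noteq> a)}"
      using translate_X[OF y] by (auto simp: D_def S_def B_def translate_nth add.commute)
    then show "real (card {s. s < nat m \<and> translate (int s) y \<in> D}) \<le> 4 * real_of_int ((k + 2) * (l ^ N - 1) ^ t)"
      using prediction_errors_le[OF N(2) assms(2) y m_def] by simp
  qed
  then have "real_of_int m * measure \<mu> D \<le> 4 * ((real_of_int k + 2) * (b - 1) ^ t)"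
    using m by (simp add: b_def)
  moreover have "real_of_int m = real_of_int k * b ^ t" by (simp add: m_def b_def power_mult)
  ultimately have "measure \<mu> D \<le> K * r ^ t"
    using assms(2) b by (simp add: K_def r_def power_divide field_simps)
  then have "measure \<mu> D < \<epsilon>" using t by simp
  then show ?thesis using per unfolding D_def B_def by blast
qed

text \<open>The sets whose indicators are periodic form an algebra, because two periods have a common multiple, and
  this algebra approximates the cylinders.\<close>

lemma approx_periodic_fun:
  assumes "coincident k" "k > 0" "h \<in> L2 \<mu>" "\<epsilon> > 0"
  obtains F where "periodic_fun F" "sqnorm \<mu> (\<lambda>y. h y - F y) < \<epsilon>"
proof -
  let ?\<A> = "{B. B \<subseteq> X \<and> periodic_fun (\<lambda>y. y \<in> B)}"
  have "\<exists>F\<in>{F. periodic_fun F}. sqnorm \<mu> (\<lambda>y. h y - F y) < \<epsilon>"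
  proof (rule L2_dense_of_sets[OF _ _ _ _ _ assms(3,4)])
    show "{F. periodic_fun F} \<subseteq> L2 \<mu>" using local_fun_L2 by (auto simp: periodic_fun_def)
    show "(\<lambda>y. f y + g y) \<in> {F. periodic_fun F}" if "f \<in> {F. periodic_fun F}" "g \<in> {F. periodic_fun F}" for f g
      using that periodic_fun_comp2[of f g "(+)"] by simp
    show sub: "?\<A> \<subseteq> sets \<mu>"
    proof
      fix B assume B: "B \<in> ?\<A>"
      then have "local_set X B" by (simp add: periodic_fun_def local_set_iff_local_fun)
      then show "B \<in> sets \<mu>" using local_in_sets[of B] B by (simp add: Int_absorb2)
    qed
    show "(\<lambda>y. c * indicator A y) \<in> {F. periodic_fun F}" if "A \<in> ?\<A>" for A c
      using that periodic_fun_comp[of "\<lambda>y. y \<in> A" "\<lambda>b. c * of_bool b"] by (simp add: indicator_def)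
    show "\<exists>A\<in>?\<A>. measure \<mu> (A - B \<union> (B - A)) < \<eta>" if B: "B \<in> sets \<mu>" "\<eta> > 0" for B \<eta>
    proof (rule approx_by_algebra[OF _ sub _ _ B])
      have X: "periodic_fun (\<lambda>y. y \<in> X)"
        unfolding periodic_fun_def local_fun_def using translate_X by (auto intro!: exI[of _ 1])
      have "periodic_fun (\<lambda>y. y \<in> X - B)" if "periodic_fun (\<lambda>y. y \<in> B)" for B
        using periodic_fun_comp2[OF X that, of "\<lambda>u v. u \<and> \<not> v"] by simp
      moreover have "periodic_fun (\<lambda>y. y \<in> B \<union> C)" if "periodic_fun (\<lambda>y. y \<in> B)" "periodic_fun (\<lambda>y. y \<in> C)" for B C
        using periodic_fun_comp2[OF that, of "(\<or>)"] by simp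
      moreover have "periodic_fun (\<lambda>y. y \<in> {})" using periodic_fun_const[of False] by simp
      ultimately show "algebra (space \<mu>) ?\<A>" unfolding algebra_iff_Un space_eq by blast
      show "sets \<mu> = sigma_sets (space \<mu>) {{y \<in> X. y i = a} |i a. True}"
        using sets_cylinders by (simp add: space_eq)
      fix B and \<epsilon> :: real assume "B \<in> {{y \<in> X. y i = a} |i a. True}" "\<epsilon> > 0"
      then obtain i a where Bia: "B = {y \<in> X. y i = a}" by blast
      obtain S where S: "periodic_fun (\<lambda>y. y \<in> S)" "measure \<mu> (S \<inter> X - B \<union> (B - S \<inter> X)) < \<epsilon>"
        using periodic_approximation[OF assms(1,2) \<open>\<epsilon> > 0\<close>, of i a] unfolding Bia by blast
      have "periodic_fun (\<lambda>y. y \<in> S \<inter> X)" using periodic_fun_comp2[OF S(1) X, of "(\<and>)"] by simp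
      then show "\<exists>A\<in>?\<A>. measure \<mu> (A - B \<union> (B - A)) < \<epsilon>"
        using S(2) by (intro bexI[of _ "S \<inter> X"]) auto
    qed
  qed
  then show ?thesis using that by blast
qed

end

section \<open>Rational eigenfunctions\<close>

context self_similar_measure
begin

text \<open>By recurrence already the forward orbit of \<open>x\<close> is dense.\<close>

lemma agree_forward:
  assumes "y \<in> X" obtains s where "agree R y (translate (int s) x)"
proof -
  obtain t where t: "agree R y (translate t x)" using assms in_orbit_closure by blast
  obtain L where L: "L > 0" "\<And>u a. \<exists>t. a \<le> t \<and> t < a + L \<and> (\<forall>i. 0 \<le> i \<and> i \<le> 2 * int R \<longrightarrow> x (t + i) = x (u + i))"
    by (rule word_recurs[of "2 * int R"]) blast
  obtain t' where t': "0 \<le> t'" "\<And>i. 0 \<le> i \<and> i \<le> 2 * int R \<Longrightarrow> x (t' + i) = x (t - int R + i)"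
    using L(2)[of 0 "t - int R"] by blast
  have "agree R (translate t x) (translate (int (nat t' + R)) x)"
    unfolding agree_def translate_nth
  proof (intro allI impI)
    fix i :: int assume "\<bar>i\<bar> \<le> int R"
    then have "0 \<le> i + int R \<and> i + int R \<le> 2 * int R" by linarith
    then show "x (i + t) = x (i + int (nat t' + R))"
      using t'(2)[of "i + int R"] t'(1) by (simp add: algebra_simps)
  qed
  then show ?thesis using agree_trans[OF t] that by blast
qed

text \<open>The locally constant eigenfunctions whose eigenvalues are roots of unity, with value 1 at \<open>x\<close>.
  As the orbit of \<open>x\<close> is dense, there is only one for each eigenvalue.\<close>

definition rational_eigenfunction :: "complex \<Rightarrow> ((int \<Rightarrow> 'a) \<Rightarrow> complex) \<Rightarrow> bool" where
  "rational_eigenfunction \<omega> \<phi> \<longleftrightarrow> (\<exists>m>0. \<omega> ^ m = 1) \<and> local_fun X \<phi> \<and> \<phi> x = 1 \<and>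
     (\<forall>y\<in>X. \<phi> (shift y) = \<omega> * \<phi> y) \<and> (\<forall>y. y \<notin> X \<longrightarrow> \<phi> y = 0)"

lemma eigen_orbit:
  assumes "\<And>y. y \<in> X \<Longrightarrow> \<phi> (shift y) = \<omega> * (\<phi> y :: complex)" "y \<in> X"
  shows "\<phi> (translate (int s) y) = \<omega> ^ s * \<phi> y"
proof (induction s)
  case (Suc s)
  have "translate (int (Suc s)) y = shift (translate (int s) y)" by (simp add: shift_eq_translate)
  then have "\<phi> (translate (int (Suc s)) y) = \<omega> * \<phi> (translate (int s) y)"
    using assms(1)[OF translate_X[OF assms(2)]] by metis
  then show ?case using Suc by simp
qed simp

lemma rational_eigenvalue_norm:
  assumes "rational_eigenfunction \<omega> \<phi>" shows "cmod \<omega> = 1"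
proof -
  obtain m where m: "m > 0" "\<omega> ^ m = 1" using assms by (auto simp: rational_eigenfunction_def)
  then have "cmod \<omega> ^ m = 1 ^ m" by (metis norm_one norm_power power_one)
  then show ?thesis using m(1) by (intro power_eq_imp_eq_base[of "cmod \<omega>" m 1]) auto
qed

lemma rational_eigenfunction_norm:
  assumes "rational_eigenfunction \<omega> \<phi>" "y \<in> X" shows "cmod (\<phi> y) = 1"
proof -
  obtain R where R: "\<And>y z. y \<in> X \<Longrightarrow> z \<in> X \<Longrightarrow> agree R y z \<Longrightarrow> \<phi> y = \<phi> z"
    using assms(1) unfolding rational_eigenfunction_def local_fun_def by blast
  obtain s where s: "agree R y (translate (int s) x)" by (rule agree_forward[OF assms(2)])
  have "\<phi> y = \<phi> (translate (int s) x)" by (rule R[OF assms(2) orbit_in_orbit_closure s])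
  also have "\<dots> = \<omega> ^ s"
    using eigen_orbit[OF _ self_in_orbit_closure, of \<phi> \<omega> s] assms(1) by (simp add: rational_eigenfunction_def)
  finally show ?thesis using rational_eigenvalue_norm[OF assms(1)] by (simp add: norm_power)
qed

lemma rational_eigenfunction_unique:
  assumes "rational_eigenfunction \<omega> \<phi>" "rational_eigenfunction \<omega> \<psi>" shows "\<phi> = \<psi>"
proof
  fix y
  show "\<phi> y = \<psi> y"
  proof (cases "y \<in> X")
    case True
    obtain R where R: "\<And>y z. y \<in> X \<Longrightarrow> z \<in> X \<Longrightarrow> agree R y z \<Longrightarrow> \<phi> y = \<phi> z \<and> \<psi> y = \<psi> z"
      using local_fun_cases2[of X \<phi> \<psi>] assms unfolding rational_eigenfunction_def by blast
    obtain s where s: "agree R y (translate (int s) x)" by (rule agree_forward[OF True])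
    have "\<phi> (translate (int s) x) = \<psi> (translate (int s) x)"
      using eigen_orbit[OF _ self_in_orbit_closure, of \<phi> \<omega> s] eigen_orbit[OF _ self_in_orbit_closure, of \<psi> \<omega> s] assms
      by (simp add: rational_eigenfunction_def)
    then show ?thesis using R[OF True orbit_in_orbit_closure s] by simp
  qed (use assms in \<open>simp add: rational_eigenfunction_def\<close>)
qed

lemma rational_eigenfunctions_orthonormal:
  assumes "rational_eigenfunction \<omega> \<phi>" "rational_eigenfunction \<omega>' \<psi>"
  shows "L2_inner \<mu> \<phi> \<psi> = (if \<phi> = \<psi> then 1 else 0)"
proof (cases "\<phi> = \<psi>")
  case True
  have "L2_inner \<mu> \<phi> \<psi> = (LINT y|\<mu>. 1)"
    unfolding L2_inner_def True
  proof (rule Bochner_Integration.integral_cong[OF refl])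
    fix y assume "y \<in> space \<mu>"
    then have "cmod (\<psi> y) = 1" using rational_eigenfunction_norm[OF assms(2)] by (simp add: space_eq)
    then show "\<psi> y * cnj (\<psi> y) = 1" by (simp add: complex_norm_square[symmetric])
  qed
  then show ?thesis using True by (simp add: prob_space)
next
  case False
  then have "\<omega> \<noteq> \<omega>'" using rational_eigenfunction_unique assms by blast
  define f where "f = (\<lambda>y. \<phi> y * cnj (\<psi> y))"
  have "local_fun X f"
    unfolding f_def using assms local_fun_comp2[of X \<phi> \<psi> "\<lambda>u v. u * cnj v"]
    by (simp add: rational_eigenfunction_def)
  then have f: "f \<in> borel_measurable \<mu>" by (rule local_fun_borel)
  have "(LINT y|\<mu>. f y) = (LINT y|\<mu>. f (translate (int 1) y))"
    by (rule integral_translate[OF f, symmetric])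
  also have "\<dots> = (LINT y|\<mu>. (\<omega> * cnj \<omega>') * f y)"
  proof (rule Bochner_Integration.integral_cong[OF refl])
    fix y assume "y \<in> space \<mu>"
    then show "f (translate (int 1) y) = (\<omega> * cnj \<omega>') * f y"
      using assms by (simp add: space_eq f_def rational_eigenfunction_def shift_eq_translate)
  qed
  also have "\<dots> = (\<omega> * cnj \<omega>') * (LINT y|\<mu>. f y)" by simp
  finally have "(1 - \<omega> * cnj \<omega>') * (LINT y|\<mu>. f y) = 0" by (simp add: algebra_simps)
  moreover have "\<omega> * cnj \<omega>' \<noteq> 1"
  proof
    assume eq: "\<omega> * cnj \<omega>' = 1"
    have "\<omega> = \<omega> * (\<omega>' * cnj \<omega>')"
      using rational_eigenvalue_norm[OF assms(2)] by (simp flip: complex_norm_square)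
    also have "\<dots> = \<omega>'" using eq by (simp add: mult.left_commute)
    finally show False using \<open>\<omega> \<noteq> \<omega>'\<close> by simp
  qed
  ultimately show ?thesis using False by (simp add: L2_inner_def f_def)
qed

text \<open>A periodic function is a sum of eigenfunctions by the finite Fourier transform along its period.\<close>

definition fourier_part :: "nat \<Rightarrow> ((int \<Rightarrow> 'a) \<Rightarrow> complex) \<Rightarrow> nat \<Rightarrow> (int \<Rightarrow> 'a) \<Rightarrow> complex" where
  "fourier_part m F q y = (\<Sum>s<m. cnj (cis (2 * pi * real q / real m)) ^ s * F (translate (int s) y)) / of_nat m"

lemma fourier_part_shift:
  assumes "m > 0" "\<And>y. y \<in> X \<Longrightarrow> F (translate (int m) y) = F y" "y \<in> X"
  shows "fourier_part m F q (shift y) = cis (2 * pi * real q / real m) * fourier_part m F q y"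
proof -
  define \<omega> where "\<omega> = cis (2 * pi * real q / real m)"
  have \<omega>1: "\<omega> * cnj \<omega> = 1" by (simp add: \<omega>_def cis_cnj cis_mult)
  have "\<omega> ^ m = cis (2 * pi * real q)" using assms(1) by (simp add: \<omega>_def Complex.DeMoivre)
  also have "\<dots> = 1" using cis_multiple_2pi[of "real q"] by simp
  finally have \<omega>m: "cnj \<omega> ^ m = 1" by (metis complex_cnj_one complex_cnj_power)
  define g where "g s = cnj \<omega> ^ s * F (translate (int s) y)" for s
  have "g m = g 0" using assms(2)[OF assms(3)] \<omega>m by (simp add: g_def)
  then have g_sum: "(\<Sum>s<m. g (Suc s)) = (\<Sum>s<m. g s)"
    using sum.lessThan_Suc_shift[of g m] by simp
  have term_eq: "cnj \<omega> ^ s * F (translate (int s) (shift y)) = \<omega> * g (Suc s)" for s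
  proof -
    have "translate (int s) (shift y) = translate (int (Suc s)) y" by (simp add: shift_eq_translate add.commute)
    then have "\<omega> * g (Suc s) = (\<omega> * cnj \<omega>) * (cnj \<omega> ^ s * F (translate (int s) (shift y)))"
      by (simp add: g_def mult_ac)
    then show ?thesis using \<omega>1 by simp
  qed
  show ?thesis
    unfolding fourier_part_def \<omega>_def[symmetric] term_eq sum_distrib_left[symmetric] g_sum
    by (simp add: g_def)
qed

lemma sum_fourier_parts:
  assumes "m > 0" shows "(\<Sum>q<m. fourier_part m F q y) = F y"
proof -
  define \<omega> where "\<omega> q = cis (2 * pi * real q / real m)" for q
  have sw: "cnj (\<omega> q) ^ s = cnj (\<omega> s) ^ q" for q s
    by (simp add: \<omega>_def cis_cnj Complex.DeMoivre mult_ac)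
  have "inj_on \<omega> {..<m}"
    using Complex.bij_betw_roots_unity[OF assms] unfolding \<omega>_def bij_betw_def by blast
  have sums: "(\<Sum>q<m. cnj (\<omega> q) ^ s) = (if s = 0 then of_nat m else 0)" if s: "s < m" for s
  proof (cases "s = 0")
    case False
    have "\<omega> s \<noteq> \<omega> 0"
      using \<open>inj_on \<omega> {..<m}\<close> s False assms by (auto dest: inj_onD)
    then have ne: "cnj (\<omega> s) \<noteq> 1" by (simp add: \<omega>_def cis_cnj) (metis complex_cnj_cancel_iff complex_cnj_one cis_cnj)
    have "\<omega> s ^ m = cis (2 * pi * real s)" using assms by (simp add: \<omega>_def Complex.DeMoivre)
    also have "\<dots> = 1" using cis_multiple_2pi[of "real s"] by simp
    finally have "cnj (\<omega> s) ^ m = 1" by (metis complex_cnj_one complex_cnj_power)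
    then have "(\<Sum>q<m. cnj (\<omega> s) ^ q) = 0" using geometric_sum[OF ne, of m] by simp
    then show ?thesis using False sw by simp
  qed simp
  have "(\<Sum>q<m. fourier_part m F q y) = (\<Sum>q<m. \<Sum>s<m. cnj (\<omega> q) ^ s * F (translate (int s) y)) / of_nat m"
    unfolding fourier_part_def \<omega>_def by (simp add: sum_divide_distrib)
  also have "(\<Sum>q<m. \<Sum>s<m. cnj (\<omega> q) ^ s * F (translate (int s) y)) =
      (\<Sum>s<m. (\<Sum>q<m. cnj (\<omega> q) ^ s) * F (translate (int s) y))"
    by (subst sum.swap) (simp add: sum_distrib_right)
  also have "\<dots> = (\<Sum>s<m. if s = 0 then of_nat m * F y else 0)"
    by (intro sum.cong refl) (simp add: sums)
  also have "\<dots> = of_nat m * F y" using assms by simp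
  finally show ?thesis using assms by simp
qed

text \<open>The Fourier parts of periodic functions are multiples of the rational eigenfunctions, which are
  orthonormal; and periodic functions are dense.\<close>

lemma coincident_imp_discrete_spectrum:
  assumes "coincident k" "k > 0" shows "discrete_spectrum \<mu>"
proof -
  define \<Phi> where "\<Phi> = {\<phi>. \<exists>\<omega>. rational_eigenfunction \<omega> \<phi>}"
  have "L2_orthonormal_basis \<mu> \<Phi>"
    unfolding L2_orthonormal_basis_def
  proof (intro conjI ballI allI impI)
    show "\<Phi> \<subseteq> L2 \<mu>" using local_fun_L2 by (auto simp: \<Phi>_def rational_eigenfunction_def)
    show "L2_inner \<mu> \<phi> \<psi> = (if \<phi> = \<psi> then 1 else 0)" if "\<phi> \<in> \<Phi>" "\<psi> \<in> \<Phi>" for \<phi> \<psi>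
      using that rational_eigenfunctions_orthonormal unfolding \<Phi>_def by blast
    fix h and \<epsilon> :: real assume h: "h \<in> L2 \<mu>" "\<epsilon> > 0"
    obtain F where F: "periodic_fun F" "sqnorm \<mu> (\<lambda>y. h y - F y) < \<epsilon>"
      using approx_periodic_fun[OF assms h] by blast
    obtain m where m: "m > 0" "\<And>y. y \<in> X \<Longrightarrow> F (translate (int m) y) = F y"
      using F(1) unfolding periodic_fun_def by blast
    define \<omega> where "\<omega> q = cis (2 * pi * real q / real m)" for q
    define G where "G q = fourier_part m F q" for q
    have G_shift: "G q (shift y) = \<omega> q * G q y" if "y \<in> X" for q y
      unfolding G_def \<omega>_def by (rule fourier_part_shift) (use m that in auto)
    have G_local: "local_fun X (G q)" for q
    proof -
      have "local_fun X (\<lambda>y. \<Sum>s<m. cnj (\<omega> q) ^ s * F (translate (int s) y))"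
      proof (intro local_fun_sum)
        fix s
        have "local_fun X (\<lambda>y. F (translate (int s) y))"
          using F(1) translate_X by (intro local_fun_translate) (auto simp: periodic_fun_def)
        then show "local_fun X (\<lambda>y. cnj (\<omega> q) ^ s * F (translate (int s) y))" by (rule local_fun_comp)
      qed simp
      then show ?thesis unfolding G_def fourier_part_def[abs_def] \<omega>_def by (rule local_fun_comp)
    qed
    have G_zero: "G q y = 0" if zero: "G q x = 0" and y: "y \<in> X" for q y
    proof -
      obtain R where R: "\<And>y z. y \<in> X \<Longrightarrow> z \<in> X \<Longrightarrow> agree R y z \<Longrightarrow> G q y = G q z"
        using G_local[of q] unfolding local_fun_def by blast
      obtain s where s: "agree R y (translate (int s) x)" by (rule agree_forward[OF y])
      have "G q y = G q (translate (int s) x)" by (rule R[OF y orbit_in_orbit_closure s])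
      also have "\<dots> = \<omega> q ^ s * G q x" by (rule eigen_orbit[of "G q", OF G_shift self_in_orbit_closure])
      finally show ?thesis using zero by simp
    qed
    define \<phi> where "\<phi> q = (\<lambda>y. if y \<in> X then G q y / G q x else 0)" for q
    define Q where "Q = {q. q < m \<and> G q x \<noteq> 0}"
    have "finite Q" by (rule finite_subset[of _ "{..<m}"]) (auto simp: Q_def)
    have \<phi>_eigen: "rational_eigenfunction (\<omega> q) (\<phi> q)" if "q \<in> Q" for q
      unfolding rational_eigenfunction_def
    proof (intro conjI ballI allI impI)
      have "\<omega> q ^ m = cis (2 * pi * real q)" using m(1) by (simp add: \<omega>_def Complex.DeMoivre)
      also have "\<dots> = 1" using cis_multiple_2pi[of "real q"] by simp
      finally show "\<exists>m>0. \<omega> q ^ m = 1" using m(1) by blast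
      have "local_fun X (\<lambda>y. G q y / G q x)" using G_local by (rule local_fun_comp)
      then show "local_fun X (\<phi> q)" unfolding local_fun_def \<phi>_def by simp
      show "\<phi> q x = 1" using that self_in_orbit_closure by (simp add: \<phi>_def Q_def)
      show "\<phi> q (shift y) = \<omega> q * \<phi> q y" if "y \<in> X" for y
        using that G_shift[OF that] translate_X[OF that, of 1] by (simp add: \<phi>_def shift_eq_translate)
    qed (simp add: \<phi>_def)
    define c where "c f = (\<Sum>q\<in>{q \<in> Q. \<phi> q = f}. G q x)" for f
    have "F y = (\<Sum>f\<in>\<phi> ` Q. c f * f y)" if y: "y \<in> X" for y
    proof -
      have "F y = (\<Sum>q<m. G q y)" unfolding G_def by (rule sum_fourier_parts[OF m(1), symmetric])
      also have "\<dots> = (\<Sum>q\<in>Q. G q y)"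
        using G_zero y by (intro sum.mono_neutral_right) (auto simp: Q_def)
      also have "\<dots> = (\<Sum>q\<in>Q. G q x * \<phi> q y)"
        using y by (intro sum.cong) (auto simp: \<phi>_def Q_def)
      also have "\<dots> = (\<Sum>f\<in>\<phi> ` Q. \<Sum>q\<in>{q \<in> Q. \<phi> q = f}. G q x * \<phi> q y)"
        by (rule sum.image_gen[OF \<open>finite Q\<close>])
      also have "\<dots> = (\<Sum>f\<in>\<phi> ` Q. c f * f y)"
        unfolding c_def sum_distrib_right by (intro sum.cong refl) auto
      finally show ?thesis .
    qed
    then have "sqnorm \<mu> (\<lambda>y. h y - (\<Sum>f\<in>\<phi> ` Q. c f * f y)) = sqnorm \<mu> (\<lambda>y. h y - F y)"
      by (intro sqnorm_cong) (simp add: space_eq)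
    then have "(LINT y|\<mu>. (cmod (h y - (\<Sum>f\<in>\<phi> ` Q. c f * f y)))\<^sup>2) < \<epsilon>"
      using F(2) by (simp add: sqnorm_def)
    moreover have "\<phi> ` Q \<subseteq> \<Phi>" using \<phi>_eigen by (auto simp: \<Phi>_def)
    ultimately show "\<exists>F c. finite F \<and> F \<subseteq> \<Phi> \<and> (LINT y|\<mu>. (cmod (h y - (\<Sum>f\<in>F. c f * f y)))\<^sup>2) < \<epsilon>"
      using \<open>finite Q\<close> by blast
  qed
  moreover have "eigenfunction \<mu> \<phi>" if \<phi>: "\<phi> \<in> \<Phi>" for \<phi>
  proof -
    obtain \<omega> where \<omega>: "rational_eigenfunction \<omega> \<phi>" using \<phi> by (auto simp: \<Phi>_def)
    then have "AE y in \<mu>. \<phi> (shift y) = \<omega> * \<phi> y"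
      by (intro AE_I2) (simp add: space_eq rational_eigenfunction_def)
    then show ?thesis
      using \<omega> local_fun_L2 unfolding eigenfunction_def rational_eigenfunction_def by blast
  qed
  ultimately show ?thesis unfolding discrete_spectrum_def by blast
qed

end

section \<open>The trichotomy\<close>

text \<open>With \<open>k\<close> the distance of two equal letters, everything is decided by whether \<open>x\<close> has coincidences at
  distance \<open>k\<close> and whether \<open>X\<close> is finite.\<close>

theorem corollary1p3:
  fixes \<theta> :: "'a::finite \<Rightarrow> 'a list"
    and d :: "(int \<Rightarrow> 'a) \<Rightarrow> (int \<Rightarrow> 'a) \<Rightarrow> real"
    and \<mu> :: "(int \<Rightarrow> 'a) measure"
  assumes "substitution \<theta>" and "primitive \<theta>" and "constant_length \<theta>"
    and "induces_shift_topology d"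
    and "invariant_prob (substitution_subshift \<theta>) \<mu>"
  shows "(has_ac d (substitution_subshift \<theta>) 0 \<longleftrightarrow> finite (substitution_subshift \<theta>)) \<and>
     (1 \<le> lower_ac d (substitution_subshift \<theta>) \<and>
       lower_ac d (substitution_subshift \<theta>) \<le> upper_ac d (substitution_subshift \<theta>) \<and>
       upper_ac d (substitution_subshift \<theta>) < \<infinity> \<longleftrightarrow>
       discrete_spectrum \<mu> \<and> infinite (substitution_subshift \<theta>)) \<and>
     (has_ac d (substitution_subshift \<theta>) \<infinity> \<longleftrightarrow> partly_continuous_spectrum \<mu>)"
proof -
  obtain x l where X: "substitution_subshift \<theta> = orbit_closure x" and "self_similar x l"
    by (rule substitution_subshift_self_similar[OF assms(1-3)])
  then interpret self_similar_measure x l \<mu>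
    using assms(5) by (simp add: self_similar_measure_def self_similar_measure_axioms_def)
  obtain k i where k: "k > 0" "x i = x (i + k)" by (rule exists_return)
  have mono: "lower_ac d X \<le> upper_ac d X" by (rule lower_ac_le_upper_ac)
  have nonneg: "0 \<le> lower_ac d X" by (rule lower_ac_nonneg)
  have fin: "upper_ac d X \<le> 0" if "finite X" using that by (rule finite_imp_upper_ac_le_0)
  have inf: "1 \<le> lower_ac d X" if "infinite X"
    using infinite_imp_aperiodic[OF that] assms(4) by (intro aperiodic_imp_lower_ac_ge_1)
  have coin: "upper_ac d X < \<infinity>" "discrete_spectrum \<mu>" if "coincident k"
    using coincident_imp_upper_ac_finite[OF that k(1) assms(4)]
      coincident_imp_discrete_spectrum[OF that k(1)] by auto
  have not_coin: "lower_ac d X = \<infinity>" "\<not> discrete_spectrum \<mu>" if "\<not> coincident k"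
    using not_coincident_imp_lower_ac_infinite[OF k(2,1) that assms(4)]
      discrete_spectrum_imp_coincident[OF k(2,1)] that by auto
  have "has_ac d X 0 \<longleftrightarrow> finite X"
  proof
    assume "has_ac d X 0"
    then show "finite X" using inf by (auto simp: has_ac_def)
  next
    assume "finite X"
    then show "has_ac d X 0" using fin mono nonneg by (auto simp: has_ac_def intro: order_antisym order_trans)
  qed
  moreover have "1 \<le> lower_ac d X \<and> lower_ac d X \<le> upper_ac d X \<and> upper_ac d X < \<infinity> \<longleftrightarrow>
      discrete_spectrum \<mu> \<and> infinite X"
  proof (cases "coincident k")
    case True
    have "\<not> 1 \<le> lower_ac d X" if "finite X"
    proof
      assume "1 \<le> lower_ac d X"
      then have "(1::ereal) \<le> 0" using fin[OF that] mono by (meson order_trans)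
      then show False by simp
    qed
    then show ?thesis using coin[OF True] mono inf by blast
  next
    case False
    then show ?thesis using not_coin[OF False] mono by auto
  qed
  moreover have "has_ac d X \<infinity> \<longleftrightarrow> partly_continuous_spectrum \<mu>"
  proof (cases "coincident k")
    case True
    then show ?thesis using coin[OF True] by (auto simp: has_ac_def partly_continuous_spectrum_def)
  next
    case False
    then show ?thesis using not_coin[OF False] mono
      by (auto simp: has_ac_def partly_continuous_spectrum_def)
  qed
  ultimately show ?thesis unfolding X by blast
qed

end
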